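(* Let $\Delta$ be a $d$-dimensional Cohen-Macaulay simplicial complex over a field $\mathbb{K}$ on vertex set $[n]$, let $R=\mathbb{K}[x_1,\dots,x_n]$ and $L=x_1+\dots+x_n$. Assume $\theta_1,\dots,\theta_{d+1}$ is an $(L,\mathbf{a})$-unexpected system of parameters of $\Delta$ of total degree $t$, where $\mathbf{a}=(a_1,\dots,a_n)\in\mathbb{N}^n$. Then the monomial algebra $$A=\frac{R}{I_\Delta+(x_1^{a_1},\dots,x_n^{a_n})}$$ fails the weak Lefschetz property due to surjectivity in degree $t-1$.
   Context: $I_\Delta=(\prod_{i\in\sigma}x_i:\sigma\notin\Delta)\subset R$ is the Stanley-Reisner ideal. $\Delta$ is Cohen-Macaulay over $\mathbb{K}$ if $\tilde H_i(\mathrm{link}_\Delta(\sigma);\mathbb{K})=0$ for all $\sigma\in\Delta$ and $i<\dim\mathrm{link}_\Delta(\sigma)$. $\mathrm{HF}(i,A)=\dim_{\mathbb{K}}A_i$. $h_\Delta(x)$ is the $h$-polynomial: the Hilbert series of $R/I_\Delta$ is $h_\Delta(x)/(1-x)^{d+1}$. For a homogeneous $f\in R$, an integer $t\ge\deg h_\Delta(x)$ and $\mathbf{a}\in\mathbb{N}^n$, a sequence $\theta_1,\dots,\theta_{d+1}\in R$ is an $(f,\mathbf{a})$-unexpected system of parameters of total degree $t$ if: (U1) $\theta_1,\dots,\theta_{d+1}$ is a homogeneous system of parameters of $I_\Delta$, i.e. the $\theta_i$ are homogeneous and $R/(I_\Delta+(\theta_1,\dots,\theta_{d+1}))$ is a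 finite dimensional $\mathbb{K}$-vector space; (U2) $\deg\theta_1+\dots+\deg\theta_{d+1}+\deg h_\Delta(x)-d-1=t$; (U3) $f\in I_\Delta+(\theta_1,\dots,\theta_{d+1})$; (U4) $x_i^{a_i}\in I_\Delta+(\theta_1,\dots,\theta_{d+1})$ for every $i$; (U5) $\mathrm{HF}(t,R/J)\le\mathrm{HF}(t-\deg f,R/J)$, where $J=I_\Delta+(x_1^{a_1},\dots,x_n^{a_n})$. A standard graded artinian algebra $A$ has the weak Lefschetz property (WLP) if there is a linear form $\ell$ such that every map $\times\ell:A_i\to A_{i+1}$ has full rank; for monomial algebras this is equivalent to $L=x_1+\dots+x_n$ having this property. "$A$ fails the WLP due to surjectivity in degree $t-1$" means that $\dim A_{t}\le\dim A_{t-1}$ but $\times L:A_{t-1}\to A_t$ is not surjective (so it does not have full rank).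
   Formalization: The parameters θ_1,…,θ_{d+1} are required to have positive degree, as is usual for a homogeneous system of parameters; if constants were allowed, e.g. θ=(1,x_1^5) for the full simplex on two vertices with a=(1,1), the claim would be false. *)

theory Defs
  imports
    "HOL-Library.Poly_Mapping"
    "HOL-Computational_Algebra.Polynomial_FPS"
begin

text \<open>
  Throughout, the vertex set \<open>[n]\<close> is a finite linearly ordered type \<open>'v\<close> with
  \<open>n\<close> elements (the order only fixes signs in the simplicial boundary map), and
  \<open>R = K[x\<^sub>1,\<dots>,x\<^sub>n]\<close> is the whole type \<open>('v, 'k) mpol\<close> with its ring structure from
  \<^theory>\<open>HOL-Library.Poly_Mapping\<close>. A quotient \<open>R/J\<close> is represented by \<open>J\<close>.
\<close>


section \<open>Polynomials in finitely many variables\<close>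

type_synonym ('v, 'k) mpol = "('v \<Rightarrow>\<^sub>0 nat) \<Rightarrow>\<^sub>0 'k"

definition var :: "'v \<Rightarrow> ('v, 'k::comm_ring_1) mpol" where
  "var v = Poly_Mapping.single (Poly_Mapping.single v 1) 1"

definition smul :: "'k::comm_ring_1 \<Rightarrow> ('v, 'k) mpol \<Rightarrow> ('v, 'k) mpol" where
  "smul c p = Poly_Mapping.single 0 c * p"

global_interpretation pvs: vector_space "smul :: 'k::field \<Rightarrow> ('v, 'k) mpol \<Rightarrow> ('v, 'k) mpol"
  by unfold_locales
    (simp_all add: smul_def distrib_left distrib_right single_add mult.assoc[symmetric] mult_single)

text \<open>\<open>pideal.span G\<close> is the ideal generated by \<open>G\<close>.\<close>

global_interpretation pideal: module "times :: 'a \<Rightarrow> 'a \<Rightarrow> 'a::comm_ring_1"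
  by unfold_locales (simp_all add: algebra_simps)

definition mdeg :: "('v::finite \<Rightarrow>\<^sub>0 nat) \<Rightarrow> nat" where
  "mdeg m = (\<Sum>v\<in>UNIV. Poly_Mapping.lookup m v)"

text \<open>Total degree; the zero polynomial gets degree \<open>0\<close>.\<close>

definition tdeg :: "('v::finite, 'k::zero) mpol \<Rightarrow> nat" where
  "tdeg p = Max (insert 0 (mdeg ` Poly_Mapping.keys p))"

text \<open>The graded component \<open>R\<^sub>i\<close>, which is \<open>{0}\<close> for negative \<open>i\<close>.\<close>

definition hcomp :: "int \<Rightarrow> ('v::finite, 'k::zero) mpol set" where
  "hcomp i = {p. \<forall>m\<in>Poly_Mapping.keys p. int (mdeg m) = i}"

definition homogeneous :: "('v::finite, 'k::zero) mpol \<Rightarrow> bool" where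
  "homogeneous p \<longleftrightarrow> (\<exists>i. p \<in> hcomp i)"


section \<open>Quotients of the polynomial ring\<close>

text \<open>
  The residue classes of the elements of \<open>B\<close> are pairwise distinct and form a finite
  \<open>K\<close>-basis of the image of \<open>V\<close> in \<open>R/U\<close>.
\<close>

definition quot_basis ::
    "('v, 'k::field) mpol set \<Rightarrow> ('v, 'k) mpol set \<Rightarrow> ('v, 'k) mpol set \<Rightarrow> bool" where
  "quot_basis V U B \<longleftrightarrow> finite B \<and> B \<subseteq> V \<and> V \<subseteq> pvs.span (B \<union> U) \<and>
     (\<forall>c. (\<Sum>b\<in>B. smul (c b) b) \<in> U \<longrightarrow> (\<forall>b\<in>B. c b = 0))"

definition quot_dim :: "('v, 'k::field) mpol set \<Rightarrow> ('v, 'k) mpol set \<Rightarrow> nat" where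
  "quot_dim V U = card (SOME B. quot_basis V U B)"

definition quot_finite_dim :: "('v, 'k::field) mpol set \<Rightarrow> bool" where
  "quot_finite_dim U \<longleftrightarrow> (\<exists>B. finite B \<and> pvs.span (B \<union> U) = UNIV)"

text \<open>\<open>HF(i, R/J)\<close>: for homogeneous \<open>J\<close>, the component \<open>(R/J)\<^sub>i\<close> is the image of \<open>R\<^sub>i\<close> in \<open>R/J\<close>.\<close>

definition HF :: "int \<Rightarrow> ('v::finite, 'k::field) mpol set \<Rightarrow> nat" where
  "HF i J = quot_dim (hcomp i) J"


section \<open>Simplicial complexes\<close>

text \<open>
  A complex contains the empty face, but a vertex \<open>v\<close> need not satisfy \<open>{v} \<in> \<Delta>\<close>; in
  particular \<open>\<Delta> = {{}}\<close>, of dimension \<open>-1\<close>, is allowed.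
\<close>

definition simplicial_complex :: "'v::finite set set \<Rightarrow> bool" where
  "simplicial_complex \<Delta> \<longleftrightarrow> \<Delta> \<noteq> {} \<and> (\<forall>\<sigma>\<in>\<Delta>. \<forall>\<tau>. \<tau> \<subseteq> \<sigma> \<longrightarrow> \<tau> \<in> \<Delta>)"

definition cx_dim :: "'v::finite set set \<Rightarrow> int" where
  "cx_dim \<Delta> = int (Max (card ` \<Delta>)) - 1"

definition link :: "'v set set \<Rightarrow> 'v set \<Rightarrow> 'v set set" where
  "link \<Delta> \<sigma> = {\<tau> \<in> \<Delta>. \<tau> \<inter> \<sigma> = {} \<and> \<tau> \<union> \<sigma> \<in> \<Delta>}"

text \<open>
  The augmented oriented chain complex of \<open>\<Delta>\<close>: an \<open>i\<close>-chain is a function on sets supported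
  on the faces of dimension \<open>i\<close>, where \<open>i = -1\<close> belongs to the empty face. The face
  \<open>{v\<^sub>0 < \<dots> < v\<^sub>k}\<close> has boundary \<open>\<Sum>j. (-1) ^ j \<cdot> {v\<^sub>0, \<dots>, v\<^sub>k} - {v\<^sub>j}\<close>; below, the
  coefficient of the boundary of \<open>c\<close> at \<open>\<tau>\<close> collects the contributions of all \<open>\<tau> \<union> {v}\<close>.
\<close>

definition chains :: "'v::finite set set \<Rightarrow> int \<Rightarrow> ('v set \<Rightarrow> 'k::field) set" where
  "chains \<Delta> i = {c. \<forall>\<sigma>. c \<sigma> \<noteq> 0 \<longrightarrow> \<sigma> \<in> \<Delta> \<and> int (card \<sigma>) = i + 1}"

definition boundary :: "('v::{finite,linorder} set \<Rightarrow> 'k::field) \<Rightarrow> ('v set \<Rightarrow> 'k)" where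
  "boundary c = (\<lambda>\<tau>. \<Sum>v\<in>- \<tau>. (-1) ^ card {w \<in> \<tau>. w < v} * c (insert v \<tau>))"

definition cycles :: "'v::{finite,linorder} set set \<Rightarrow> int \<Rightarrow> ('v set \<Rightarrow> 'k::field) set" where
  "cycles \<Delta> i = {c \<in> chains \<Delta> i. boundary c = (\<lambda>_. 0)}"

definition boundaries :: "'v::{finite,linorder} set set \<Rightarrow> int \<Rightarrow> ('v set \<Rightarrow> 'k::field) set" where
  "boundaries \<Delta> i = boundary ` chains \<Delta> (i + 1)"

text \<open>Vanishing of the reduced homology group of \<open>\<Delta>\<close> in degree \<open>i\<close> with coefficients in \<open>'k\<close>.\<close>

definition red_homology_zero ::
    "'k::field itself \<Rightarrow> 'v::{finite,linorder} set set \<Rightarrow> int \<Rightarrow> bool" where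
  "red_homology_zero _ \<Delta> i \<longleftrightarrow>
     (cycles \<Delta> i :: ('v set \<Rightarrow> 'k) set) = boundaries \<Delta> i"

definition cohen_macaulay ::
    "'k::field itself \<Rightarrow> 'v::{finite,linorder} set set \<Rightarrow> bool" where
  "cohen_macaulay K \<Delta> \<longleftrightarrow>
     (\<forall>\<sigma>\<in>\<Delta>. \<forall>i. i < cx_dim (link \<Delta> \<sigma>) \<longrightarrow> red_homology_zero K (link \<Delta> \<sigma>) i)"

definition SR_ideal :: "'v::finite set set \<Rightarrow> ('v, 'k::field) mpol set" where
  "SR_ideal \<Delta> = pideal.span {\<Prod>i\<in>\<sigma>. var i | \<sigma>. \<sigma> \<notin> \<Delta>}"

text \<open>
  The polynomial \<open>h\<close> with \<open>\<Sum>i. HF(i, R/I\<^sub>\<Delta>) x\<^sup>i = h(x) / (1 - x) ^ (d + 1)\<close>. The type argument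
  is the coefficient field.
\<close>

definition h_poly :: "'k::field itself \<Rightarrow> 'v::finite set set \<Rightarrow> int poly" where
  "h_poly _ \<Delta> = (THE h. fps_of_poly h =
     Abs_fps (\<lambda>i. int (HF (int i) (SR_ideal \<Delta> :: ('v, 'k) mpol set)))
       * (1 - fps_X) ^ nat (cx_dim \<Delta> + 1))"


section \<open>Unexpected systems of parameters\<close>

text \<open>
  The ideals \<open>I\<^sub>\<Delta> + (\<theta>\<^sub>1,\<dots>,\<theta>\<^sub>m)\<close> and \<open>I\<^sub>\<Delta> + (x\<^sub>1\<^bsup>a\<^sub>1\<^esup>,\<dots>,x\<^sub>n\<^bsup>a\<^sub>n\<^esup>)\<close>.
\<close>

definition sop_ideal ::
    "'v::finite set set \<Rightarrow> ('v, 'k::field) mpol list \<Rightarrow> ('v, 'k) mpol set" where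
  "sop_ideal \<Delta> \<theta> = pideal.span (SR_ideal \<Delta> \<union> set \<theta>)"

definition power_ideal ::
    "'v::finite set set \<Rightarrow> ('v \<Rightarrow> nat) \<Rightarrow> ('v, 'k::field) mpol set" where
  "power_ideal \<Delta> a = pideal.span (SR_ideal \<Delta> \<union> range (\<lambda>i. var i ^ a i))"

text \<open>
  As usual, parameters lie in the irrelevant maximal ideal, i.e. have positive degree. (Otherwise
  the sequence \<open>1, 0, \<dots>, 0\<close> would qualify.)
\<close>

definition hsop :: "'v::finite set set \<Rightarrow> ('v, 'k::field) mpol list \<Rightarrow> bool" where
  "hsop \<Delta> \<theta> \<longleftrightarrow> int (length \<theta>) = cx_dim \<Delta> + 1 \<and>
     (\<forall>p\<in>set \<theta>. homogeneous p \<and> tdeg p > 0) \<and> quot_finite_dim (sop_ideal \<Delta> \<theta>)"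

definition unexpected_sop ::
    "'v::finite set set \<Rightarrow> ('v, 'k::field) mpol \<Rightarrow> ('v \<Rightarrow> nat) \<Rightarrow> int \<Rightarrow> ('v, 'k) mpol list \<Rightarrow> bool"
where
  "unexpected_sop \<Delta> f a t \<theta> \<longleftrightarrow>
     homogeneous f \<and> t \<ge> int (degree (h_poly TYPE('k) \<Delta>)) \<and>
     hsop \<Delta> \<theta> \<and>
     (\<Sum>p\<leftarrow>\<theta>. int (tdeg p)) + int (degree (h_poly TYPE('k) \<Delta>)) - cx_dim \<Delta> - 1 = t \<and>
     f \<in> sop_ideal \<Delta> \<theta> \<and>
     (\<forall>i. var i ^ a i \<in> sop_ideal \<Delta> \<theta>) \<and>
     HF t (power_ideal \<Delta> a :: ('v, 'k) mpol set)
       \<le> HF (t - int (tdeg f)) (power_ideal \<Delta> a :: ('v, 'k) mpol set)"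


section \<open>The weak Lefschetz property\<close>

text \<open>
  Full rank and surjectivity of \<open>\<times>l : A\<^sub>i \<rightarrow> A\<^sub>i\<^sub>+\<^sub>1\<close> for \<open>A = R/J\<close>. The image of this map is
  the image of \<open>l R\<^sub>i\<close> in \<open>R/J\<close>.
\<close>

definition mult_full_rank ::
    "('v::finite, 'k::field) mpol set \<Rightarrow> ('v, 'k) mpol \<Rightarrow> int \<Rightarrow> bool" where
  "mult_full_rank J l i \<longleftrightarrow> quot_dim ((*) l ` hcomp i) J = min (HF i J) (HF (i + 1) J)"

definition mult_surj ::
    "('v::finite, 'k::field) mpol set \<Rightarrow> ('v, 'k) mpol \<Rightarrow> int \<Rightarrow> bool" where
  "mult_surj J l i \<longleftrightarrow> (\<forall>p\<in>hcomp (i + 1). \<exists>q\<in>hcomp i. l * q - p \<in> J)"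

definition WLP :: "('v::finite, 'k::field) mpol set \<Rightarrow> bool" where
  "WLP J \<longleftrightarrow> (\<exists>l\<in>hcomp 1. \<forall>i. mult_full_rank J l i)"

definition sum_vars :: "('v::finite, 'k::field) mpol" where
  "sum_vars = (\<Sum>i\<in>UNIV. var i)"

text \<open>
  The last two conditions are the failure of surjectivity in degree \<open>i\<close> for \<open>L\<close>, the sum of the
  variables; the first one refers to all linear forms.
\<close>

definition fails_WLP_surjectivity :: "('v::finite, 'k::field) mpol set \<Rightarrow> int \<Rightarrow> bool" where
  "fails_WLP_surjectivity J i \<longleftrightarrow>
     \<not> WLP J \<and> HF (i + 1) J \<le> HF i J \<and> \<not> mult_surj J sum_vars i"

end

theory Submission
  imports Defs "HOL-Library.Function_Algebras"
begin

text \<open>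
  Let \<open>S = R/I\<^sub>\<Delta>\<close> have dimension \<open>D = d + 1\<close>. Surjectivity of \<open>\<times>L\<close> on \<open>A\<close> in degree \<open>t - 1\<close> would give
  \<open>(S/\<theta>S)\<^sub>t = 0\<close>, because \<open>L\<close> and all \<open>x\<^sub>i\<^bsup>a\<^sub>i\<^esup>\<close> lie in \<open>I\<^sub>\<Delta> + (\<theta>)\<close>. We exclude this by constructing a
  nonzero linear functional on a component \<open>R\<^sub>s\<close> with \<open>s \<ge> t\<close> that kills \<open>I\<^sub>\<Delta> + (\<theta>)\<close>; as \<open>S/\<theta>S\<close> is
  generated in degree \<open>0\<close>, then also \<open>(S/\<theta>S)\<^sub>t \<noteq> 0\<close>.

  The functional comes from a zigzag through a double complex: the graded dual of the Cech complex
  \<open>S \<rightarrow> \<Oplus> S\<^bsub>x\<^sub>v\<^esub> \<rightarrow> \<dots>\<close> (terms indexed by faces \<open>F\<close>) tensored with the Koszul complex of \<open>\<theta>\<close>. In the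
  face direction each multidegree is the chain complex of a link or of a cone, so it is exact below
  the top by the Cohen-Macaulay property (which also implies purity). In the Koszul direction it is
  exact wherever \<open>F \<noteq> {}\<close>, since a variable of \<open>F\<close> is invertible there and one of its powers lies in
  \<open>I\<^sub>\<Delta> + (\<theta>)\<close>. The zigzag starts from a top-dimensional cycle on the link of a face \<open>\<tau>\<close> and ends in
  degree \<open>\<Sum> deg \<theta>\<^sub>i - |\<tau>|\<close>. Expanding the \<open>h\<close>-polynomial in powers of \<open>1 - x\<close> writes its coefficients
  as Euler characteristics of links, hence a suitable \<open>\<tau>\<close> exists with \<open>|\<tau>| \<le> D - deg h\<close>.
\<close>

text \<open>The textbook route goes through Reisner's criterion: \<open>S\<close> is a
  Cohen-Macaulay ring, \<theta> is regular on it, and the top degree of \<open>S/\<theta>S\<close>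
  is read off the h-polynomial. Here the vanishing of link homology enters directly, as exactness in
  one direction of the double complex. The start sits at the Laurent exponent that is -1 on \<tau>
  and 0 elsewhere, with all indices of \<theta> in its Koszul index set. Removing the index i from
  that set raises the degree by \<open>deg i\<close>, whence the final degree; since t is the sum of
  the \<open>deg i\<close> plus deg h - D, the bound on |\<tau>| makes this degree at least t. The
  start must not be the Koszul image of a cycle in the face direction. For this \<tau> is taken of
  least cardinality among the faces whose link has top homology. Contraction with a form of positive
  degree reads values in strictly larger total degree. An exponent there without positive entries
  has fewer than |\<tau>| negative ones, so its link is acyclic at the top; an exponent with a
  positive entry gives a cone. Hence every cycle on D-element faces there bounds, and it is 0
  because no larger faces exist.\<close>

text \<open>As a simp rule, \<open>pideal.scale_scale\<close> reassociates every product and makes \<open>ac_simps\<close> loop.\<close>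

declare pideal.scale_scale [simp del]

section \<open>Signs and Koszul complexes\<close>

lemma sum_antisym_eq_0:
  fixes f :: "'a \<Rightarrow> 'a \<Rightarrow> 'b::ab_group_add"
  assumes "finite I" and "\<And>i j. i \<in> I \<Longrightarrow> j \<in> I \<Longrightarrow> f i j = - f j i" and "\<And>i. i \<in> I \<Longrightarrow> f i i = 0"
  shows "(\<Sum>i\<in>I. \<Sum>j\<in>I. f i j) = 0"
  using assms
proof (induction I rule: finite_induct)
  case (insert x I)
  have "(\<Sum>j\<in>I. f x j) = - (\<Sum>i\<in>I. f i x)"
    unfolding sum_negf[symmetric] by (rule sum.cong[OF refl], rule insert.prems(1)) simp_all
  moreover have "(\<Sum>i\<in>I. \<Sum>j\<in>I. f i j) = 0"
    by (rule insert.IH; rule insert.prems) simp_all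
  moreover have "f x x = 0"
    by (rule insert.prems) simp
  ultimately show ?case
    using insert.hyps by (simp add: sum.distrib)
qed simp

definition face_sign :: "'a::linorder \<Rightarrow> 'a set \<Rightarrow> 'k::field" where
  "face_sign v \<tau> = (-1) ^ card {w \<in> \<tau>. w < v}"

lemma face_sign_mult_self [simp]: "face_sign v \<tau> * face_sign v \<tau> = (1::'k::field)"
  by (simp add: face_sign_def power_mult_distrib[symmetric])

lemma face_sign_mult_self_left [simp]: "face_sign v \<tau> * (face_sign v \<tau> * x) = (x::'k::field)"
  by (simp add: mult.assoc[symmetric])

lemma face_sign_insert:
  assumes "finite \<tau>" "v \<notin> \<tau>"
  shows "face_sign w (insert v \<tau>) = (if v < w then - face_sign w \<tau> else (face_sign w \<tau> :: 'k::field))"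
proof (cases "v < w")
  case True
  then have "{x \<in> insert v \<tau>. x < w} = insert v {x \<in> \<tau>. x < w}" by auto
  with True assms show ?thesis by (simp add: face_sign_def)
next
  case False
  then have "{x \<in> insert v \<tau>. x < w} = {x \<in> \<tau>. x < w}" by auto
  with False show ?thesis by (simp add: face_sign_def)
qed

lemma boundary_face_sign: "boundary c \<tau> = (\<Sum>v\<in>-\<tau>. face_sign v \<tau> * c (insert v \<tau>))"
  by (simp add: boundary_def face_sign_def)

lemma boundary_boundary:
  fixes c :: "'v::{finite,linorder} set \<Rightarrow> 'k::field"
  shows "boundary (boundary c) = (\<lambda>_. 0)"
proof
  fix \<tau> :: "'v set"
  \<comment> \<open>Padding with 0 on the diagonal makes both indices range over the same set, as
    the antisymmetry argument requires.\<close>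
  define f where "f v w = (if v = w then 0 else face_sign v \<tau> * (face_sign w (insert v \<tau>) * c (insert w (insert v \<tau>))))" for v w
  have "boundary (boundary c) \<tau> = (\<Sum>v\<in>-\<tau>. \<Sum>w\<in>-\<tau>. f v w)"
    unfolding boundary_face_sign sum_distrib_left
  proof (rule sum.cong[OF refl])
    fix v assume v: "v \<in> -\<tau>"
    have "(\<Sum>w\<in>- insert v \<tau>. face_sign v \<tau> * (face_sign w (insert v \<tau>) * c (insert w (insert v \<tau>))))
       = (\<Sum>w\<in>- insert v \<tau>. f v w)"
      by (intro sum.cong) (auto simp: f_def)
    also have "\<dots> = (\<Sum>w\<in>-\<tau>. f v w)"
      by (intro sum.mono_neutral_left) (auto simp: f_def)
    finally show "(\<Sum>w\<in>- insert v \<tau>. face_sign v \<tau> * (face_sign w (insert v \<tau>) * c (insert w (insert v \<tau>))))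
       = (\<Sum>w\<in>-\<tau>. f v w)" .
  qed
  also have "\<dots> = 0"
  proof (rule sum_antisym_eq_0)
    fix v w assume "v \<in> - \<tau>" "w \<in> - \<tau>"
    then have "face_sign v \<tau> * (face_sign w (insert v \<tau>) * z) = - (face_sign w \<tau> * (face_sign v (insert w \<tau>) * z))"
      if "v \<noteq> w" for z :: 'k
      using that by (auto simp: face_sign_insert)
    then show "f v w = - f w v"
      by (simp add: f_def insert_commute[of w v])
  qed (auto simp: f_def)
  finally show "boundary (boundary c) \<tau> = 0" .
qed

section \<open>Linear operators on functions, and Koszul complexes of commuting operators\<close>

definition flinear :: "(('x \<Rightarrow> 'k::field) \<Rightarrow> ('y \<Rightarrow> 'k)) \<Rightarrow> bool" where
  "flinear P \<longleftrightarrow> (\<forall>f g. P (f + g) = P f + P g) \<and> (\<forall>c f. P (\<lambda>x. c * f x) = (\<lambda>y. c * P f y))"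

lemma flinearI:
  assumes "\<And>f g y. P (f + g) y = P f y + P g y" "\<And>c f y. P (\<lambda>x. c * f x) y = c * P f y"
  shows "flinear P"
  using assms by (auto simp: flinear_def fun_eq_iff)

lemma flinear_zero: "flinear P \<Longrightarrow> P (\<lambda>_. 0) = (\<lambda>_. 0)"
  unfolding flinear_def by (drule conjunct2, drule spec[of _ 0]) simp

lemma flinear_sum:
  assumes "flinear P"
  shows "P (\<lambda>x. \<Sum>i\<in>I. c i * f i x) = (\<lambda>y. \<Sum>i\<in>I. c i * P (f i) y)"
proof (induction I rule: infinite_finite_induct)
  case (insert i I)
  have "P (\<lambda>x. \<Sum>i\<in>insert i I. c i * f i x) = P ((\<lambda>x. c i * f i x) + (\<lambda>x. \<Sum>i\<in>I. c i * f i x))"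
    using insert.hyps by (simp add: plus_fun_def)
  also have "\<dots> = (\<lambda>y. c i * P (f i) y) + (\<lambda>y. \<Sum>i\<in>I. c i * P (f i) y)"
    using assms insert.IH by (simp add: flinear_def)
  finally show ?case using insert.hyps by (simp add: plus_fun_def)
qed (simp_all add: flinear_zero[OF assms])

lemma flinear_diff:
  assumes "flinear P"
  shows "P (f - g) = P f - P g"
proof -
  have "P f = P ((f - g) + g)" by simp
  also have "\<dots> = P (f - g) + P g" using assms by (simp only: flinear_def)
  finally show ?thesis by (simp add: fun_eq_iff)
qed

lemma flinear_add: "flinear P \<Longrightarrow> P (f + g) = P f + P g"
  by (simp add: flinear_def)

lemma flinear_scale: "flinear P \<Longrightarrow> P (\<lambda>x. c * f x) = (\<lambda>y. c * P f y)"
  by (simp add: flinear_def)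

text \<open>Dualizing turns the usual Koszul differential, which removes an index, into one that
  adds an index: the value at \<open>B\<close> collects the values at all
  \<open>B - {a}\<close>.\<close>

definition koszul :: "(nat \<Rightarrow> ('x \<Rightarrow> 'k::field) \<Rightarrow> 'x \<Rightarrow> 'k) \<Rightarrow> (nat set \<Rightarrow> 'x \<Rightarrow> 'k) \<Rightarrow> nat set \<Rightarrow> 'x \<Rightarrow> 'k" where
  "koszul P y B = (\<lambda>x. \<Sum>a\<in>B. face_sign a (B - {a}) * P a (y (B - {a})) x)"

lemma koszul_comm:
  assumes "flinear Q" "\<And>a A. a \<in> B \<Longrightarrow> Q (P a (y A)) = P a (Q (y A))"
  shows "koszul P (\<lambda>A. Q (y A)) B = Q (koszul P y B)"
  unfolding koszul_def flinear_sum[OF assms(1)] using assms(2) by simp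

lemma koszul_koszul:
  assumes lin: "\<And>a. flinear (P a)" and fin: "finite B"
    and comm: "\<And>a b A. P a (P b (y A)) = P b (P a (y A))"
  shows "koszul P (koszul P y) B = (\<lambda>_. 0)"
proof
  fix x
  define f where "f a b = (if a = b then 0 else
     face_sign a (B - {a}) * (face_sign b (B - {a} - {b}) * P a (P b (y (B - {a} - {b}))) x))" for a b
  have "koszul P (koszul P y) B x = (\<Sum>a\<in>B. \<Sum>b\<in>B. f a b)"
    unfolding koszul_def flinear_sum[OF lin] sum_distrib_left
  proof (rule sum.cong[OF refl])
    fix a assume a: "a \<in> B"
    have "(\<Sum>b\<in>B - {a}. face_sign a (B - {a}) * (face_sign b (B - {a} - {b}) * P a (P b (y (B - {a} - {b}))) x))
        = (\<Sum>b\<in>B - {a}. f a b)"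
      by (intro sum.cong) (auto simp: f_def)
    also have "\<dots> = (\<Sum>b\<in>B. f a b)"
      by (intro sum.mono_neutral_left) (auto simp: f_def fin)
    finally show "(\<Sum>b\<in>B - {a}. face_sign a (B - {a}) * (face_sign b (B - {a} - {b}) * P a (P b (y (B - {a} - {b}))) x))
        = (\<Sum>b\<in>B. f a b)" .
  qed
  also have "\<dots> = 0"
  proof (rule sum_antisym_eq_0)
    fix a b assume ab: "a \<in> B" "b \<in> B"
    show "f a b = - f b a"
    proof (cases "a = b")
      case False
      define C where "C = B - {a} - {b}"
      have C: "B - {a} = insert b C" "B - {b} = insert a C" "B - {b} - {a} = C" "a \<notin> C" "b \<notin> C" "finite C"
        using ab False fin by (auto simp: C_def)
      have "insert b C - {b} = C" using C by auto
      then have "f a b = face_sign a (insert b C) * (face_sign b C * P a (P b (y C)) x)"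
        using False unfolding f_def C(1) by simp
      moreover have "f b a = face_sign b (insert a C) * (face_sign a C * P b (P a (y C)) x)"
        using False unfolding f_def C(3) unfolding C(2) by simp
      moreover have "face_sign a (insert b C) * (face_sign b C * z) = - (face_sign b (insert a C) * (face_sign a C * z))" for z :: 'b
        using C(4-6) False by (auto simp: face_sign_insert mult.left_commute)
      ultimately show ?thesis by (simp only: comm[of b a])
    qed (simp add: f_def)
  qed (auto simp: f_def fin)
  finally show "koszul P (koszul P y) B x = 0" .
qed

text \<open>The \<open>G a\<close> define a contracting homotopy H. Writing K for the Koszul
  differential, KH + HK is the sum of all \<open>P a\<close> after \<open>G a\<close>, since the
  mixed terms cancel by their signs. This sum fixes \<open>y B\<close> by \<open>inv\<close>, and Ky
  = 0 by \<open>cyc\<close>, so Hy is a preimage.\<close>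

lemma koszul_exact:
  assumes linP: "\<And>a. flinear (P a)" and linG: "\<And>a. flinear (G a)" and fin: "finite I" and B: "B \<subseteq> I"
    and comm: "\<And>a b A. P a (G b (y A)) = G b (P a (y A))"
    and inv: "(\<lambda>x. \<Sum>a\<in>I. P a (G a (y B)) x) = y B"
    and cyc: "\<And>A. A \<subseteq> I \<Longrightarrow> koszul P y A = (\<lambda>_. 0)"
  shows "koszul P (\<lambda>A x. \<Sum>a\<in>I - A. face_sign a A * G a (y (insert a A)) x) B = y B"
proof
  fix x
  \<comment> \<open>\<open>Y a b\<close> is the mixed term in which the index \<open>a\<close> has
    been exchanged for \<open>b\<close>; it occurs in KH and in HK with opposite signs.\<close>
  define Y where "Y a b = P a (G b (y (insert b (B - {a})))) x" for a b
  have finB: "finite B" using B fin by (rule finite_subset)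
  have "koszul P (\<lambda>A x. \<Sum>a\<in>I - A. face_sign a A * G a (y (insert a A)) x) B x
     = (\<Sum>a\<in>B. \<Sum>b\<in>I - (B - {a}). face_sign a (B - {a}) * (face_sign b (B - {a}) * Y a b))"
    unfolding koszul_def flinear_sum[OF linP] sum_distrib_left Y_def ..
  also have "\<dots> = (\<Sum>a\<in>B. P a (G a (y B)) x
      + (\<Sum>b\<in>I - B. face_sign a (B - {a}) * (face_sign b (B - {a}) * Y a b)))"
  proof (intro sum.cong refl)
    fix a assume a: "a \<in> B"
    then have "I - (B - {a}) = insert a (I - B)" using B by auto
    then have "(\<Sum>b\<in>I - (B - {a}). face_sign a (B - {a}) * (face_sign b (B - {a}) * Y a b))
       = Y a a + (\<Sum>b\<in>I - B. face_sign a (B - {a}) * (face_sign b (B - {a}) * Y a b))"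
      using a fin by simp
    then show "(\<Sum>b\<in>I - (B - {a}). face_sign a (B - {a}) * (face_sign b (B - {a}) * Y a b))
       = P a (G a (y B)) x + (\<Sum>b\<in>I - B. face_sign a (B - {a}) * (face_sign b (B - {a}) * Y a b))"
      using a by (simp add: Y_def insert_absorb)
  qed
  finally have 1: "koszul P (\<lambda>A x. \<Sum>a\<in>I - A. face_sign a A * G a (y (insert a A)) x) B x
     = (\<Sum>a\<in>B. P a (G a (y B)) x)
      + (\<Sum>a\<in>B. \<Sum>b\<in>I - B. face_sign a (B - {a}) * (face_sign b (B - {a}) * Y a b))" by (simp add: sum.distrib)
  \<comment> \<open>HKy vanishes because y is a cycle, but its expansion supplies the diagonal terms
    for indices outside \<open>B\<close>, which KHy lacks.\<close>
  have "0 = (\<Sum>b\<in>I - B. face_sign b B * G b (koszul P y (insert b B)) x)"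
  proof -
    have "koszul P y (insert b B) = (\<lambda>_. 0)" if "b \<in> I - B" for b using that B by (intro cyc) auto
    then show ?thesis by (simp add: flinear_zero[OF linG])
  qed
  also have "\<dots> = (\<Sum>b\<in>I - B. P b (G b (y B)) x
      + (\<Sum>a\<in>B. face_sign b B * (face_sign a (insert b B - {a}) * Y a b)))"
  proof (intro sum.cong refl)
    fix b assume b: "b \<in> I - B"
    have "face_sign b B * G b (koszul P y (insert b B)) x
        = (\<Sum>a\<in>insert b B. face_sign b B * (face_sign a (insert b B - {a}) * P a (G b (y (insert b B - {a}))) x))"
      unfolding koszul_def flinear_sum[OF linG] sum_distrib_left comm ..
    also have "\<dots> = P b (G b (y B)) x
      + (\<Sum>a\<in>B. face_sign b B * (face_sign a (insert b B - {a}) * P a (G b (y (insert b B - {a}))) x))"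
      using b finB by simp
    also have "(\<Sum>a\<in>B. face_sign b B * (face_sign a (insert b B - {a}) * P a (G b (y (insert b B - {a}))) x))
        = (\<Sum>a\<in>B. face_sign b B * (face_sign a (insert b B - {a}) * Y a b))"
      using b by (intro sum.cong refl) (auto simp: Y_def insert_Diff_if)
    finally show "face_sign b B * G b (koszul P y (insert b B)) x = P b (G b (y B)) x
      + (\<Sum>a\<in>B. face_sign b B * (face_sign a (insert b B - {a}) * Y a b))" .
  qed
  also have "\<dots> = (\<Sum>b\<in>I - B. P b (G b (y B)) x)
      + (\<Sum>a\<in>B. \<Sum>b\<in>I - B. face_sign b B * (face_sign a (insert b B - {a}) * Y a b))"
    by (simp add: sum.distrib) (rule sum.swap)
  also have "(\<Sum>a\<in>B. \<Sum>b\<in>I - B. face_sign b B * (face_sign a (insert b B - {a}) * Y a b))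
    = (\<Sum>a\<in>B. \<Sum>b\<in>I - B. - (face_sign a (B - {a}) * (face_sign b (B - {a}) * Y a b)))"
  proof (intro sum.cong refl)
    fix a b assume ab: "a \<in> B" "b \<in> I - B"
    define C where "C = B - {a}"
    have C: "B = insert a C" "insert b B - {a} = insert b C" "a \<notin> C" "b \<notin> C" "finite C" "a \<noteq> b"
      using ab finB by (auto simp: C_def)
    have "face_sign b B * face_sign a (insert b C) = - (face_sign a C * face_sign b C :: 'b)"
      using C(3-) by (subst C(1)) (auto simp: face_sign_insert mult.commute)
    then show "face_sign b B * (face_sign a (insert b B - {a}) * Y a b) = - (face_sign a (B - {a}) * (face_sign b (B - {a}) * Y a b))"
      unfolding C(2) C_def[symmetric] mult.assoc[symmetric] by simp
  qed
  finally have 2: "(\<Sum>a\<in>B. \<Sum>b\<in>I - B. face_sign a (B - {a}) * (face_sign b (B - {a}) * Y a b))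
      = (\<Sum>b\<in>I - B. P b (G b (y B)) x)" by (simp add: sum_negf)
  have "(\<Sum>a\<in>I. P a (G a (y B)) x) = (\<Sum>a\<in>B. P a (G a (y B)) x) + (\<Sum>b\<in>I - B. P b (G b (y B)) x)"
    using sum.subset_diff[OF B fin, of "\<lambda>a. P a (G a (y B)) x"] by (simp add: add.commute)
  with 1 2 inv show "koszul P (\<lambda>A x. \<Sum>a\<in>I - A. face_sign a A * G a (y (insert a A)) x) B x = y B x"
    by (simp add: fun_eq_iff)
qed

section \<open>Contraction on functions of face and multidegree\<close>

definition pairing :: "('v, 'k::field) mpol \<Rightarrow> (('v \<Rightarrow>\<^sub>0 nat) \<Rightarrow> 'k) \<Rightarrow> 'k" where
  "pairing p \<phi> = (\<Sum>k\<in>Poly_Mapping.keys p. Poly_Mapping.lookup p k * \<phi> k)"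

lemma pairing_superset:
  assumes "finite S" "Poly_Mapping.keys p \<subseteq> S"
  shows "pairing p \<phi> = (\<Sum>k\<in>S. Poly_Mapping.lookup p k * \<phi> k)"
  unfolding pairing_def using assms by (intro sum.mono_neutral_left) (auto simp: in_keys_iff)

lemma pairing_add: "pairing (p + q) \<phi> = pairing p \<phi> + pairing q \<phi>"
  using Poly_Mapping.keys_add[of p q]
  by (simp add: pairing_superset[where S = "Poly_Mapping.keys p \<union> Poly_Mapping.keys q"]
      lookup_add distrib_right sum.distrib)

lemma pairing_zero [simp]: "pairing 0 \<phi> = 0"
  by (simp add: pairing_def)

lemma pairing_sum: "pairing (\<Sum>i\<in>I. p i) \<phi> = (\<Sum>i\<in>I. pairing (p i) \<phi>)"
  by (induction I rule: infinite_finite_induct) (simp_all add: pairing_add)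

lemma pairing_single [simp]: "pairing (Poly_Mapping.single k c) \<phi> = c * \<phi> k"
  by (simp add: pairing_def)

lemma pairing_uminus: "pairing (- p) \<phi> = - pairing p \<phi>"
  using pairing_add[of p "-p" \<phi>] by (simp add: add_eq_0_iff)

lemma pairing_diff: "pairing (p - q) \<phi> = pairing p \<phi> - pairing q \<phi>"
  using pairing_add[of p "-q" \<phi>] by (simp add: pairing_uminus)

lemma pairing_add_right: "pairing p (\<lambda>k. \<phi> k + \<psi> k) = pairing p \<phi> + pairing p \<psi>"
  by (simp add: pairing_def distrib_left sum.distrib)

lemma pairing_mult_right: "pairing p (\<lambda>k. c * \<phi> k) = c * pairing p \<phi>"
  by (simp add: pairing_def sum_distrib_left ac_simps)

lemma pairing_zero_right [simp]: "pairing p (\<lambda>k. 0) = 0"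
  by (simp add: pairing_def)

lemma pairing_sum_right: "pairing p (\<lambda>k. \<Sum>i\<in>I. \<phi> i k) = (\<Sum>i\<in>I. pairing p (\<phi> i))"
  by (induction I rule: infinite_finite_induct) (simp_all add: pairing_add_right)

lemma pairing_cong: "(\<And>k. k \<in> Poly_Mapping.keys p \<Longrightarrow> \<phi> k = \<psi> k) \<Longrightarrow> pairing p \<phi> = pairing p \<psi>"
  by (simp add: pairing_def)

lemma pairing_nonzeroD: "pairing p \<phi> \<noteq> 0 \<Longrightarrow> \<exists>k\<in>Poly_Mapping.keys p. \<phi> k \<noteq> 0"
  unfolding pairing_def by (metis (no_types, lifting) mult_zero_right sum.neutral)

lemma sum_single_lookup:
  "(\<Sum>k\<in>Poly_Mapping.keys p. Poly_Mapping.single k (Poly_Mapping.lookup p k)) = p"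
  by (rule poly_mapping_eqI)
    (auto simp: lookup_sum lookup_single when_def sum.delta in_keys_iff)

lemma pairing_mult: "pairing (p * q) \<phi> = pairing p (\<lambda>k. pairing q (\<lambda>l. \<phi> (k + l)))"
proof -
  have "p * q = (\<Sum>k\<in>Poly_Mapping.keys p. \<Sum>l\<in>Poly_Mapping.keys q.
      Poly_Mapping.single (k + l) (Poly_Mapping.lookup p k * Poly_Mapping.lookup q l))"
  proof -
    have "p * q = (\<Sum>k\<in>Poly_Mapping.keys p. Poly_Mapping.single k (Poly_Mapping.lookup p k))
        * (\<Sum>l\<in>Poly_Mapping.keys q. Poly_Mapping.single l (Poly_Mapping.lookup q l))"
      by (simp only: sum_single_lookup)
    then show ?thesis by (simp only: sum_product mult_single)
  qed
  then have "pairing (p * q) \<phi> = (\<Sum>k\<in>Poly_Mapping.keys p. \<Sum>l\<in>Poly_Mapping.keys q.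
      Poly_Mapping.lookup p k * Poly_Mapping.lookup q l * \<phi> (k + l))"
    by (simp only: pairing_sum pairing_single)
  then show ?thesis
    unfolding pairing_def[of p] pairing_def[of q] by (simp only: sum_distrib_left mult.assoc)
qed

lemma prod_var: "(\<Prod>i\<in>\<tau>. var i) = (Poly_Mapping.single (\<Sum>i\<in>\<tau>. Poly_Mapping.single i 1) 1 :: ('v, 'k::comm_ring_1) mpol)"
  by (induction \<tau> rule: infinite_finite_induct) (simp_all add: var_def mult_single)

lemma var_power: "var v ^ N = (Poly_Mapping.single (Poly_Mapping.single v N) 1 :: ('v, 'k::comm_ring_1) mpol)"
  by (induction N) (simp_all add: var_def mult_single single_add[symmetric])

lemma lookup_sum_single_1:
  "finite \<tau> \<Longrightarrow> Poly_Mapping.lookup (\<Sum>i\<in>\<tau>. Poly_Mapping.single i (1::nat)) v = (if v \<in> \<tau> then 1 else 0)"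
  by (auto simp: lookup_sum lookup_single when_def)

section \<open>Laurent exponents and the two commuting kinds of operators\<close>

definition up :: "('v \<Rightarrow> int) \<Rightarrow> ('v \<Rightarrow>\<^sub>0 nat) \<Rightarrow> ('v \<Rightarrow> int)" where
  "up m k = (\<lambda>v. m v + int (Poly_Mapping.lookup k v))"

definition neg :: "('v \<Rightarrow> int) \<Rightarrow> 'v set" where "neg m = {v. m v < 0}"

definition supp :: "('v \<Rightarrow> int) \<Rightarrow> 'v set" where "supp m = {v. m v \<noteq> 0}"

lemma up_add: "up (up m k) l = up m (k + l)"
  by (simp add: up_def lookup_add fun_eq_iff)

lemma neg_up: "neg (up m k) \<subseteq> neg m"
  by (auto simp: neg_def up_def)

text \<open>
  \<open>f (F, m)\<close> is the value on the Laurent monomial \<open>x\<^sup>m\<close> of a functional on the localization \<open>S\<^bsub>x\<^sub>F\<^esub>\<close>, in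
  which \<open>x\<^sup>m\<close> is nonzero iff \<open>m\<close> is negative only on \<open>F\<close> and \<open>F \<union> supp m\<close> is a face. Polynomials
  act by contraction, which involves no condition on the complex.
\<close>

type_synonym ('v, 'k) lfun = "'v set \<times> ('v \<Rightarrow> int) \<Rightarrow> 'k"

text \<open>The test on \<open>neg m\<close> is essential: adding the exponent of a monomial of
  \<open>p\<close> may lift \<open>m\<close> into the supported range although \<open>x^m\<close>
  itself does not lie in the localization at \<open>F\<close>.\<close>

definition contract :: "('v, 'k::field) mpol \<Rightarrow> ('v, 'k) lfun \<Rightarrow> ('v, 'k) lfun" where
  "contract p f = (\<lambda>(F, m). if neg m \<subseteq> F then pairing p (\<lambda>k. f (F, up m k)) else 0)"

lemma contract_apply: "contract p f (F, m) = (if neg m \<subseteq> F then pairing p (\<lambda>k. f (F, up m k)) else 0)"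
  by (simp add: contract_def)

lemma flinear_contract: "flinear (contract p)"
  by (rule flinearI) (auto simp: contract_def pairing_add_right pairing_mult_right)

lemma contract_mult:
  fixes f :: "('v, 'k::field) lfun"
  shows "contract (p * q) f = contract p (contract q f)"
proof
  fix x :: "'v set \<times> ('v \<Rightarrow> int)"
  obtain F m where x: "x = (F, m)" by (cases x)
  have "neg (up m k) \<subseteq> F" if "neg m \<subseteq> F" for k
    using that neg_up[of m k] by auto
  then show "contract (p * q) f x = contract p (contract q f) x"
    by (simp add: x contract_apply pairing_mult up_add)
qed

lemma contract_comm: "contract p (contract q f) = contract q (contract p f)"
  by (simp add: contract_mult[symmetric] mult.commute)

lemma contract_add: "contract (p + q) f = contract p f + contract q f"
  by (auto simp: contract_def pairing_add fun_eq_iff)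

lemma contract_zero [simp]: "contract 0 f = (\<lambda>_. 0)"
  by (auto simp: contract_def)

lemma contract_zero_right [simp]: "contract p (\<lambda>_. 0) = (\<lambda>_. 0)"
  by (auto simp: contract_def)

lemma contract_sum_apply: "contract (\<Sum>i\<in>I. p i) f x = (\<Sum>i\<in>I. contract (p i) f x)"
  by (cases x) (simp add: contract_apply pairing_sum)

text \<open>This is dual to the Cech differential, which adds a vertex to the face. The test
  discards the faces whose localization does not contain \<open>x^m\<close>.\<close>

definition face_boundary :: "('v::{finite,linorder}, 'k::field) lfun \<Rightarrow> ('v, 'k) lfun" where
  "face_boundary f = (\<lambda>(G, m). if neg m \<subseteq> G then boundary (\<lambda>F. f (F, m)) G else 0)"

lemma face_boundary_apply: "face_boundary f (G, m) = (if neg m \<subseteq> G then boundary (\<lambda>F. f (F, m)) G else 0)"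
  by (simp add: face_boundary_def)

lemma flinear_face_boundary: "flinear face_boundary"
  by (rule flinearI)
    (auto simp: face_boundary_def boundary_face_sign distrib_left sum.distrib sum_distrib_left ac_simps)

lemma face_boundary_face_boundary:
  fixes f :: "('v::{finite,linorder}, 'k::field) lfun"
  shows "face_boundary (face_boundary f) = (\<lambda>_. 0)"
proof
  fix x :: "'v set \<times> ('v \<Rightarrow> int)"
  obtain G m where x: "x = (G, m)" by (cases x)
  show "face_boundary (face_boundary f) x = 0"
  proof (cases "neg m \<subseteq> G")
    case True
    then have "neg m \<subseteq> insert v G" for v by auto
    then have "boundary (\<lambda>F. face_boundary f (F, m)) G = boundary (boundary (\<lambda>F. f (F, m))) G"
      unfolding boundary_face_sign[of "\<lambda>F. face_boundary f (F, m)"] boundary_face_sign[of "boundary _"]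
      by (simp add: face_boundary_apply)
    then show ?thesis by (simp add: x face_boundary_apply boundary_boundary)
  qed (simp add: x face_boundary_apply)
qed

lemma face_boundary_contract:
  fixes f :: "('v::{finite,linorder}, 'k::field) lfun"
  shows "face_boundary (contract p f) = contract p (face_boundary f)"
proof
  fix x :: "'v set \<times> ('v \<Rightarrow> int)"
  obtain G m where x: "x = (G, m)" by (cases x)
  show "face_boundary (contract p f) x = contract p (face_boundary f) x"
  proof (cases "neg m \<subseteq> G")
    case True
    then have "neg m \<subseteq> insert v G" "neg (up m k) \<subseteq> G" for v k using neg_up[of m k] by auto
    with True show ?thesis
      by (simp add: x face_boundary_apply contract_apply boundary_face_sign pairing_sum_right pairing_mult_right)
  qed (simp add: x face_boundary_apply contract_apply)
qed

section \<open>Support conditions imposed by the complex\<close>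

definition face_supported :: "'v set set \<Rightarrow> nat \<Rightarrow> ('v, 'k::field) lfun \<Rightarrow> bool" where
  "face_supported \<Delta> j f \<longleftrightarrow> (\<forall>F m. f (F, m) \<noteq> 0 \<longrightarrow> card F = j \<and> neg m \<subseteq> F \<and> F \<union> supp m \<in> \<Delta>)"

lemma face_supportedD: "face_supported \<Delta> j f \<Longrightarrow> f (F, m) \<noteq> 0 \<Longrightarrow> card F = j \<and> neg m \<subseteq> F \<and> F \<union> supp m \<in> \<Delta>"
  by (auto simp: face_supported_def)

lemma face_supported_zero: "face_supported \<Delta> j (\<lambda>_. 0)"
  by (simp add: face_supported_def)

lemma face_supported_diff: "face_supported \<Delta> j f \<Longrightarrow> face_supported \<Delta> j g \<Longrightarrow> face_supported \<Delta> j (f - g)"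
  unfolding face_supported_def by (metis diff_zero fun_diff_def)

lemma face_supported_sum:
  assumes "\<And>i. i \<in> I \<Longrightarrow> face_supported \<Delta> j (f i)"
  shows "face_supported \<Delta> j (\<lambda>x. \<Sum>i\<in>I. c i * f i x)"
  unfolding face_supported_def
proof (intro allI impI)
  fix F m assume "(\<Sum>i\<in>I. c i * f i (F, m)) \<noteq> 0"
  then obtain i where "i \<in> I" "c i * f i (F, m) \<noteq> 0" by (rule sum.not_neutral_contains_not_neutral)
  with face_supportedD[OF assms[of i], of F m] show "card F = j \<and> neg m \<subseteq> F \<and> F \<union> supp m \<in> \<Delta>" by auto
qed

context
  fixes \<Delta> :: "'v::{finite,linorder} set set"
  assumes sc: "simplicial_complex \<Delta>"
begin

lemma face_subset: "\<sigma> \<in> \<Delta> \<Longrightarrow> \<tau> \<subseteq> \<sigma> \<Longrightarrow> \<tau> \<in> \<Delta>"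
  using sc by (auto simp: simplicial_complex_def)

text \<open>Off \<open>F\<close> the exponent \<open>m\<close> is nonnegative, so raising it can
  only enlarge the support there. Being a face therefore passes from the raised exponent down to
  \<open>m\<close>.\<close>

lemma face_supported_contract:
  assumes "face_supported \<Delta> j f" shows "face_supported \<Delta> j (contract p f)"
  unfolding face_supported_def
proof (intro allI impI)
  fix F m assume *: "contract p f (F, m) \<noteq> 0"
  then have n: "neg m \<subseteq> F" by (auto simp: contract_apply split: if_splits)
  with * obtain k where "f (F, up m k) \<noteq> 0" by (auto simp: contract_apply dest: pairing_nonzeroD)
  from face_supportedD[OF assms this] have k: "card F = j" "F \<union> supp (up m k) \<in> \<Delta>" by auto
  have "F \<union> supp m \<subseteq> F \<union> supp (up m k)"
    using n by (force simp: supp_def up_def neg_def)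
  with k n show "card F = j \<and> neg m \<subseteq> F \<and> F \<union> supp m \<in> \<Delta>" by (auto intro: face_subset)
qed

lemma face_supported_face_boundary:
  assumes "face_supported \<Delta> (Suc j) f" shows "face_supported \<Delta> j (face_boundary f)"
  unfolding face_supported_def
proof (intro allI impI)
  fix G m assume *: "face_boundary f (G, m) \<noteq> 0"
  then have n: "neg m \<subseteq> G" by (auto simp: face_boundary_apply split: if_splits)
  with * have "(\<Sum>v\<in>-G. face_sign v G * f (insert v G, m)) \<noteq> 0" by (simp add: face_boundary_apply boundary_face_sign)
  then obtain v where v: "v \<in> -G" "face_sign v G * f (insert v G, m) \<noteq> 0"
    by (rule sum.not_neutral_contains_not_neutral)
  then have "f (insert v G, m) \<noteq> 0" by auto
  from face_supportedD[OF assms this] v n show "card G = j \<and> neg m \<subseteq> G \<and> G \<union> supp m \<in> \<Delta>"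
    by (auto intro: face_subset)
qed

text \<open>Raising an exponent by the squarefree monomial of a nonface \<tau> makes every vertex of
  \<tau> outside \<open>F\<close> positive. A nonzero value there would put \<tau> inside a
  face.\<close>

lemma contract_SR_ideal:
  assumes "face_supported \<Delta> j f" "s \<in> SR_ideal \<Delta>"
  shows "contract s f = (\<lambda>_. 0)"
  using assms(2) unfolding SR_ideal_def
proof (induction rule: pideal.span_induct_alt)
  case (step c x y)
  then obtain \<tau> where \<tau>: "x = (\<Prod>i\<in>\<tau>. var i)" "\<tau> \<notin> \<Delta>" by auto
  have "contract x f = (\<lambda>_. 0)"
  proof (rule ext, clarsimp)
    fix F m
    let ?k = "\<Sum>i\<in>\<tau>. Poly_Mapping.single i (1::nat)"
    show "contract x f (F, m) = 0"
    proof (rule ccontr)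
      assume "contract x f (F, m) \<noteq> 0"
      then have n: "neg m \<subseteq> F" and "f (F, up m ?k) \<noteq> 0"
        by (auto simp: contract_apply \<tau>(1) prod_var split: if_splits)
      from face_supportedD[OF assms(1) this(2)] have "F \<union> supp (up m ?k) \<in> \<Delta>" by auto
      moreover have "\<tau> \<subseteq> F \<union> supp (up m ?k)"
      proof
        fix v assume "v \<in> \<tau>"
        then have "up m ?k v = m v + 1"
          using lookup_sum_single_1[of \<tau> v] by (simp add: up_def)
        moreover have "v \<in> F \<or> m v \<ge> 0" using n by (auto simp: neg_def)
        ultimately show "v \<in> F \<union> supp (up m ?k)" by (auto simp: supp_def)
      qed
      ultimately show False using \<tau>(2) face_subset by blast
    qed
  qed
  moreover have "contract y f = (\<lambda>_. 0)" by (rule step.IH)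
  ultimately show ?case by (simp add: contract_add contract_mult plus_fun_def)
qed simp

end

lemma sop_ideal_explicit:
  assumes "x \<in> sop_ideal \<Delta> \<theta>"
  shows "\<exists>s g. s \<in> SR_ideal \<Delta> \<and> x = s + (\<Sum>i<length \<theta>. \<theta> ! i * g i)"
proof -
  have "x \<in> {x + y |x y. x \<in> SR_ideal \<Delta> \<and> y \<in> pideal.span (set \<theta>)}"
    using assms unfolding sop_ideal_def pideal.span_Un SR_ideal_def pideal.span_span .
  then obtain s y where x: "x = s + y" "s \<in> SR_ideal \<Delta>" and "y \<in> pideal.span (set \<theta>)" by blast
  from this(3) have "\<exists>g. y = (\<Sum>i<length \<theta>. \<theta> ! i * g i)"
  proof (induction rule: pideal.span_induct_alt)
    case base
    then show ?case by (intro exI[of _ "\<lambda>_. 0"]) simp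
  next
    case (step c x y)
    then obtain g j where g: "y = (\<Sum>i<length \<theta>. \<theta> ! i * g i)" and j: "j < length \<theta>" "x = \<theta> ! j"
      by (auto simp: in_set_conv_nth)
    have "c * x + y = (\<Sum>i<length \<theta>. \<theta> ! i * (g i + (if i = j then c else 0)))"
      using j by (simp add: g distrib_left sum.distrib if_distrib[of "\<lambda>x. _ * x"] sum.delta mult.commute cong: if_cong)
    then show ?case by (rule exI[where x = "\<lambda>i. g i + (if i = j then c else 0)"])
  qed
  with x show ?thesis by blast
qed

section \<open>Exactness in the face direction\<close>

text \<open>The homotopy is coning with apex \<open>v0\<close>. Only sets containing
  \<open>N\<close> count as simplices; since \<open>v0\<close> is not in \<open>N\<close>, adding or
  removing the apex respects this restriction.\<close>

lemma cone_exact: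
  fixes c :: "'v::{finite,linorder} set \<Rightarrow> 'k::field"
  assumes v0: "v0 \<notin> N" and cyc: "\<And>G. N \<subseteq> G \<Longrightarrow> boundary c G = 0" and G: "N \<subseteq> G"
  shows "boundary (\<lambda>F. if v0 \<in> F then face_sign v0 (F - {v0}) * c (F - {v0}) else 0) G = c G"
proof (cases "v0 \<in> G")
  case False
  have "boundary (\<lambda>F. if v0 \<in> F then face_sign v0 (F - {v0}) * c (F - {v0}) else 0) G
      = (\<Sum>v\<in>{v0}. face_sign v G * (if v0 \<in> insert v G then face_sign v0 (insert v G - {v0}) * c (insert v G - {v0}) else 0))"
    unfolding boundary_face_sign using False by (intro sum.mono_neutral_right) auto
  with False show ?thesis by simp
next
  case True
  define G' where "G' = G - {v0}"
  have G': "G = insert v0 G'" "v0 \<notin> G'" using True by (auto simp: G'_def)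
  have "boundary (\<lambda>F. if v0 \<in> F then face_sign v0 (F - {v0}) * c (F - {v0}) else 0) G
      = (\<Sum>v\<in>-G. - face_sign v0 G' * (face_sign v G' * c (insert v G')))"
    unfolding boundary_face_sign
  proof (rule sum.cong[OF refl])
    fix v assume v: "v \<in> - G"
    then have "insert v G - {v0} = insert v G'" using G' by auto
    moreover have "face_sign v (insert v0 G') * face_sign v0 (insert v G') = - (face_sign v0 G' * face_sign v G' :: 'k)"
      using v G' by (auto simp: face_sign_insert)
    ultimately show "face_sign v G * (if v0 \<in> insert v G then face_sign v0 (insert v G - {v0}) * c (insert v G - {v0}) else 0)
        = - face_sign v0 G' * (face_sign v G' * c (insert v G'))"
      using True by (simp add: G'(1)[symmetric] mult.assoc[symmetric])
  qed
  also have "\<dots> = - face_sign v0 G' * (\<Sum>v\<in>-G. face_sign v G' * c (insert v G'))"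
    by (simp add: sum_distrib_left)
  \<comment> \<open>The summand for \<open>v0\<close> in the boundary at \<open>G'\<close> is, up to
    sign, \<open>c G\<close>; the cycle condition at \<open>G'\<close> trades the remaining summands
    for it.\<close>
  also have "(\<Sum>v\<in>-G. face_sign v G' * c (insert v G')) = boundary c G' - face_sign v0 G' * c G"
  proof -
    have "- G' = insert v0 (- G)" using G' by auto
    then show ?thesis using G' by (simp add: boundary_face_sign)
  qed
  also have "boundary c G' = 0" using G v0 G' by (intro cyc) auto
  finally show ?thesis by simp
qed

text \<open>The boundary signs at a face containing \<open>N\<close> and at the corresponding face
  of the link differ by \<open>face_sign v N\<close>. The product over all vertices of the link face
  absorbs this difference, so that \<open>unlink\<close> and \<open>relink\<close> commute with the
  boundary maps.\<close>

definition link_sign :: "'v::linorder set \<Rightarrow> 'v set \<Rightarrow> 'k::field" where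
  "link_sign N \<tau> = (\<Prod>v\<in>\<tau>. face_sign v N)"

lemma link_sign_mult_self [simp]: "link_sign N \<tau> * (link_sign N \<tau> * x) = (x::'k::field)"
  by (simp add: link_sign_def mult.assoc[symmetric] prod.distrib[symmetric])

lemma face_sign_Un:
  fixes N \<tau> :: "'v::{finite,linorder} set"
  assumes "N \<inter> \<tau> = {}"
  shows "face_sign v (N \<union> \<tau>) = face_sign v N * (face_sign v \<tau> :: 'k::field)"
proof -
  have "{w \<in> N \<union> \<tau>. w < v} = {w \<in> N. w < v} \<union> {w \<in> \<tau>. w < v}" by auto
  moreover have "card \<dots> = card {w \<in> N. w < v} + card {w \<in> \<tau>. w < v}"
    using assms by (intro card_Un_disjoint) auto
  ultimately show ?thesis by (simp add: face_sign_def power_add)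
qed

definition unlink :: "'v::{finite,linorder} set \<Rightarrow> ('v set \<Rightarrow> 'k::field) \<Rightarrow> 'v set \<Rightarrow> 'k" where
  "unlink N c \<rho> = (if \<rho> \<inter> N = {} then link_sign N \<rho> * c (N \<union> \<rho>) else 0)"

definition relink :: "'v::{finite,linorder} set \<Rightarrow> ('v set \<Rightarrow> 'k::field) \<Rightarrow> 'v set \<Rightarrow> 'k" where
  "relink N c F = (if N \<subseteq> F then link_sign N (F - N) * c (F - N) else 0)"

lemma boundary_unlink:
  fixes c :: "'v::{finite,linorder} set \<Rightarrow> 'k::field"
  shows "boundary (unlink N c) \<tau> = (if \<tau> \<inter> N = {} then link_sign N \<tau> * boundary c (N \<union> \<tau>) else 0)"
proof (cases "\<tau> \<inter> N = {}")
  case True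
  have "boundary (unlink N c) \<tau> = (\<Sum>v\<in>- (N \<union> \<tau>). face_sign v \<tau> * unlink N c (insert v \<tau>))"
    unfolding boundary_face_sign by (intro sum.mono_neutral_right) (auto simp: unlink_def)
  also have "\<dots> = (\<Sum>v\<in>- (N \<union> \<tau>). link_sign N \<tau> * (face_sign v (N \<union> \<tau>) * c (insert v (N \<union> \<tau>))))"
  proof (rule sum.cong[OF refl])
    fix v assume "v \<in> - (N \<union> \<tau>)"
    then have "insert v \<tau> \<inter> N = {}" "v \<notin> \<tau>" using True by auto
    then show "face_sign v \<tau> * unlink N c (insert v \<tau>) = link_sign N \<tau> * (face_sign v (N \<union> \<tau>) * c (insert v (N \<union> \<tau>)))"
      using True by (simp add: unlink_def link_sign_def face_sign_Un Int_commute ac_simps)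
  qed
  finally show ?thesis using True by (simp add: boundary_face_sign sum_distrib_left)
next
  case False
  then have "unlink N c (insert v \<tau>) = 0" for v by (auto simp: unlink_def)
  with False show ?thesis by (simp add: boundary_face_sign)
qed

lemma unlink_relink:
  assumes "\<And>\<rho>. c \<rho> \<noteq> 0 \<Longrightarrow> \<rho> \<inter> N = {}"
  shows "unlink N (relink N c) = c"
proof
  fix \<rho>
  have "\<rho> \<inter> N = {} \<Longrightarrow> N \<union> \<rho> - N = \<rho>" by auto
  then show "unlink N (relink N c) \<rho> = c \<rho>"
    using assms[of \<rho>] by (auto simp: unlink_def relink_def)
qed

lemma boundary_relink:
  assumes "\<And>\<rho>. c \<rho> \<noteq> 0 \<Longrightarrow> \<rho> \<inter> N = {}" and "N \<subseteq> G"
  shows "boundary (relink N c) G = link_sign N (G - N) * boundary c (G - N)"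
proof -
  have "boundary c (G - N) = link_sign N (G - N) * boundary (relink N c) (N \<union> (G - N))"
    using boundary_unlink[of N "relink N c" "G - N"] by (simp add: unlink_relink[OF assms(1)] Int_commute)
  moreover have "N \<union> (G - N) = G" using assms(2) by auto
  ultimately show ?thesis by simp
qed

text \<open>Removing \<open>N\<close> identifies chains on the faces containing \<open>N\<close>
  with chains on the link. A face with \<open>j\<close> elements becomes one of dimension
  \<open>j - card N - 1\<close>, hence the degree in \<open>hom\<close>.\<close>

lemma link_exact:
  fixes c :: "'v::{finite,linorder} set \<Rightarrow> 'k::field"
  assumes sc: "simplicial_complex \<Delta>"
    and hom: "red_homology_zero TYPE('k) (link \<Delta> N) (int j - int (card N) - 1)"
    and c: "\<And>F. c F \<noteq> 0 \<Longrightarrow> N \<subseteq> F \<and> F \<in> \<Delta> \<and> card F = j"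
    and cyc: "\<And>G. N \<subseteq> G \<Longrightarrow> boundary c G = 0"
  shows "\<exists>b. (\<forall>F. b F \<noteq> 0 \<longrightarrow> N \<subseteq> F \<and> F \<in> \<Delta> \<and> card F = Suc j) \<and>
             (\<forall>G. N \<subseteq> G \<longrightarrow> boundary b G = c G)"
proof -
  have "unlink N c \<in> chains (link \<Delta> N) (int j - int (card N) - 1)"
    unfolding chains_def
  proof (intro CollectI allI impI)
    fix \<rho> assume "unlink N c \<rho> \<noteq> 0"
    then have d: "\<rho> \<inter> N = {}" and "c (N \<union> \<rho>) \<noteq> 0" by (auto simp: unlink_def split: if_splits)
    from c[OF this(2)] have 1: "N \<union> \<rho> \<in> \<Delta>" "card (N \<union> \<rho>) = j" by auto
    have "\<rho> \<in> \<Delta>" using face_subset[OF sc 1(1)] by auto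
    moreover have "j = card N + card \<rho>" using 1(2) d by (subst (asm) card_Un_disjoint) auto
    ultimately show "\<rho> \<in> link \<Delta> N \<and> int (card \<rho>) = int j - int (card N) - 1 + 1"
      using d 1 by (auto simp: link_def Un_commute)
  qed
  moreover have "boundary (unlink N c) = (\<lambda>_. 0)"
    by (auto simp: boundary_unlink cyc)
  ultimately have "unlink N c \<in> boundaries (link \<Delta> N) (int j - int (card N) - 1)"
    using hom by (auto simp: red_homology_zero_def cycles_def)
  then obtain b where b: "b \<in> chains (link \<Delta> N) (int j - int (card N))" "unlink N c = boundary b"
    by (auto simp: boundaries_def)
  have b0: "\<rho> \<in> \<Delta>" "\<rho> \<inter> N = {}" "\<rho> \<union> N \<in> \<Delta>" "int (card \<rho>) = int j - int (card N) + 1"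
    if "b \<rho> \<noteq> 0" for \<rho>
    using b(1) that by (auto simp: chains_def link_def)
  show ?thesis
  proof (intro exI[of _ "relink N b"] conjI allI impI)
    fix F assume "relink N b F \<noteq> 0"
    then have F: "N \<subseteq> F" "b (F - N) \<noteq> 0" by (auto simp: relink_def split: if_splits)
    then have "F - N \<union> N = F" by auto
    with b0[OF F(2)] F(1) show "F \<in> \<Delta>" "card F = Suc j" "N \<subseteq> F"
      by (auto simp: card_Diff_subset card_mono of_nat_diff)
  next
    fix G assume G: "N \<subseteq> G"
    have "boundary (relink N b) G = link_sign N (G - N) * boundary b (G - N)"
      using b0 G by (intro boundary_relink) auto
    also have "\<dots> = c (N \<union> (G - N))"
      by (simp add: b(2)[symmetric] unlink_def Int_commute)
    finally show "boundary (relink N b) G = c G" using G by (simp add: Un_absorb1)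
  qed
qed

definition pos :: "('v \<Rightarrow> int) \<Rightarrow> 'v set" where "pos m = {v. m v > 0}"

text \<open>The multidegree \<open>m\<close> is preserved, so exactness is checked for each
  \<open>m\<close> separately. If \<open>m\<close> is positive at \<open>v0\<close>, adding
  \<open>v0\<close> to \<open>F\<close> does not change \<open>F \<union> supp m\<close>, and a cone
  results. Otherwise \<open>supp m = neg m\<close>, and the faces that occur are those containing
  \<open>neg m\<close>, so the question is about its link.\<close>

lemma face_boundary_exact:
  fixes f :: "('v::{finite,linorder}, 'k::field) lfun"
  assumes sc: "simplicial_complex \<Delta>" and f: "face_supported \<Delta> j f" and cyc: "face_boundary f = (\<lambda>_. 0)"
    and hom: "\<And>F m. f (F, m) \<noteq> 0 \<Longrightarrow> pos m = {} \<Longrightarrow>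
      red_homology_zero TYPE('k) (link \<Delta> (neg m)) (int j - int (card (neg m)) - 1)"
  shows "\<exists>g. face_supported \<Delta> (Suc j) g \<and> face_boundary g = f"
proof -
  have "\<exists>b. (\<forall>F. b F \<noteq> 0 \<longrightarrow> card F = Suc j \<and> neg m \<subseteq> F \<and> F \<union> supp m \<in> \<Delta>) \<and>
            (\<forall>G. neg m \<subseteq> G \<longrightarrow> boundary b G = f (G, m))" for m
  proof -
    define c where "c = (\<lambda>F. f (F, m))"
    have c: "card F = j" "neg m \<subseteq> F" "F \<union> supp m \<in> \<Delta>" if "c F \<noteq> 0" for F
      using face_supportedD[OF f] that by (auto simp: c_def)
    have bc: "boundary c G = 0" if "neg m \<subseteq> G" for G
      using fun_cong[OF cyc, of "(G, m)"] that by (simp add: face_boundary_apply c_def)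
    have supp: "supp m = neg m \<union> pos m" by (auto simp: supp_def neg_def pos_def)
    consider "c = (\<lambda>_. 0)" | "pos m \<noteq> {}" | F where "c F \<noteq> 0" "pos m = {}" by auto
    then show ?thesis
    proof cases
      case 1
      then show ?thesis by (intro exI[of _ "\<lambda>_. 0"]) (auto simp: c_def fun_eq_iff boundary_def)
    next
      case 2
      then obtain v0 where v0: "v0 \<in> pos m" by auto
      then have v0n: "v0 \<notin> neg m" by (auto simp: pos_def neg_def)
      show ?thesis
      proof (intro exI[of _ "\<lambda>F. if v0 \<in> F then face_sign v0 (F - {v0}) * c (F - {v0}) else 0"] conjI allI impI)
        fix F assume "(if v0 \<in> F then face_sign v0 (F - {v0}) * c (F - {v0}) else 0) \<noteq> 0"
        then have F: "v0 \<in> F" "c (F - {v0}) \<noteq> 0" by (auto split: if_splits)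
        have "F - {v0} \<union> supp m = F \<union> supp m" using v0 F(1) supp by auto
        moreover have "card F = Suc (card (F - {v0}))" using F(1) by (intro card.remove) auto
        ultimately show "card F = Suc j" "neg m \<subseteq> F" "F \<union> supp m \<in> \<Delta>"
          using c[OF F(2)] by (simp, blast, simp)
      next
        fix G assume "neg m \<subseteq> G"
        then show "boundary (\<lambda>F. if v0 \<in> F then face_sign v0 (F - {v0}) * c (F - {v0}) else 0) G = f (G, m)"
          using cone_exact[OF v0n bc] by (simp add: c_def)
      qed
    next
      case 3
      have *: "F \<union> supp m = F" if "neg m \<subseteq> F" for F using that 3 supp by auto
      then have c': "neg m \<subseteq> F \<and> F \<in> \<Delta> \<and> card F = j" if "c F \<noteq> 0" for F
        using c[OF that] by metis
      have "f (F, m) \<noteq> 0" using 3(1) by (simp add: c_def)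
      from link_exact[OF sc hom[OF this 3(2)], of c, OF c' bc]
      obtain b where b: "\<And>F. b F \<noteq> 0 \<Longrightarrow> neg m \<subseteq> F \<and> F \<in> \<Delta> \<and> card F = Suc j"
        "\<And>G. neg m \<subseteq> G \<Longrightarrow> boundary b G = c G" by blast
      from b * show ?thesis by (intro exI[of _ b]) (auto simp: c_def)
    qed
  qed
  then obtain b where b: "\<And>m F. b m F \<noteq> 0 \<Longrightarrow> card F = Suc j \<and> neg m \<subseteq> F \<and> F \<union> supp m \<in> \<Delta>"
    "\<And>m G. neg m \<subseteq> G \<Longrightarrow> boundary (b m) G = f (G, m)" by metis
  have "face_boundary (\<lambda>(F, m). b m F) = f"
  proof (rule ext, clarify)
    fix G m
    have "f (G, m) = 0" if "\<not> neg m \<subseteq> G" using face_supportedD[OF f, of G m] that by auto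
    then show "face_boundary (\<lambda>(F, m). b m F) (G, m) = f (G, m)" by (auto simp: face_boundary_apply b(2))
  qed
  moreover have "face_supported \<Delta> (Suc j) (\<lambda>(F, m). b m F)" using b(1) by (auto simp: face_supported_def)
  ultimately show ?thesis by blast
qed

section \<open>The zigzag\<close>

locale parameter_system =
  fixes \<Delta> :: "'v::{finite,linorder} set set"
    and \<theta> :: "('v, 'k::field) mpol list"
    and a :: "'v \<Rightarrow> nat"
    and deg :: "nat \<Rightarrow> nat"
  assumes sc: "simplicial_complex \<Delta>"
    and hom: "\<And>i k. i < length \<theta> \<Longrightarrow> k \<in> Poly_Mapping.keys (\<theta> ! i) \<Longrightarrow> mdeg k = deg i"
    and deg_pos: "\<And>i. i < length \<theta> \<Longrightarrow> 0 < deg i"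
    and power_mem: "\<And>v. var v ^ a v \<in> sop_ideal \<Delta> \<theta>"
begin

definition D :: nat where "D = length \<theta>"

text \<open>The padding by 0 makes the family total on the naturals, so that linearity and
  commutation hold for all indices at once.\<close>

definition P :: "nat \<Rightarrow> ('v, 'k) lfun \<Rightarrow> ('v, 'k) lfun" where
  "P i = contract (if i < D then \<theta> ! i else 0)"

lemma P_ge: "D \<le> i \<Longrightarrow> P i f = (\<lambda>_. 0)"
  by (simp add: P_def)

lemma flinear_P: "flinear (P i)"
  by (simp add: P_def flinear_contract)

lemma P_zero [simp]: "P i (\<lambda>_. 0) = (\<lambda>_. 0)"
  by (simp add: P_def)

definition tot :: "('v \<Rightarrow> int) \<Rightarrow> int" where "tot m = (\<Sum>v\<in>UNIV. m v)"

lemma tot_up: "tot (up m k) = tot m + int (mdeg k)"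
  by (simp add: tot_def up_def mdeg_def sum.distrib)

text \<open>The Koszul degree \<open>i\<close> is an integer because the invariant of the zigzag
  refers to degree \<open>i - 1\<close> even at the last stage, where degree -1 contains only
  0.\<close>

definition bigraded :: "int \<Rightarrow> nat \<Rightarrow> (nat set \<Rightarrow> ('v, 'k) lfun) \<Rightarrow> bool" where
  "bigraded i j w \<longleftrightarrow> (\<forall>A. face_supported \<Delta> j (w A)) \<and> (\<forall>A. (A \<subseteq> {..<D} \<and> int (card A) = i) \<or> w A = (\<lambda>_. 0))"

lemma bigradedD: "bigraded i j w \<Longrightarrow> face_supported \<Delta> j (w A)" "bigraded i j w \<Longrightarrow> w A \<noteq> (\<lambda>_. 0) \<Longrightarrow> A \<subseteq> {..<D} \<and> int (card A) = i"
  by (auto simp: bigraded_def)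

lemma koszul_eq_0:
  assumes "\<And>A i. A \<subseteq> {..<D} \<Longrightarrow> i < D \<Longrightarrow> B = insert i A \<Longrightarrow> i \<notin> A \<Longrightarrow> w A = (\<lambda>_. 0)"
    and "\<And>A. \<not> A \<subseteq> {..<D} \<Longrightarrow> w A = (\<lambda>_. 0)"
  shows "koszul P w B = (\<lambda>_. 0)"
proof -
  have "P i (w (B - {i})) = (\<lambda>_. 0)" if "i \<in> B" for i
  proof (cases "i < D \<and> B - {i} \<subseteq> {..<D}")
    case True
    then have "w (B - {i}) = (\<lambda>_. 0)" using that by (intro assms(1)[of _ i]) auto
    then show ?thesis by simp
  next
    case False
    then consider "D \<le> i" | "\<not> B - {i} \<subseteq> {..<D}" by force
    then show ?thesis by cases (simp_all add: P_ge assms(2))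
  qed
  then show ?thesis by (simp add: koszul_def)
qed

lemma bigraded_koszul:
  assumes "bigraded i j w" shows "bigraded (i + 1) j (koszul P w)"
  unfolding bigraded_def
proof (intro conjI allI)
  fix B
  show "face_supported \<Delta> j (koszul P w B)"
    unfolding koszul_def P_def by (intro face_supported_sum face_supported_contract sc bigradedD(1)[OF assms])
  show "(B \<subseteq> {..<D} \<and> int (card B) = i + 1) \<or> koszul P w B = (\<lambda>_. 0)"
  proof (rule disjCI)
    assume "koszul P w B \<noteq> (\<lambda>_. 0)"
    then obtain A k where "A \<subseteq> {..<D}" "k < D" "B = insert k A" "k \<notin> A" "w A \<noteq> (\<lambda>_. 0)"
      using koszul_eq_0[of B w] bigradedD(2)[OF assms] by metis
    moreover from this have "finite A" using finite_subset by blast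
    ultimately show "B \<subseteq> {..<D} \<and> int (card B) = i + 1"
      using bigradedD(2)[OF assms, of A] by auto
  qed
qed

lemma bigraded_diff:
  assumes "bigraded i j w" "bigraded i j w'" shows "bigraded i j (\<lambda>A. w A - w' A)"
  unfolding bigraded_def
proof (intro conjI allI)
  fix A show "face_supported \<Delta> j (w A - w' A)" by (intro face_supported_diff bigradedD(1)[OF assms(1)] bigradedD(1)[OF assms(2)])
  have "w A = (\<lambda>_. 0) \<Longrightarrow> w' A = (\<lambda>_. 0) \<Longrightarrow> w A - w' A = (\<lambda>_. 0)" by auto
  then show "(A \<subseteq> {..<D} \<and> int (card A) = i) \<or> w A - w' A = (\<lambda>_. 0)"
    using bigradedD(2)[OF assms(1), of A] bigradedD(2)[OF assms(2), of A] by blast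
qed

lemma bigraded_face_boundary: "bigraded i (Suc j) w \<Longrightarrow> bigraded i j (\<lambda>A. face_boundary (w A))"
  using flinear_zero[OF flinear_face_boundary] unfolding bigraded_def by (metis face_supported_face_boundary sc)

lemma koszul_koszul_P: "koszul P (koszul P w) B = (\<lambda>_. 0)"
proof (cases "finite B")
  case True
  then show ?thesis by (intro koszul_koszul flinear_P) (simp_all add: P_def contract_comm)
qed (simp add: koszul_def)

lemma koszul_face_boundary: "koszul P (\<lambda>A. face_boundary (w A)) B = face_boundary (koszul P w B)"
  by (intro koszul_comm flinear_face_boundary) (simp add: P_def face_boundary_contract)

text \<open>The indices missing from \<open>A\<close> contribute their degrees because contraction
  with \<theta> shifts the total degree. With this normalization both differentials preserve
  \<open>e\<close>.\<close>

definition has_degree :: "int \<Rightarrow> (nat set \<Rightarrow> ('v, 'k) lfun) \<Rightarrow> bool" where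
  "has_degree e w \<longleftrightarrow> (\<forall>A F m. w A (F, m) \<noteq> 0 \<longrightarrow> tot m = e + (\<Sum>i\<in>{..<D} - A. int (deg i)))"

definition degree_part :: "int \<Rightarrow> (nat set \<Rightarrow> ('v, 'k) lfun) \<Rightarrow> nat set \<Rightarrow> ('v, 'k) lfun" where
  "degree_part e w A = (\<lambda>(F, m). if tot m = e + (\<Sum>i\<in>{..<D} - A. int (deg i)) then w A (F, m) else 0)"

lemma koszul_degree_part:
  assumes "B \<subseteq> {..<D}"
  shows "koszul P (degree_part e w) B = degree_part e (koszul P w) B"
proof (rule ext, clarify)
  fix F m
  have deg: "tot (up m k) = e + (\<Sum>i\<in>{..<D} - (B - {b}). int (deg i)) \<longleftrightarrow>
      tot m = e + (\<Sum>i\<in>{..<D} - B. int (deg i))"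
    if b: "b \<in> B" and k: "k \<in> Poly_Mapping.keys (\<theta> ! b)" for b k
  proof -
    have "{..<D} - (B - {b}) = insert b ({..<D} - B)" using b assms by auto
    moreover have "b < length \<theta>" using b assms by (auto simp: D_def)
    ultimately show ?thesis using hom[OF _ k] b by (simp add: tot_up)
  qed
  have "P b (degree_part e w (B - {b})) (F, m) =
      (if tot m = e + (\<Sum>i\<in>{..<D} - B. int (deg i)) then P b (w (B - {b})) (F, m) else 0)"
    if b: "b \<in> B" for b
  proof -
    have "b < D" using b assms by auto
    have "pairing (\<theta> ! b) (\<lambda>k. degree_part e w (B - {b}) (F, up m k)) = pairing (\<theta> ! b) (\<lambda>k.
        if tot m = e + (\<Sum>i\<in>{..<D} - B. int (deg i)) then w (B - {b}) (F, up m k) else 0)"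
      by (intro pairing_cong) (simp add: degree_part_def deg[OF b])
    then show ?thesis using \<open>b < D\<close> by (simp add: P_def contract_apply)
  qed
  then show "koszul P (degree_part e w) B (F, m) = degree_part e (koszul P w) B (F, m)"
    by (simp add: koszul_def degree_part_def)
qed

section \<open>Exactness in the Koszul direction\<close>

definition pick :: "'v set \<Rightarrow> 'v" where "pick F = (SOME v. v \<in> F)"

lemma pick: "F \<noteq> {} \<Longrightarrow> pick F \<in> F"
  unfolding pick_def by (rule someI_ex) auto

text \<open>At a nonempty face the variable of a chosen vertex \<open>v\<close> is invertible. Write
  its power as \<open>s v\<close> plus a combination of \<theta> with coefficients
  \<open>g v i\<close>; here \<open>s v\<close> acts as 0. Dividing by the power turns these
  coefficients into operators \<open>G i\<close> for which the sum of \<open>P i\<close> after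
  \<open>G i\<close> is the identity, as \<open>koszul_exact\<close> demands.\<close>

lemma koszul_acyclic:
  assumes w: "bigraded (i + 1) (Suc j) w" and cyc: "\<And>B. koszul P w B = (\<lambda>_. 0)" and dg: "has_degree e w"
  shows "\<exists>y. bigraded i (Suc j) y \<and> has_degree e y \<and> (\<forall>B. koszul P y B = w B)"
proof -
  have "\<exists>s g. s \<in> SR_ideal \<Delta> \<and> var v ^ a v = s + (\<Sum>i<D. \<theta> ! i * g i)" for v
    using sop_ideal_explicit[OF power_mem[of v]] by (simp add: D_def)
  then have "\<forall>v. \<exists>s. s \<in> SR_ideal \<Delta> \<and> (\<exists>g. var v ^ a v = s + (\<Sum>i<D. \<theta> ! i * g i))" by blast
  from choice[OF this]
  obtain s where s: "\<And>v. s v \<in> SR_ideal \<Delta>" "\<forall>v. \<exists>g. var v ^ a v = s v + (\<Sum>i<D. \<theta> ! i * g i)"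
    by blast
  from choice[OF s(2)] obtain g where g: "\<And>v. var v ^ a v = s v + (\<Sum>i<D. \<theta> ! i * g v i)" by auto
  \<comment> \<open>Division by the power of the picked variable. Only an exponent at a vertex of
    \<open>F\<close> is lowered, and there negative values are allowed, so supports are
    respected.\<close>
  define sh where "sh = (\<lambda>F (m::'v \<Rightarrow> int). m(pick F := m (pick F) - int (a (pick F))))"
  define G where "G i f = (\<lambda>(F, m). if F = {} then 0 else contract (g (pick F) i) f (F, sh F m))"
    for i and f :: "('v, 'k) lfun"
  have neg_sh: "neg (sh F m) \<subseteq> F \<longleftrightarrow> neg m \<subseteq> F" if "F \<noteq> {}" for F m
    using pick[OF that] by (auto simp: sh_def neg_def)
  have up_sh: "up (sh F m) k = sh F (up m k)" for F m k
    by (auto simp: sh_def up_def)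
  have linG: "flinear (G i)" for i
    by (intro flinearI) (auto simp: G_def flinear_add[OF flinear_contract] flinear_scale[OF flinear_contract])
  have PG: "P i (G b f) (F, m) = (if F = {} then 0 else contract (if i < D then \<theta> ! i else 0) (contract (g (pick F) b) f) (F, sh F m))"
    for i b f F m
  proof -
    have "contract p (G b f) (F, m) = (if F = {} then 0 else contract p (contract (g (pick F) b) f) (F, sh F m))" for p
      unfolding contract_apply[of p] G_def up_sh using neg_sh by simp
    then show ?thesis by (simp only: P_def)
  qed
  have comm: "P i (G b f) = G b (P i f)" for i b f
    by (rule ext, clarify, subst PG) (simp add: G_def P_def contract_comm)
  have inv: "(\<lambda>x. \<Sum>i\<in>{..<D}. P i (G i f) x) = f" if f: "face_supported \<Delta> (Suc j) f" for f
  proof (rule ext, clarify)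
    fix F m
    show "(\<Sum>i\<in>{..<D}. P i (G i f) (F, m)) = f (F, m)"
    proof (cases "F = {}")
      case True
      then show ?thesis using face_supportedD[OF f, of F m] by (auto simp: PG)
    next
      case False
      have "(\<Sum>i\<in>{..<D}. P i (G i f) (F, m)) = contract (\<Sum>i<D. \<theta> ! i * g (pick F) i) f (F, sh F m)"
        using False by (simp add: PG contract_sum_apply contract_mult)
      also have "\<dots> = contract (var (pick F) ^ a (pick F)) f (F, sh F m)"
        by (simp add: g contract_add contract_SR_ideal[OF sc f s(1)])
      also have "\<dots> = f (F, m)"
      proof -
        have "up (sh F m) (Poly_Mapping.single (pick F) (a (pick F))) = m"
          by (auto simp: sh_def up_def lookup_single when_def)
        then show ?thesis using False neg_sh[OF False, of m] face_supportedD[OF f, of F m]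
          by (auto simp: contract_apply var_power)
      qed
      finally show ?thesis .
    qed
  qed
  have admG: "face_supported \<Delta> (Suc j) (G i f)" if f: "face_supported \<Delta> (Suc j) f" for i f
    unfolding face_supported_def
  proof (intro allI impI)
    fix F m assume "G i f (F, m) \<noteq> 0"
    then have F: "F \<noteq> {}" and "contract (g (pick F) i) f (F, sh F m) \<noteq> 0"
      by (auto simp: G_def split: if_splits)
    from face_supportedD[OF face_supported_contract[OF sc f] this(2)]
    have "card F = Suc j" "neg (sh F m) \<subseteq> F" "F \<union> supp (sh F m) \<in> \<Delta>" by auto
    moreover have "F \<union> supp (sh F m) = F \<union> supp m"
      using pick[OF F] by (auto simp: sh_def supp_def split: if_splits)
    ultimately show "card F = Suc j \<and> neg m \<subseteq> F \<and> F \<union> supp m \<in> \<Delta>"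
      using neg_sh[OF F] by simp
  qed
  define y0 where "y0 = (\<lambda>A x. \<Sum>b\<in>{..<D} - A. face_sign b A * G b (w (insert b A)) x)"
  have y0: "koszul P y0 B = w B" if "B \<subseteq> {..<D}" for B
    unfolding y0_def
    using that bigradedD(1)[OF w] by (intro koszul_exact flinear_P linG comm inv cyc) auto
  have bi0: "bigraded i (Suc j) y0"
    unfolding bigraded_def
  proof (intro conjI allI)
    fix A
    show "face_supported \<Delta> (Suc j) (y0 A)"
      unfolding y0_def by (intro face_supported_sum admG bigradedD(1)[OF w])
    show "(A \<subseteq> {..<D} \<and> int (card A) = i) \<or> y0 A = (\<lambda>_. 0)"
    proof (rule disjCI)
      assume "y0 A \<noteq> (\<lambda>_. 0)"
      then obtain x where "y0 A x \<noteq> 0" by (auto simp: fun_eq_iff)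
      then have "(\<Sum>b\<in>{..<D} - A. face_sign b A * G b (w (insert b A)) x) \<noteq> 0" by (simp add: y0_def)
      then obtain b where b: "b \<in> {..<D} - A" "face_sign b A * G b (w (insert b A)) x \<noteq> 0"
        by (rule sum.not_neutral_contains_not_neutral)
      have "w (insert b A) \<noteq> (\<lambda>_. 0)"
      proof
        assume "w (insert b A) = (\<lambda>_. 0)"
        with b(2) show False by (simp add: flinear_zero[OF linG])
      qed
      from bigradedD(2)[OF w this] have A: "insert b A \<subseteq> {..<D}" "int (card (insert b A)) = i + 1" by auto
      have "finite A" using finite_subset[OF A(1)] by simp
      with A b(1) show "A \<subseteq> {..<D} \<and> int (card A) = i" by simp
    qed
  qed
  \<comment> \<open>The coefficients \<open>g v i\<close> need not be homogeneous, so
    \<open>y0\<close> may mix degrees. Projection to degree \<open>e\<close> commutes with the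
    Koszul differential and fixes \<open>w\<close>, so the projected element is still a
    preimage.\<close>
  define y where "y = degree_part e y0"
  have "bigraded i (Suc j) y"
    unfolding bigraded_def
  proof (intro conjI allI)
    fix A
    show "face_supported \<Delta> (Suc j) (y A)"
      using bigradedD(1)[OF bi0, of A] by (auto simp: y_def degree_part_def face_supported_def)
    show "(A \<subseteq> {..<D} \<and> int (card A) = i) \<or> y A = (\<lambda>_. 0)"
      using bigradedD(2)[OF bi0, of A] by (auto simp: y_def degree_part_def fun_eq_iff)
  qed
  moreover have "has_degree e y" by (auto simp: has_degree_def y_def degree_part_def)
  moreover have "koszul P y B = w B" for B
  proof (cases "B \<subseteq> {..<D}")
    case True
    have "koszul P y B = degree_part e (koszul P y0) B" unfolding y_def by (rule koszul_degree_part[OF True])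
    also have "\<dots> = w B"
    proof (rule ext, clarify)
      fix F m
      have "w B (F, m) = 0" if "tot m \<noteq> e + (\<Sum>i\<in>{..<D} - B. int (deg i))"
        using dg that unfolding has_degree_def by blast
      then show "degree_part e (koszul P y0) B (F, m) = w B (F, m)"
        by (simp add: degree_part_def y0[OF True])
    qed
    finally show ?thesis .
  next
    case False
    have "koszul P y B = (\<lambda>_. 0)"
      by (rule ccontr) (use False bigradedD(2)[OF bigraded_koszul[OF \<open>bigraded i (Suc j) y\<close>], of B] in blast)
    moreover have "w B = (\<lambda>_. 0)"
      by (rule ccontr) (use False bigradedD(2)[OF w, of B] in blast)
    ultimately show ?thesis by simp
  qed
  ultimately show ?thesis by blast
qed

text \<open>
  The last clause says that \<open>w\<close> is not the Koszul image of a cycle in the face direction. It is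
  inherited along the zigzag and becomes \<open>w \<noteq> 0\<close> for \<open>i = 0\<close>, where no nonzero \<open>u\<close> exists.
\<close>

definition survives :: "int \<Rightarrow> nat \<Rightarrow> (nat set \<Rightarrow> ('v, 'k) lfun) \<Rightarrow> bool" where
  "survives e i w \<longleftrightarrow> bigraded (int i) i w \<and> has_degree e w \<and> (\<forall>B. koszul P w B = (\<lambda>_. 0)) \<and>
     (\<forall>A. face_boundary (w A) = (\<lambda>_. 0)) \<and>
     (\<forall>u. bigraded (int i - 1) i u \<longrightarrow> (\<forall>A. face_boundary (u A) = (\<lambda>_. 0)) \<longrightarrow> (\<exists>B. koszul P u B \<noteq> w B))"

text \<open>Lift \<open>w\<close> through the Koszul differential to some \<open>y\<close>, then
  apply the face differential. Since the two commute, the result is a cycle in both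
  directions.\<close>

lemma survives_step:
  assumes ex: "\<And>\<sigma>. \<sigma> \<in> \<Delta> \<Longrightarrow> red_homology_zero TYPE('k) (link \<Delta> \<sigma>) (int i - int (card \<sigma>) - 1)"
    and w: "survives e (Suc i) w"
  shows "\<exists>w'. survives e i w'"
proof -
  from w have w1: "bigraded (int i + 1) (Suc i) w" "has_degree e w" "\<And>B. koszul P w B = (\<lambda>_. 0)" "\<And>A. face_boundary (w A) = (\<lambda>_. 0)"
    and w2: "\<And>u. bigraded (int i) (Suc i) u \<Longrightarrow> (\<And>A. face_boundary (u A) = (\<lambda>_. 0)) \<Longrightarrow> \<exists>B. koszul P u B \<noteq> w B"
    by (auto simp: survives_def add.commute)
  from koszul_acyclic[OF w1(1,3,2)]
  obtain y where y: "bigraded (int i) (Suc i) y" "has_degree e y" "\<And>B. koszul P y B = w B" by blast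
  define w' where "w' = (\<lambda>A. face_boundary (y A))"
  have 1: "bigraded (int i) i w'" unfolding w'_def using y(1) by (rule bigraded_face_boundary)
  have 2: "has_degree e w'"
    unfolding has_degree_def
  proof (intro allI impI)
    fix A G m assume "w' A (G, m) \<noteq> 0"
    then have "(\<Sum>v\<in>-G. face_sign v G * y A (insert v G, m)) \<noteq> 0"
      by (auto simp: w'_def face_boundary_apply boundary_face_sign split: if_splits)
    then obtain v where "face_sign v G * y A (insert v G, m) \<noteq> 0"
      by (rule sum.not_neutral_contains_not_neutral)
    then have "y A (insert v G, m) \<noteq> 0" by auto
    then show "tot m = e + (\<Sum>i\<in>{..<D} - A. int (deg i))" using y(2) by (auto simp: has_degree_def)
  qed
  have 3: "koszul P w' B = (\<lambda>_. 0)" for B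
    by (simp add: w'_def koszul_face_boundary y(3) w1(4))
  have 4: "face_boundary (w' A) = (\<lambda>_. 0)" for A by (simp add: w'_def face_boundary_face_boundary)
  \<comment> \<open>If \<open>w'\<close> were the Koszul image of a face cycle \<open>u\<close>,
    then \<open>u\<close> would bound some \<open>u'\<close>. Subtracting the Koszul image of
    \<open>u'\<close> from \<open>y\<close> would give a face cycle with Koszul image
    \<open>w\<close>, against the invariant for \<open>w\<close>.\<close>
  have 5: "\<exists>B. koszul P u B \<noteq> w' B" if u: "bigraded (int i - 1) i u" "\<And>A. face_boundary (u A) = (\<lambda>_. 0)" for u
  proof (rule ccontr)
    assume "\<not> (\<exists>B. koszul P u B \<noteq> w' B)"
    then have uw: "koszul P u = w'" by (auto simp: fun_eq_iff)
    \<comment> \<open>Choosing 0 over 0 keeps the lift concentrated in one Koszul degree.\<close>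
    have "\<exists>g. face_supported \<Delta> (Suc i) g \<and> face_boundary g = u A \<and> (u A = (\<lambda>_. 0) \<longrightarrow> g = (\<lambda>_. 0))" for A
    proof (cases "u A = (\<lambda>_. 0)")
      case True
      then show ?thesis by (intro exI[of _ "\<lambda>_. 0"]) (simp add: face_supported_zero flinear_zero[OF flinear_face_boundary])
    next
      case False
      have "red_homology_zero TYPE('k) (link \<Delta> (neg m)) (int i - int (card (neg m)) - 1)"
        if "u A (F, m) \<noteq> 0" for F m
        using face_supportedD[OF bigradedD(1)[OF u(1)] that] by (intro ex) (auto intro: face_subset[OF sc])
      with False show ?thesis using face_boundary_exact[OF sc bigradedD(1)[OF u(1), of A] u(2)] by blast
    qed
    then obtain u' where u': "\<And>A. face_supported \<Delta> (Suc i) (u' A)" "\<And>A. face_boundary (u' A) = u A"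
      "\<And>A. u A = (\<lambda>_. 0) \<Longrightarrow> u' A = (\<lambda>_. 0)" by metis
    have bu': "bigraded (int i - 1) (Suc i) u'"
      using u' bigradedD(2)[OF u(1)] unfolding bigraded_def by metis
    define z where "z = (\<lambda>A. y A - koszul P u' A)"
    have "bigraded (int i) (Suc i) z"
      unfolding z_def using bigraded_koszul[OF bu'] by (intro bigraded_diff y) simp
    moreover have "face_boundary (z A) = (\<lambda>_. 0)" for A
    proof -
      have "face_boundary (koszul P u' A) = koszul P u A"
        using u'(2) by (simp add: koszul_face_boundary[symmetric])
      then show ?thesis
        by (simp add: z_def flinear_diff[OF flinear_face_boundary] uw) (simp add: w'_def fun_eq_iff)
    qed
    ultimately obtain B where "koszul P z B \<noteq> w B" using w2 by blast
    moreover have "koszul P z B = koszul P y B - koszul P (koszul P u') B"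
      by (simp add: koszul_def z_def flinear_diff[OF flinear_P] fun_eq_iff right_diff_distrib sum_subtractf)
    ultimately show False by (simp add: koszul_koszul_P y(3) fun_eq_iff)
  qed
  show ?thesis using 1 2 3 4 5 by (auto simp: survives_def)
qed

lemma survives_0:
  assumes ex: "\<And>\<sigma> j. \<sigma> \<in> \<Delta> \<Longrightarrow> j < D \<Longrightarrow> red_homology_zero TYPE('k) (link \<Delta> \<sigma>) (int j - int (card \<sigma>) - 1)"
    and w: "survives e D w"
  shows "\<exists>w'. survives e 0 w'"
proof -
  have "\<exists>w'. survives e (D - n) w'" if "n \<le> D" for n
    using that
  proof (induction n)
    case (Suc n)
    then obtain w' where "survives e (D - n) w'" by auto
    moreover have "D - n = Suc (D - Suc n)" using Suc.prems by auto
    ultimately show ?case using Suc.prems by (intro survives_step ex) auto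
  qed (use w in auto)
  from this[of D] show ?thesis by simp
qed

text \<open>At the last stage both the Koszul index set and the face are empty, so no exponent of
  the support has a negative entry and the values live on genuine monomials. The Koszul cycle
  condition at the singleton \<open>{i}\<close> says that contraction with \<theta>_i gives
  0.\<close>

lemma functional_of_survives_0:
  assumes w: "survives e 0 w"
  shows "\<exists>\<phi>. (\<exists>k. \<phi> k \<noteq> 0) \<and> (\<forall>k. \<phi> k \<noteq> 0 \<longrightarrow> int (mdeg k) = e + (\<Sum>i<D. int (deg i))) \<and>
     (\<forall>p\<in>sop_ideal \<Delta> \<theta>. pairing p \<phi> = 0)"
proof -
  from w have w1: "bigraded 0 0 w" "has_degree e w" "\<And>B. koszul P w B = (\<lambda>_. 0)"
    and w2: "\<And>u. bigraded (- 1) 0 u \<Longrightarrow> (\<And>A. face_boundary (u A) = (\<lambda>_. 0)) \<Longrightarrow> \<exists>B. koszul P u B \<noteq> w B"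
    by (auto simp: survives_def)
  define f where "f = w {}"
  have f: "face_supported \<Delta> 0 f" unfolding f_def by (rule bigradedD(1)[OF w1(1)])
  have "\<exists>B. koszul P (\<lambda>_ _. 0) B \<noteq> w B"
    by (rule w2) (auto simp: bigraded_def face_supported_zero flinear_zero[OF flinear_face_boundary])
  then obtain B where "koszul P (\<lambda>_ _. 0) B \<noteq> w B" ..
  then have B: "w B \<noteq> (\<lambda>_. 0)" by (auto simp: koszul_def)
  with bigradedD(2)[OF w1(1) B] have "B = {}" using finite_subset[of B "{..<D}"] by auto
  with B obtain F m where Fm: "f (F, m) \<noteq> 0" by (auto simp: f_def fun_eq_iff)
  define \<phi> where "\<phi> k = f ({}, up (\<lambda>_. 0) k)" for k
  have n0: "neg (\<lambda>_. 0) = {}" by (simp add: neg_def)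
  have "contract (\<theta> ! i) f = (\<lambda>_. 0)" if "i < D" for i
  proof -
    have "koszul P w {i} = contract (\<theta> ! i) f" using that by (simp add: koszul_def P_def f_def face_sign_def)
    then show ?thesis using w1(3)[of "{i}"] by simp
  qed
  then have "pairing p \<phi> = 0" if p: "p \<in> sop_ideal \<Delta> \<theta>" for p
  proof -
    assume *: "\<And>i. i < D \<Longrightarrow> contract (\<theta> ! i) f = (\<lambda>_. 0)"
    from sop_ideal_explicit[OF p] obtain s g where s: "s \<in> SR_ideal \<Delta>" "p = s + (\<Sum>i<D. \<theta> ! i * g i)"
      by (auto simp: D_def)
    have "pairing p \<phi> = contract p f ({}, \<lambda>_. 0)" by (simp add: contract_apply \<phi>_def[abs_def] n0)
    also have "\<dots> = (\<Sum>i<D. contract (g i) (contract (\<theta> ! i) f) ({}, \<lambda>_. 0))"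
      by (simp add: s(2) contract_add contract_SR_ideal[OF sc f s(1)] contract_sum_apply contract_mult contract_comm)
    also have "\<dots> = 0" by (simp add: *)
    finally show ?thesis .
  qed
  moreover have "\<phi> (Poly_Mapping.Abs_poly_mapping (\<lambda>v. nat (m v))) \<noteq> 0"
  proof -
    have "F = {}" "neg m = {}" using face_supportedD[OF f Fm] by auto
    moreover from this have "up (\<lambda>_. 0) (Poly_Mapping.Abs_poly_mapping (\<lambda>v. nat (m v))) = m"
      by (auto simp: up_def fun_eq_iff neg_def not_less)
    ultimately show ?thesis using Fm by (simp add: \<phi>_def)
  qed
  moreover have "int (mdeg k) = e + (\<Sum>i<D. int (deg i))" if "\<phi> k \<noteq> 0" for k
  proof -
    have "w {} ({}, up (\<lambda>_. 0) k) \<noteq> 0" using that by (simp add: \<phi>_def f_def)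
    then have "tot (up (\<lambda>_. 0) k) = e + (\<Sum>i\<in>{..<D} - {}. int (deg i))"
      using w1(2) unfolding has_degree_def by blast
    then show ?thesis by (simp add: tot_up) (simp add: tot_def)
  qed
  ultimately show ?thesis by blast
qed

text \<open>By \<open>dim\<close> the link has no chains one dimension higher, so nonzero homology
  is a nonzero cycle \<open>c0\<close>. It is transplanted to the faces containing \<tau>. The
  premise \<open>small\<close> keeps it from being a Koszul image of a face cycle.\<close>

lemma survives_top:
  assumes \<tau>: "\<tau> \<in> \<Delta>" and nz: "\<not> red_homology_zero TYPE('k) (link \<Delta> \<tau>) (int D - int (card \<tau>) - 1)"
    and small: "\<And>\<sigma>. \<sigma> \<in> \<Delta> \<Longrightarrow> card \<sigma> < card \<tau> \<Longrightarrow>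
      red_homology_zero TYPE('k) (link \<Delta> \<sigma>) (int D - int (card \<sigma>) - 1)"
    and dim: "\<And>\<sigma>. \<sigma> \<in> \<Delta> \<Longrightarrow> card \<sigma> \<le> D"
  shows "\<exists>w. survives (- int (card \<tau>)) D w"
proof -
  have z: "(\<lambda>_. 0) \<in> (cycles (link \<Delta> \<tau>) i :: ('v set \<Rightarrow> 'k) set)" for i
    by (auto simp: cycles_def chains_def boundary_def)
  have "(boundaries (link \<Delta> \<tau>) (int D - int (card \<tau>) - 1) :: ('v set \<Rightarrow> 'k) set) = {\<lambda>_. 0}"
  proof -
    have "(chains (link \<Delta> \<tau>) (int D - int (card \<tau>)) :: ('v set \<Rightarrow> 'k) set) = {\<lambda>_. 0}"
    proof -
      have "c \<rho> = 0" if "c \<in> chains (link \<Delta> \<tau>) (int D - int (card \<tau>))" for c :: "'v set \<Rightarrow> 'k" and \<rho>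
      proof (rule ccontr)
        assume "c \<rho> \<noteq> 0"
        with that have "\<rho> \<inter> \<tau> = {}" "\<rho> \<union> \<tau> \<in> \<Delta>" "int (card \<rho>) = int D - int (card \<tau>) + 1"
          by (auto simp: chains_def link_def)
        then show False using dim[of "\<rho> \<union> \<tau>"] by (simp add: card_Un_disjoint)
      qed
      then show ?thesis by (auto simp: chains_def)
    qed
    then show ?thesis by (simp add: boundaries_def boundary_def)
  qed
  with nz have "(cycles (link \<Delta> \<tau>) (int D - int (card \<tau>) - 1) :: ('v set \<Rightarrow> 'k) set) \<noteq> {\<lambda>_. 0}"
    by (simp add: red_homology_zero_def)
  with z[of "int D - int (card \<tau>) - 1"] obtain c0 :: "'v set \<Rightarrow> 'k"
    where c0: "c0 \<in> cycles (link \<Delta> \<tau>) (int D - int (card \<tau>) - 1)" "c0 \<noteq> (\<lambda>_. 0)" by blast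
  have c0': "\<rho> \<inter> \<tau> = {}" "\<rho> \<union> \<tau> \<in> \<Delta>" "int (card \<rho>) = int D - int (card \<tau>)" if "c0 \<rho> \<noteq> 0" for \<rho>
    using c0(1) that by (auto simp: cycles_def chains_def link_def)
  \<comment> \<open>Among the exponents that are negative exactly on \<tau> and 0 elsewhere, this
    one has the largest total degree. Every exponent of larger total degree without positive entries
    then has fewer than \<open>card \<tau>\<close> negative ones.\<close>
  define mt where "mt = (\<lambda>v. if v \<in> \<tau> then -1 else 0 :: int)"
  have mt: "neg mt = \<tau>" "supp mt = \<tau>" "tot mt = - int (card \<tau>)"
    by (auto simp: mt_def neg_def supp_def tot_def sum.If_cases sum_negf)
  define c where "c = (\<lambda>(F, m). if m = mt then relink \<tau> c0 F else 0)"
  have rl: "\<tau> \<subseteq> F" "card F = D" "F \<in> \<Delta>" if "relink \<tau> c0 F \<noteq> 0" for F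
  proof -
    from that have F: "\<tau> \<subseteq> F" "c0 (F - \<tau>) \<noteq> 0" by (auto simp: relink_def split: if_splits)
    then have "F - \<tau> \<union> \<tau> = F" by auto
    with c0'[OF F(2)] F(1) show "\<tau> \<subseteq> F" "card F = D" "F \<in> \<Delta>"
      by (auto simp: card_Diff_subset card_mono of_nat_diff)
  qed
  have admc: "face_supported \<Delta> D c"
    unfolding face_supported_def c_def using rl by (auto simp: mt Un_absorb2)
  have resc: "face_boundary c = (\<lambda>_. 0)"
  proof (rule ext, clarify)
    fix G m
    have "boundary (relink \<tau> c0) G = 0" if "\<tau> \<subseteq> G"
      using boundary_relink[of c0, OF c0'(1) that] c0(1) by (simp add: cycles_def)
    moreover have "boundary (\<lambda>F. c (F, m)) G = (if m = mt then boundary (relink \<tau> c0) G else 0)"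
      by (simp add: c_def boundary_def)
    ultimately show "face_boundary c (G, m) = 0"
      by (auto simp: face_boundary_apply mt(1))
  qed
  obtain \<rho> where \<rho>: "c0 \<rho> \<noteq> 0" using c0(2) by auto
  have "unlink \<tau> (relink \<tau> c0) \<rho> \<noteq> 0" using unlink_relink[of c0 \<tau>] c0'(1) \<rho> by simp
  then have c_nz: "c (\<tau> \<union> \<rho>, mt) \<noteq> 0" by (auto simp: unlink_def c_def split: if_splits)
  define w where "w = (\<lambda>A. if A = {..<D} then c else (\<lambda>_. 0))"
  have biw: "bigraded (int D) D w"
    using admc face_supported_zero by (auto simp: w_def bigraded_def)
  moreover have "has_degree (- int (card \<tau>)) w"
    by (auto simp: has_degree_def w_def c_def mt(3) split: if_splits)
  \<comment> \<open>A nonzero Koszul image would need an index set with \<open>D + 1\<close>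
    elements.\<close>
  moreover have "koszul P w B = (\<lambda>_. 0)" for B
  proof (rule ccontr)
    assume "koszul P w B \<noteq> (\<lambda>_. 0)"
    from bigradedD(2)[OF bigraded_koszul[OF biw] this] show False
      using card_mono[of "{..<D}" B] by auto
  qed
  moreover have "face_boundary (w A) = (\<lambda>_. 0)" for A
    by (simp add: w_def resc flinear_zero[OF flinear_face_boundary])
  moreover have "\<exists>B. koszul P u B \<noteq> w B" if u: "bigraded (int D - 1) D u" "\<And>A. face_boundary (u A) = (\<lambda>_. 0)" for u
  proof (rule ccontr)
    assume "\<not> (\<exists>B. koszul P u B \<noteq> w B)"
    then have "koszul P u {..<D} (\<tau> \<union> \<rho>, mt) \<noteq> 0" using c_nz by (simp add: w_def)
    then have "(\<Sum>b\<in>{..<D}. face_sign b ({..<D} - {b}) * P b (u ({..<D} - {b})) (\<tau> \<union> \<rho>, mt)) \<noteq> 0"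
      by (simp add: koszul_def)
    then obtain b where b: "b \<in> {..<D}" "face_sign b ({..<D} - {b}) * P b (u ({..<D} - {b})) (\<tau> \<union> \<rho>, mt) \<noteq> 0"
      by (rule sum.not_neutral_contains_not_neutral)
    define f where "f = u ({..<D} - {b})"
    have "contract (\<theta> ! b) f (\<tau> \<union> \<rho>, mt) \<noteq> 0" using b by (auto simp: P_def f_def)
    then obtain k where k: "k \<in> Poly_Mapping.keys (\<theta> ! b)" "f (\<tau> \<union> \<rho>, up mt k) \<noteq> 0"
      by (auto simp: contract_apply dest: pairing_nonzeroD split: if_splits)
    have b': "b < length \<theta>" using b by (simp add: D_def)
    have t: "tot (up mt k) > - int (card \<tau>)"
      using deg_pos[OF b'] hom[OF b' k(1)] by (simp add: tot_up mt(3))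
    have "neg (up mt k) \<subseteq> \<tau>" using neg_up[of mt k] mt(1) by simp
    have f: "face_supported \<Delta> D f" unfolding f_def by (rule bigradedD(1)[OF u(1)])
    \<comment> \<open>\<open>small\<close> is available only in larger total degree, so
      \<open>f\<close> is cut down to the single exponent reached by \<open>k\<close>. It stays a
      cycle because the face differential preserves exponents.\<close>
    define f' where "f' = (\<lambda>(F, m). if m = up mt k then f (F, m) else 0)"
    have f': "face_supported \<Delta> D f'" using f by (auto simp: face_supported_def f'_def)
    have rf': "face_boundary f' = (\<lambda>_. 0)"
    proof (rule ext, clarify)
      fix G m
      have "boundary (\<lambda>F. f' (F, m)) G = (if m = up mt k then boundary (\<lambda>F. f (F, m)) G else 0)"
        by (simp add: f'_def boundary_def)
      then show "face_boundary f' (G, m) = 0"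
        using fun_cong[OF u(2)[of "{..<D} - {b}"], of "(G, m)"]
        by (auto simp: face_boundary_apply f_def split: if_splits)
    qed
    have "\<exists>g. face_supported \<Delta> (Suc D) g \<and> face_boundary g = f'"
    proof (rule face_boundary_exact[OF sc f' rf'])
      fix F m assume "f' (F, m) \<noteq> 0" and p: "pos m = {}"
      then have m: "m = up mt k" and "f (F, m) \<noteq> 0" by (auto simp: f'_def split: if_splits)
      from face_supportedD[OF f this(2)] have "neg m \<in> \<Delta>" by (auto intro: face_subset[OF sc])
      moreover have "card (neg m) < card \<tau>"
      proof -
        have "tot m \<le> (\<Sum>v\<in>UNIV. if v \<in> neg m then -1 else 0)"
          unfolding tot_def using p by (intro sum_mono) (auto simp: neg_def pos_def not_less)
        also have "\<dots> = - int (card (neg m))" by (simp add: sum.If_cases sum_negf)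
        finally show ?thesis using t m by simp
      qed
      ultimately show "red_homology_zero TYPE('k) (link \<Delta> (neg m)) (int D - int (card (neg m)) - 1)"
        by (rule small)
    qed
    then obtain g where g: "face_supported \<Delta> (Suc D) g" "face_boundary g = f'" by blast
    have "g (F, m) = 0" for F m
    proof (rule ccontr)
      assume "g (F, m) \<noteq> 0"
      from face_supportedD[OF g(1) this] have "card F = Suc D" "F \<in> \<Delta>" by (auto intro: face_subset[OF sc])
      then show False using dim[of F] by simp
    qed
    then have "g = (\<lambda>_. 0)" by (auto simp: fun_eq_iff)
    then have "f' (\<tau> \<union> \<rho>, up mt k) = 0" using g(2) flinear_zero[OF flinear_face_boundary] by metis
    with k(2) show False by (simp add: f'_def)
  qed
  ultimately have "survives (- int (card \<tau>)) D w" by (auto simp: survives_def)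
  then show ?thesis by blast
qed

end

section \<open>Euler characteristics and purity\<close>

text \<open>Extend a basis \<open>B0\<close> of the kernel to a basis \<open>B\<close> of
  \<open>V\<close>. A kernel vector in the span of \<open>B - B0\<close> is also in the span of
  \<open>B0\<close>, so its representations have disjoint supports and it is 0; thus
  \<open>f\<close> is injective on that span.\<close>

lemma (in vector_space_pair) rank_nullity:
  assumes f: "Vector_Spaces.linear s1 s2 f" and V: "vs1.subspace V" and fin: "finite S" "V \<subseteq> vs1.span S"
  shows "vs1.dim V = vs1.dim {x \<in> V. f x = 0} + vs2.dim (f ` V)"
proof -
  interpret f: Vector_Spaces.linear s1 s2 f by fact
  define K where "K = {x \<in> V. f x = 0}"
  obtain B0 where B0: "B0 \<subseteq> K" "vs1.independent B0" "K \<subseteq> vs1.span B0" "card B0 = vs1.dim K"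
    by (rule vs1.basis_exists)
  have "B0 \<subseteq> V" using B0(1) by (auto simp: K_def)
  then obtain B where B: "B0 \<subseteq> B" "B \<subseteq> V" "vs1.independent B" "V \<subseteq> vs1.span B"
    using B0(2) by (rule vs1.maximal_independent_subset_extend)
  have finB: "finite B"
    using vs1.independent_span_bound[OF fin(1) B(3)] B(2) fin(2) by blast
  have indC: "vs1.independent (B - B0)" using B(3) by (rule vs1.independent_mono) auto
  have inj: "inj_on f (vs1.span (B - B0))"
    unfolding f.inj_on_iff_eq_0[OF vs1.subspace_span]
  proof safe
    fix x assume x: "x \<in> vs1.span (B - B0)" "f x = 0"
    have "vs1.span (B - B0) \<subseteq> V" using B(2) V by (intro vs1.span_minimal) auto
    with x have x0: "x \<in> vs1.span B0" using B0(3) by (auto simp: K_def)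
    have "vs1.representation B x = vs1.representation (B - B0) x"
      by (rule vs1.representation_extend[OF B(3) x(1)]) auto
    moreover have "vs1.representation B x = vs1.representation B0 x"
      by (rule vs1.representation_extend[OF B(3) x0 B(1)])
    ultimately have "vs1.representation B0 x b = 0" for b
      using vs1.representation_ne_zero[of "B - B0" x b] vs1.representation_ne_zero[of B0 x b] by (metis DiffD2)
    then show "x = 0" using vs1.sum_nonzero_representation_eq[OF B0(2) x0] by simp
  qed
  have "vs2.dim (f ` V) = card (f ` (B - B0))"
  proof (rule vs2.dim_unique[OF _ _ _ refl])
    show "f ` (B - B0) \<subseteq> f ` V" using B(2) by auto
    have "f ` V \<subseteq> vs2.span (f ` B)" using B(4) by (rule f.spans_image)
    also have "\<dots> \<subseteq> vs2.span (insert 0 (f ` (B - B0)))"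
      using B0(1) by (intro vs2.span_mono) (auto simp: K_def)
    finally show "f ` V \<subseteq> vs2.span (f ` (B - B0))" by simp
    show "vs2.independent (f ` (B - B0))" using indC inj by (rule f.independent_injective_image)
  qed
  also have "\<dots> = card (B - B0)"
    by (rule card_image) (rule inj_on_subset[OF inj vs1.span_superset])
  also have "\<dots> = card B - card B0" using finB B(1) by (simp add: card_Diff_subset finite_subset)
  also have "card B = vs1.dim V" using B by (intro vs1.basis_card_eq_dim) auto
  finally show ?thesis
    using B0(4) card_mono[OF finB B(1)] \<open>card B = vs1.dim V\<close> by (simp add: K_def)
qed

lemma sum_fun_apply: "(\<Sum>i\<in>I. f i) x = (\<Sum>i\<in>I. f i x :: 'a::comm_monoid_add)"
  by (induction I rule: infinite_finite_induct) simp_all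

definition fscale :: "'k::field \<Rightarrow> ('x \<Rightarrow> 'k) \<Rightarrow> 'x \<Rightarrow> 'k" where
  "fscale c f x = c * f x"

lemma vector_space_fscale: "vector_space fscale"
  by unfold_locales (auto simp: fscale_def algebra_simps fun_eq_iff)

text \<open>Euler-Poincare, indexed by cardinality so that the empty face sits at
  \<open>j = 0\<close>. Exactness makes each face number the sum of two consecutive cycle
  dimensions, and the alternating sum telescopes.\<close>

lemma euler_char_eq_0:
  fixes \<Gamma> :: "'v::{finite,linorder} set set"
  assumes hom: "\<And>j. red_homology_zero TYPE('k::field) \<Gamma> (int j - 1)"
  shows "(\<Sum>\<sigma>\<in>\<Gamma>. (-1) ^ card \<sigma>) = (0::int)"
proof -
  interpret F: vector_space "fscale :: 'k \<Rightarrow> ('v set \<Rightarrow> 'k) \<Rightarrow> 'v set \<Rightarrow> 'k" by (rule vector_space_fscale)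
  interpret FF: vector_space_pair "fscale :: 'k \<Rightarrow> ('v set \<Rightarrow> 'k) \<Rightarrow> 'v set \<Rightarrow> 'k"
    "fscale :: 'k \<Rightarrow> ('v set \<Rightarrow> 'k) \<Rightarrow> 'v set \<Rightarrow> 'k" ..
  define C where "C j = (chains \<Gamma> (int j - 1) :: ('v set \<Rightarrow> 'k) set)" for j
  define Z where "Z j = (cycles \<Gamma> (int j - 1) :: ('v set \<Rightarrow> 'k) set)" for j
  define f where "f j = card {\<sigma> \<in> \<Gamma>. card \<sigma> = j}" for j
  define ind where "ind \<sigma> = (\<lambda>\<tau>. if \<tau> = \<sigma> then 1 else 0 :: 'k)" for \<sigma> :: "'v set"
  have lin: "Vector_Spaces.linear fscale fscale (boundary :: ('v set \<Rightarrow> 'k) \<Rightarrow> _)"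
    by unfold_locales
      (auto simp: boundary_def fscale_def fun_eq_iff distrib_left sum.distrib sum_distrib_left mult.left_commute)
  have subC: "F.subspace (C j)" for j
    by (auto simp: F.subspace_def C_def chains_def fscale_def) (metis add.right_neutral add_0)+
  have spanC: "C j \<subseteq> F.span (ind ` {\<sigma> \<in> \<Gamma>. card \<sigma> = j})" for j
  proof
    fix c assume c: "c \<in> C j"
    have "c = (\<Sum>\<sigma>\<in>{\<sigma> \<in> \<Gamma>. card \<sigma> = j}. fscale (c \<sigma>) (ind \<sigma>))"
    proof
      fix \<tau>
      have "(\<Sum>\<sigma>\<in>{\<sigma> \<in> \<Gamma>. card \<sigma> = j}. fscale (c \<sigma>) (ind \<sigma>)) \<tau> = (\<Sum>\<sigma>\<in>{\<sigma> \<in> \<Gamma>. card \<sigma> = j}. c \<sigma> * ind \<sigma> \<tau>)"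
        by (simp add: sum_fun_apply fscale_def)
      also have "\<dots> = c \<tau>"
        using c by (auto simp: ind_def C_def chains_def if_distrib[of "\<lambda>x. _ * x"] cong: if_cong)
      finally show "c \<tau> = (\<Sum>\<sigma>\<in>{\<sigma> \<in> \<Gamma>. card \<sigma> = j}. fscale (c \<sigma>) (ind \<sigma>)) \<tau>" ..
    qed
    also have "\<dots> \<in> F.span (ind ` {\<sigma> \<in> \<Gamma>. card \<sigma> = j})"
      by (intro F.span_sum F.span_scale F.span_base) auto
    finally show "c \<in> F.span (ind ` {\<sigma> \<in> \<Gamma>. card \<sigma> = j})" .
  qed
  have inj: "inj ind"
  proof (rule injI)
    fix \<sigma> \<tau> assume "ind \<sigma> = ind \<tau>"
    from fun_cong[OF this, of \<sigma>] show "\<sigma> = \<tau>" by (simp add: ind_def split: if_splits)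
  qed
  have indep: "F.independent (ind ` S)" for S
  proof (rule F.independent_if_scalars_zero)
    fix g x assume 0: "(\<Sum>x\<in>ind ` S. fscale (g x) x) = 0" and x: "x \<in> ind ` S"
    from x obtain \<sigma> where \<sigma>: "\<sigma> \<in> S" "x = ind \<sigma>" by auto
    have "0 = (\<Sum>x\<in>ind ` S. fscale (g x) x) \<sigma>" by (simp add: 0)
    also have "\<dots> = (\<Sum>x\<in>ind ` S. g x * x \<sigma>)"
      by (simp add: sum_fun_apply fscale_def)
    also have "\<dots> = (\<Sum>\<tau>\<in>S. g (ind \<tau>) * ind \<tau> \<sigma>)"
      by (subst sum.reindex) (auto intro: inj_on_subset[OF inj])
    also have "\<dots> = g x" using \<sigma> by (auto simp: ind_def if_distrib[of "\<lambda>x. _ * x"] cong: if_cong)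
    finally show "g x = 0" ..
  qed simp
  have dimC: "F.dim (C j) = f j" for j
    unfolding f_def
  proof (rule F.dim_unique[OF _ spanC indep])
    show "ind ` {\<sigma> \<in> \<Gamma>. card \<sigma> = j} \<subseteq> C j" by (auto simp: ind_def C_def chains_def split: if_splits)
    show "card (ind ` {\<sigma> \<in> \<Gamma>. card \<sigma> = j}) = card {\<sigma> \<in> \<Gamma>. card \<sigma> = j}"
      by (intro card_image inj_on_subset[OF inj]) auto
  qed
  have kerC: "{c \<in> C j. boundary c = 0} = Z j" for j
    by (auto simp: C_def Z_def cycles_def zero_fun_def)
  have rn: "f j = F.dim (Z j) + F.dim (boundary ` C j)" for j
    using FF.rank_nullity[OF lin subC _ spanC, of j] by (simp add: dimC kerC)
  have f0: "f 0 = F.dim (Z 0)"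
  proof -
    have "boundary c = (\<lambda>_. 0)" if "c \<in> C 0" for c
    proof -
      have "c (insert v \<tau>) = 0" for v \<tau> using that by (auto simp: C_def chains_def)
      then show ?thesis by (simp add: boundary_def)
    qed
    then have "C 0 = Z 0" by (auto simp: C_def Z_def cycles_def)
    then show ?thesis using dimC[of 0] by simp
  qed
  have fS: "f (Suc j) = F.dim (Z (Suc j)) + F.dim (Z j)" for j
  proof -
    have "boundary ` C (Suc j) = Z j"
      using hom[of j] by (auto simp: red_homology_zero_def boundaries_def C_def Z_def)
    then show ?thesis using rn[of "Suc j"] by simp
  qed
  have alt: "(\<Sum>j\<le>n. (-1) ^ j * int (f j)) = (-1) ^ n * int (F.dim (Z n))" for n
    by (induction n) (simp_all add: f0 fS algebra_simps)
  \<comment> \<open>Chosen above every cardinality, so that the term left over by the telescoping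
    sum vanishes.\<close>
  define n where "n = Suc (card (UNIV :: 'v set))"
  have big: "card \<sigma> < n" for \<sigma> :: "'v set" using card_mono[of UNIV \<sigma>] by (simp add: n_def)
  have "f n = 0" using big by (auto simp: f_def)
  then have "F.dim (Z n) = 0" using rn[of n] by simp
  have "(\<Sum>\<sigma>\<in>\<Gamma>. (-1) ^ card \<sigma>) = (\<Sum>j\<le>n. \<Sum>\<sigma>\<in>{\<sigma> \<in> \<Gamma>. card \<sigma> = j}. (-1) ^ card \<sigma> :: int)"
    using big by (intro sum.group[symmetric]) (auto intro: less_imp_le)
  also have "\<dots> = (\<Sum>j\<le>n. (-1) ^ j * int (f j))" by (simp add: f_def mult.commute)
  finally show ?thesis using alt[of n] \<open>F.dim (Z n) = 0\<close> by simp
qed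

section \<open>Links, connectedness and purity of Cohen-Macaulay complexes\<close>

lemma link_link:
  fixes \<Delta> :: "'v::{finite,linorder} set set"
  assumes "simplicial_complex \<Delta>" "\<tau> \<in> link \<Delta> \<sigma>"
  shows "link (link \<Delta> \<sigma>) \<tau> = link \<Delta> (\<sigma> \<union> \<tau>)"
proof (intro equalityI subsetI)
  fix \<rho> assume "\<rho> \<in> link (link \<Delta> \<sigma>) \<tau>"
  then show "\<rho> \<in> link \<Delta> (\<sigma> \<union> \<tau>)" by (auto simp: link_def Un_ac)
next
  fix \<rho> assume *: "\<rho> \<in> link \<Delta> (\<sigma> \<union> \<tau>)"
  then have 1: "\<rho> \<union> (\<sigma> \<union> \<tau>) \<in> \<Delta>" by (auto simp: link_def)
  have "\<rho> \<union> \<sigma> \<in> \<Delta>" "\<rho> \<union> \<tau> \<in> \<Delta>" "\<rho> \<union> \<tau> \<union> \<sigma> \<in> \<Delta>"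
    by (rule face_subset[OF assms(1) 1]; blast)+
  with * assms(2) show "\<rho> \<in> link (link \<Delta> \<sigma>) \<tau>" by (auto simp: link_def)
qed

lemma link_empty [simp]: "link \<Delta> {} = \<Delta>"
  by (auto simp: link_def)

lemma simplicial_complex_link:
  fixes \<Delta> :: "'v::{finite,linorder} set set"
  assumes "simplicial_complex \<Delta>" "\<sigma> \<in> \<Delta>"
  shows "simplicial_complex (link \<Delta> \<sigma>)"
  unfolding simplicial_complex_def
proof (intro conjI ballI allI impI)
  have "{} \<in> \<Delta>" by (rule face_subset[OF assms]) simp
  then show "link \<Delta> \<sigma> \<noteq> {}" using assms(2) by (auto simp: link_def)
  fix \<rho> \<tau> assume *: "\<rho> \<in> link \<Delta> \<sigma>" "\<tau> \<subseteq> \<rho>"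
  then have "\<tau> \<in> \<Delta>" "\<tau> \<union> \<sigma> \<in> \<Delta>"
    using face_subset[OF assms(1), of \<rho> \<tau>] face_subset[OF assms(1), of "\<rho> \<union> \<sigma>" "\<tau> \<union> \<sigma>"] by (auto simp: link_def)
  with * show "\<tau> \<in> link \<Delta> \<sigma>" by (auto simp: link_def)
qed

lemma cohen_macaulay_link:
  fixes \<Delta> :: "'v::{finite,linorder} set set"
  assumes "simplicial_complex \<Delta>" "cohen_macaulay K \<Delta>" "\<sigma> \<in> \<Delta>"
  shows "cohen_macaulay K (link \<Delta> \<sigma>)"
  unfolding cohen_macaulay_def
proof (intro ballI allI impI)
  fix \<tau> i assume \<tau>: "\<tau> \<in> link \<Delta> \<sigma>" and i: "i < cx_dim (link (link \<Delta> \<sigma>) \<tau>)"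
  have "\<sigma> \<union> \<tau> \<in> \<Delta>" using \<tau> by (simp add: link_def Un_commute)
  with assms(2) i show "red_homology_zero K (link (link \<Delta> \<sigma>) \<tau>) i"
    unfolding link_link[OF assms(1) \<tau>] cohen_macaulay_def by blast
qed

lemma Max_card_eqI:
  fixes \<Gamma> :: "'v::finite set set"
  assumes "\<And>\<rho>. \<rho> \<in> \<Gamma> \<Longrightarrow> card \<rho> \<le> r" "F \<in> \<Gamma>" "card F = r"
  shows "Max (card ` \<Gamma>) = r"
  using assms by (intro Max_eqI) auto

lemma card_le_Max_card: "\<rho> \<in> \<Gamma> \<Longrightarrow> card \<rho> \<le> Max (card ` \<Gamma>)" for \<rho> :: "'v::finite set"
  by (intro Max_ge) auto

text \<open>Before purity is known, the link of a face outside all top faces could have smaller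
  dimension; hence the premise that \<sigma> lies in a top face.\<close>

lemma Max_card_link:
  fixes \<Delta> :: "'v::finite set set"
  assumes "simplicial_complex \<Delta>" "F \<in> \<Delta>" "card F = Max (card ` \<Delta>)" "\<sigma> \<subseteq> F"
  shows "Max (card ` link \<Delta> \<sigma>) = Max (card ` \<Delta>) - card \<sigma>"
proof (rule Max_card_eqI)
  fix \<rho> assume "\<rho> \<in> link \<Delta> \<sigma>"
  then have "\<rho> \<inter> \<sigma> = {}" "\<rho> \<union> \<sigma> \<in> \<Delta>" by (auto simp: link_def)
  then show "card \<rho> \<le> Max (card ` \<Delta>) - card \<sigma>"
    using card_le_Max_card[of "\<rho> \<union> \<sigma>" \<Delta>] by (simp add: card_Un_disjoint)
next
  have "F - \<sigma> \<union> \<sigma> = F" using assms(4) by auto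
  moreover have "F - \<sigma> \<in> \<Delta>"
    using assms(1,2) unfolding simplicial_complex_def by (meson Diff_subset)
  ultimately show "F - \<sigma> \<in> link \<Delta> \<sigma>" using assms(2) by (auto simp: link_def)
  show "card (F - \<sigma>) = Max (card ` \<Delta>) - card \<sigma>"
    using assms(3,4) by (simp add: card_Diff_subset)
qed

text \<open>The 0-cycle supported on \<open>v\<close> and \<open>w\<close> bounds a 1-chain. If no
  edge left \<open>G\<close>, each edge inside \<open>G\<close> would contribute twice with opposite
  signs, so the coefficients over \<open>G\<close> would sum to 0; but this sum is -1.\<close>

lemma connected_if_red_homology_zero:
  fixes \<Gamma> :: "'v::{finite,linorder} set set"
  assumes sc: "simplicial_complex \<Gamma>" and hom: "red_homology_zero TYPE('k::field) \<Gamma> 0"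
    and v: "{v} \<in> \<Gamma>" "v \<notin> G" and w: "{w} \<in> \<Gamma>" "w \<in> G"
  shows "\<exists>x y. x \<in> G \<and> y \<notin> G \<and> {x, y} \<in> \<Gamma>"
proof (rule ccontr)
  assume no: "\<not> ?thesis"
  define c where "c \<sigma> = (if \<sigma> = {v} then 1 else if \<sigma> = {w} then - 1 else 0 :: 'k)" for \<sigma>
  have vw: "v \<noteq> w" using v w by auto
  have "boundary c = (\<lambda>_. 0)"
  proof
    fix \<tau>
    show "boundary c \<tau> = 0"
    proof (cases "\<tau> = {}")
      case True
      have "boundary c \<tau> = (\<Sum>u\<in>UNIV. (if u = v then 1 else 0) + (if u = w then - 1 else 0))"
        unfolding boundary_def using True vw by (intro sum.cong) (auto simp: c_def)
      then show ?thesis by (simp add: sum.distrib)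
    next
      case False
      then have "c (insert u \<tau>) = 0" if "u \<notin> \<tau>" for u using that by (auto simp: c_def)
      then show ?thesis by (simp add: boundary_def)
    qed
  qed
  moreover have "c \<in> chains \<Gamma> 0" using v w by (auto simp: chains_def c_def split: if_splits)
  ultimately have "c \<in> boundaries \<Gamma> 0" using hom by (auto simp: red_homology_zero_def cycles_def)
  then obtain b where b: "b \<in> chains \<Gamma> 1" "c = boundary b" by (auto simp: boundaries_def)
  define f where "f x y = (if x = y then 0 else face_sign y {x} * b {x, y})" for x y
  have "(\<Sum>x\<in>G. c {x}) = (\<Sum>x\<in>G. \<Sum>y\<in>G. f x y)"
  proof (rule sum.cong[OF refl])
    fix x assume x: "x \<in> G"
    have "c {x} = (\<Sum>y\<in>-{x}. f x y)"
      unfolding b(2) boundary_face_sign by (intro sum.cong) (auto simp: f_def insert_commute)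
    also have "\<dots> = (\<Sum>y\<in>UNIV. f x y)"
      by (intro sum.mono_neutral_left) (auto simp: f_def)
    also have "\<dots> = (\<Sum>y\<in>G. f x y)"
    proof (intro sum.mono_neutral_right ballI)
      fix y assume "y \<in> UNIV - G"
      then have "{x, y} \<notin> \<Gamma>" using no x by auto
      then have "b {x, y} = 0" using b(1) by (auto simp: chains_def)
      then show "f x y = 0" by (simp add: f_def)
    qed auto
    finally show "c {x} = (\<Sum>y\<in>G. f x y)" .
  qed
  also have "\<dots> = 0"
  proof (rule sum_antisym_eq_0)
    fix x y :: 'v
    have "face_sign y {x} = (- face_sign x {y} :: 'k)" if "x \<noteq> y"
      using that by (cases x y rule: linorder_cases) (simp_all add: face_sign_insert face_sign_def[of _ "{}"])
    then show "f x y = - f y x" by (simp add: f_def insert_commute)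
  qed (auto simp: f_def)
  also have "(\<Sum>x\<in>G. c {x}) = (\<Sum>x\<in>G. if x = w then - 1 else 0)"
    using v by (intro sum.cong) (auto simp: c_def)
  finally show False using w by simp
qed

text \<open>Let \<open>G\<close> be the vertices of top faces. If \<open>v\<close> were outside,
  connectedness would give an edge \<open>{x, y}\<close> leaving \<open>G\<close> at
  \<open>x\<close>. The link of \<open>x\<close> has dimension one less, so by induction
  \<open>y\<close> lies in a top face of it; adding \<open>x\<close> yields a top face containing
  \<open>y\<close>.\<close>

lemma cohen_macaulay_vertex_in_top_face:
  fixes \<Gamma> :: "'v::{finite,linorder} set set"
  assumes "simplicial_complex \<Gamma>" "cohen_macaulay TYPE('k::field) \<Gamma>" "{v} \<in> \<Gamma>"
  shows "\<exists>F\<in>\<Gamma>. v \<in> F \<and> card F = Max (card ` \<Gamma>)"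
  using assms
proof (induction "Max (card ` \<Gamma>)" arbitrary: \<Gamma> v rule: less_induct)
  case less
  define r where "r = Max (card ` \<Gamma>)"
  define G where "G = {w. \<exists>F\<in>\<Gamma>. w \<in> F \<and> card F = r}"
  have r1: "r \<ge> 1" using card_le_Max_card[OF less.prems(3)] by (simp add: r_def)
  show ?case
  proof (cases "r = 1")
    case True
    then show ?thesis using less.prems(3) by (intro bexI[of _ "{v}"]) (auto simp: r_def)
  next
    case False
    have "v \<in> G"
    proof (rule ccontr)
      assume v: "v \<notin> G"
      have "r \<in> card ` \<Gamma>" unfolding r_def
        using less.prems(1) by (intro Max_in) (auto simp: simplicial_complex_def)
      then obtain F where F: "F \<in> \<Gamma>" "card F = r" by auto
      then obtain w where "w \<in> F" using r1 by fastforce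
      then have w: "w \<in> G" "{w} \<in> \<Gamma>"
        using F face_subset[OF less.prems(1) F(1), of "{w}"] by (auto simp: G_def)
      have "{} \<in> \<Gamma>" using face_subset[OF less.prems(1) F(1)] by simp
      moreover have "0 < cx_dim (link \<Gamma> {})" using False r1 by (simp add: cx_dim_def r_def)
      ultimately have "red_homology_zero TYPE('k) \<Gamma> 0"
        using less.prems(2) unfolding cohen_macaulay_def by (metis link_empty)
      from connected_if_red_homology_zero[OF less.prems(1) this less.prems(3) v w(2,1)]
      obtain x y where xy: "x \<in> G" "y \<notin> G" "{x, y} \<in> \<Gamma>" by blast
      from xy(1) obtain F where F: "F \<in> \<Gamma>" "x \<in> F" "card F = r" by (auto simp: G_def)
      have x: "{x} \<in> \<Gamma>" and y: "{y} \<in> \<Gamma>" by (rule face_subset[OF less.prems(1) xy(3)]; simp)+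
      have r': "Max (card ` link \<Gamma> {x}) = r - 1"
        using Max_card_link[OF less.prems(1) F(1), of "{x}"] F by (simp add: r_def)
      have "{y} \<in> link \<Gamma> {x}" using xy y by (auto simp: link_def insert_commute)
      then have "\<exists>F\<in>link \<Gamma> {x}. y \<in> F \<and> card F = Max (card ` link \<Gamma> {x})"
        using r' r1 x by (intro less.hyps simplicial_complex_link cohen_macaulay_link less.prems)
          (auto simp: r_def)
      then obtain F' where F': "F' \<in> link \<Gamma> {x}" "y \<in> F'" "card F' = r - 1" using r' by auto
      then have "insert x F' \<in> \<Gamma>" "card (insert x F') = r" "y \<in> insert x F'"
        using r1 by (auto simp: link_def)
      then have "y \<in> G" unfolding G_def by blast
      with xy(2) show False by simp
    qed
    then show ?thesis by (auto simp: G_def r_def)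
  qed
qed

text \<open>Enlarge the face one vertex at a time. The face reached so far lies in a top face, so
  its link has the expected dimension, and the next vertex lies in a top face of that link.\<close>

lemma cohen_macaulay_pure:
  fixes \<Delta> :: "'v::{finite,linorder} set set"
  assumes sc: "simplicial_complex \<Delta>" and cm: "cohen_macaulay TYPE('k::field) \<Delta>" and "\<sigma> \<in> \<Delta>"
  shows "\<exists>F\<in>\<Delta>. \<sigma> \<subseteq> F \<and> card F = Max (card ` \<Delta>)"
  using finite[of \<sigma>] \<open>\<sigma> \<in> \<Delta>\<close>
proof (induction rule: finite_induct)
  case empty
  have "Max (card ` \<Delta>) \<in> card ` \<Delta>"
    using sc by (intro Max_in) (auto simp: simplicial_complex_def)
  then show ?case by auto
next
  case (insert v \<sigma>)
  have \<sigma>: "\<sigma> \<in> \<Delta>" and v: "{v} \<in> \<Delta>" by (rule face_subset[OF sc insert.prems]; auto)+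
  from insert.IH[OF \<sigma>] obtain F where F: "F \<in> \<Delta>" "\<sigma> \<subseteq> F" "card F = Max (card ` \<Delta>)" by auto
  have m: "Max (card ` link \<Delta> \<sigma>) = Max (card ` \<Delta>) - card \<sigma>"
    using Max_card_link[OF sc F(1,3,2)] .
  have "{v} \<in> link \<Delta> \<sigma>" using v insert by (auto simp: link_def)
  from cohen_macaulay_vertex_in_top_face[OF simplicial_complex_link[OF sc \<sigma>] cohen_macaulay_link[OF sc cm \<sigma>] this]
  obtain F' where F': "F' \<in> link \<Delta> \<sigma>" "v \<in> F'" "card F' = Max (card ` \<Delta>) - card \<sigma>" using m by auto
  have "card \<sigma> \<le> Max (card ` \<Delta>)" using \<sigma> by (rule card_le_Max_card)
  then have "F' \<union> \<sigma> \<in> \<Delta>" "card (F' \<union> \<sigma>) = Max (card ` \<Delta>)"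
    using F' by (auto simp: link_def card_Un_disjoint)
  with F'(2) show ?case by (intro bexI[of _ "F' \<union> \<sigma>"]) auto
qed

text \<open>Purity fixes the dimension of every link, which turns the Cohen-Macaulay condition into
  the bound \<open>j < D\<close> uniformly in \<sigma>. This is the form in which the zigzag uses
  it.\<close>

lemma cohen_macaulay_link_homology:
  fixes \<Delta> :: "'v::{finite,linorder} set set"
  assumes sc: "simplicial_complex \<Delta>" and cm: "cohen_macaulay TYPE('k::field) \<Delta>" and \<sigma>: "\<sigma> \<in> \<Delta>"
    and j: "j < Max (card ` \<Delta>)"
  shows "red_homology_zero TYPE('k) (link \<Delta> \<sigma>) (int j - int (card \<sigma>) - 1)"
proof -
  from cohen_macaulay_pure[OF sc cm \<sigma>] obtain F
    where F: "F \<in> \<Delta>" "\<sigma> \<subseteq> F" "card F = Max (card ` \<Delta>)" by auto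
  have "int j - int (card \<sigma>) - 1 < cx_dim (link \<Delta> \<sigma>)"
    using j card_le_Max_card[OF \<sigma>] by (simp add: cx_dim_def Max_card_link[OF sc F(1,3,2)] of_nat_diff)
  then show ?thesis using cm \<sigma> unfolding cohen_macaulay_def by blast
qed

text \<open>The Cohen-Macaulay condition leaves open only the top homology of the link. If that
  vanishes too, the link is acyclic, and the sum is up to sign its reduced Euler
  characteristic.\<close>

lemma sum_star_eq_0:
  fixes \<Delta> :: "'v::{finite,linorder} set set"
  assumes sc: "simplicial_complex \<Delta>" and cm: "cohen_macaulay TYPE('k::field) \<Delta>" and \<tau>: "\<tau> \<in> \<Delta>"
    and top: "red_homology_zero TYPE('k) (link \<Delta> \<tau>) (int (Max (card ` \<Delta>)) - int (card \<tau>) - 1)"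
  shows "(\<Sum>\<sigma>\<in>{\<sigma> \<in> \<Delta>. \<tau> \<subseteq> \<sigma>}. (-1) ^ card \<sigma>) = (0::int)"
proof -
  let ?D = "Max (card ` \<Delta>)"
  have "red_homology_zero TYPE('k) (link \<Delta> \<tau>) (int j - 1)" for j
  proof -
    consider "j + card \<tau> < ?D" | "j + card \<tau> = ?D" | "j + card \<tau> > ?D" by linarith
    then show ?thesis
    proof cases
      case 1
      then show ?thesis using cohen_macaulay_link_homology[OF sc cm \<tau>, of "j + card \<tau>"] by simp
    next
      case 2
      then have "int ?D - int (card \<tau>) - 1 = int j - 1" by linarith
      with top show ?thesis by simp
    next
      case 3
      have "(chains (link \<Delta> \<tau>) i :: ('v set \<Rightarrow> 'k) set) = {\<lambda>_. 0}" if "i \<ge> int j - 1" for i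
      proof -
        have "c \<rho> = 0" if "c \<in> chains (link \<Delta> \<tau>) i" for c :: "'v set \<Rightarrow> 'k" and \<rho>
        proof (rule ccontr)
          assume "c \<rho> \<noteq> 0"
          with that have \<rho>: "\<rho> \<inter> \<tau> = {}" "\<rho> \<union> \<tau> \<in> \<Delta>" "int (card \<rho>) = i + 1"
            by (auto simp: chains_def link_def)
          then have "int (card \<rho>) + int (card \<tau>) \<le> int ?D"
            using card_le_Max_card[OF \<rho>(2)] by (simp add: card_Un_disjoint)
          with \<rho>(3) 3 \<open>i \<ge> int j - 1\<close> show False by linarith
        qed
        then show ?thesis by (auto simp: chains_def)
      qed
      then have c: "(chains (link \<Delta> \<tau>) (int j - 1) :: ('v set \<Rightarrow> 'k) set) = {\<lambda>_. 0}"
        "(chains (link \<Delta> \<tau>) (int j - 1 + 1) :: ('v set \<Rightarrow> 'k) set) = {\<lambda>_. 0}"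
        by simp_all
      have z: "boundary (\<lambda>_. 0) = (\<lambda>_::'v set. 0::'k)" by (simp add: boundary_def)
      show ?thesis
        unfolding red_homology_zero_def cycles_def boundaries_def c using z by auto
    qed
  qed
  then have *: "(\<Sum>\<rho>\<in>link \<Delta> \<tau>. (-1) ^ card \<rho>) = (0::int)" by (rule euler_char_eq_0)
  have "(\<Sum>\<sigma>\<in>{\<sigma> \<in> \<Delta>. \<tau> \<subseteq> \<sigma>}. (-1) ^ card \<sigma>) = (\<Sum>\<rho>\<in>link \<Delta> \<tau>. (-1) ^ card (\<rho> \<union> \<tau>) :: int)"
  proof (rule sum.reindex_bij_witness[of _ "\<lambda>\<rho>. \<rho> \<union> \<tau>" "\<lambda>\<sigma>. \<sigma> - \<tau>"])
    fix \<sigma> assume \<sigma>: "\<sigma> \<in> {\<sigma> \<in> \<Delta>. \<tau> \<subseteq> \<sigma>}"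
    then show e: "\<sigma> - \<tau> \<union> \<tau> = \<sigma>" by auto
    have "\<sigma> - \<tau> \<in> \<Delta>" using \<sigma> face_subset[OF sc, of \<sigma> "\<sigma> - \<tau>"] by auto
    with \<sigma> e show "\<sigma> - \<tau> \<in> link \<Delta> \<tau>" by (auto simp: link_def)
    show "(-1) ^ card (\<sigma> - \<tau> \<union> \<tau>) = ((-1) ^ card \<sigma> :: int)" using e by simp
  qed (auto simp: link_def)
  also have "\<dots> = (\<Sum>\<rho>\<in>link \<Delta> \<tau>. (-1) ^ card \<tau> * (-1) ^ card \<rho>)"
    by (intro sum.cong) (auto simp: link_def card_Un_disjoint power_add)
  finally show ?thesis by (simp add: sum_distrib_left[symmetric] *)
qed

section \<open>Dimensions of quotients\<close>

text \<open>Projection of \<open>R\<close> along \<open>U\<close> onto a complement. It models the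
  quotient inside \<open>R\<close>, so that dimensions in \<open>R/U\<close> become ordinary
  dimensions of images.\<close>

lemma ex_linear_with_kernel:
  fixes U :: "('v, 'k::field) mpol set"
  assumes "pvs.subspace U"
  shows "\<exists>\<pi> :: ('v, 'k) mpol \<Rightarrow> ('v, 'k) mpol.
    Vector_Spaces.linear smul smul \<pi> \<and> (\<forall>x. \<pi> x = 0 \<longleftrightarrow> x \<in> U)"
proof -
  interpret PP: vector_space_pair "smul :: 'k \<Rightarrow> ('v, 'k) mpol \<Rightarrow> ('v, 'k) mpol"
    "smul :: 'k \<Rightarrow> ('v, 'k) mpol \<Rightarrow> ('v, 'k) mpol" ..
  obtain B0 where B0: "B0 \<subseteq> U" "pvs.independent B0" "U \<subseteq> pvs.span B0"
    using pvs.basis_exists[of U] by metis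
  obtain B where B: "B0 \<subseteq> B" "pvs.independent B" "UNIV \<subseteq> pvs.span B"
    using pvs.maximal_independent_subset_extend[OF subset_UNIV B0(2)] by metis
  define \<pi> where "\<pi> = PP.construct B (\<lambda>b. if b \<in> B0 then 0 else b)"
  have lin: "Vector_Spaces.linear smul smul \<pi>" unfolding \<pi>_def by (rule PP.linear_construct[OF B(2)])
  interpret \<pi>: Vector_Spaces.linear smul smul \<pi> by (rule lin)
  have \<pi>0: "\<pi> b = 0" if "b \<in> B0" for b
    using that B(1) PP.construct_basis[OF B(2)] by (auto simp: \<pi>_def)
  have \<pi>1: "\<pi> b = b" if "b \<in> B - B0" for b
    using that PP.construct_basis[OF B(2)] by (auto simp: \<pi>_def)
  have U0: "\<pi> x = 0" if "x \<in> U" for x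
    using \<pi>.eq_0_on_span[OF \<pi>0] that B0(3) by blast
  have id: "\<pi> x = x" if "x \<in> pvs.span (B - B0)" for x
    using PP.linear_eq_on[OF lin pvs.linear_id[unfolded id_def] that] \<pi>1 by simp
  have "x \<in> U" if x: "\<pi> x = 0" for x
  proof -
    have "x \<in> pvs.span (B0 \<union> (B - B0))" using B(1,3) by (simp add: Un_absorb1 subset_iff)
    then obtain u w where uw: "x = u + w" "u \<in> pvs.span B0" "w \<in> pvs.span (B - B0)"
      unfolding pvs.span_Un by blast
    have "u \<in> U" using uw(2) pvs.span_minimal[OF B0(1) assms] by blast
    with uw x have "w = 0" by (simp add: \<pi>.add U0 id)
    with uw \<open>u \<in> U\<close> show ?thesis by simp
  qed
  with U0 have "\<forall>x. \<pi> x = 0 \<longleftrightarrow> x \<in> U" by auto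
  with lin show ?thesis by (intro exI[of _ \<pi>] conjI)
qed

text \<open>All bases of the quotient have the same cardinality, so the choice in
  \<open>quot_dim\<close> is harmless.\<close>

lemma quot_dim_eq_dim_image:
  fixes U :: "('v, 'k::field) mpol set"
  assumes lin: "Vector_Spaces.linear smul smul \<pi>" and ker: "\<And>x. \<pi> x = 0 \<longleftrightarrow> x \<in> U"
    and fin: "finite S" "V \<subseteq> pvs.span S"
  shows "quot_dim V U = pvs.dim (\<pi> ` V)" and "\<exists>B. quot_basis V U B"
    and "\<And>B. quot_basis V U B \<Longrightarrow> card B = pvs.dim (\<pi> ` V)"
proof -
  interpret \<pi>: Vector_Spaces.linear smul smul \<pi> by (rule lin)
  have \<pi>sum: "\<pi> (\<Sum>b\<in>B. smul (c b) b) = (\<Sum>b\<in>B. smul (c b) (\<pi> b))" for c B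
    by (simp add: \<pi>.sum \<pi>.scale)
  show card: "card B = pvs.dim (\<pi> ` V)" if B: "quot_basis V U B" for B
  proof -
    have B': "finite B" "B \<subseteq> V" "V \<subseteq> pvs.span (B \<union> U)" "\<And>c. (\<Sum>b\<in>B. smul (c b) b) \<in> U \<Longrightarrow> \<forall>b\<in>B. c b = 0"
      using B by (auto simp: quot_basis_def)
    have inj: "inj_on \<pi> B"
    proof (rule inj_onI, rule ccontr)
      fix x y assume xy: "x \<in> B" "y \<in> B" "\<pi> x = \<pi> y" "x \<noteq> y"
      define c where "c b = (if b = x then 1 else if b = y then - 1 else 0 :: 'k)" for b
      have "(\<Sum>b\<in>B. smul (c b) b) = (\<Sum>b\<in>{x, y}. smul (c b) b)"
        using xy B'(1) by (intro sum.mono_neutral_right) (auto simp: c_def)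
      also have "\<dots> = x - y" using xy by (simp add: c_def)
      also have "\<dots> \<in> U" using xy by (simp add: ker[symmetric] \<pi>.diff)
      finally have "c x = 0" using B'(4) xy by blast
      then show False by (simp add: c_def)
    qed
    have indep: "pvs.independent (\<pi> ` B)"
    proof (rule pvs.independent_if_scalars_zero)
      show "finite (\<pi> ` B)" using B'(1) by simp
      fix g x assume "(\<Sum>x\<in>\<pi> ` B. smul (g x) x) = 0" and x: "x \<in> \<pi> ` B"
      then have "(\<Sum>b\<in>B. smul (g (\<pi> b)) (\<pi> b)) = 0" by (simp add: sum.reindex[OF inj])
      then have "(\<Sum>b\<in>B. smul (g (\<pi> b)) b) \<in> U"
        using \<pi>sum[of "\<lambda>b. g (\<pi> b)" B] by (simp add: ker[symmetric])
      from B'(4)[OF this] x show "g x = 0" by auto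
    qed
    have "\<pi> ` V \<subseteq> pvs.span (\<pi> ` (B \<union> U))" using B'(3) by (rule \<pi>.spans_image)
    also have "\<dots> \<subseteq> pvs.span (insert 0 (\<pi> ` B))" using ker by (intro pvs.span_mono) auto
    finally have "\<pi> ` V \<subseteq> pvs.span (\<pi> ` B)" by simp
    then have "card (\<pi> ` B) = pvs.dim (\<pi> ` V)"
      using B'(2) indep by (intro pvs.basis_card_eq_dim) auto
    then show ?thesis by (simp add: card_image[OF inj])
  qed
  show ex: "\<exists>B. quot_basis V U B"
  proof -
    obtain C where C: "C \<subseteq> \<pi> ` V" "pvs.independent C" "\<pi> ` V \<subseteq> pvs.span C"
      using pvs.basis_exists[of "\<pi> ` V"] by metis
    have "\<pi> ` V \<subseteq> pvs.span (\<pi> ` S)" using fin(2) by (rule \<pi>.spans_image)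
    then have finC: "finite C" using pvs.independent_span_bound[OF _ C(2), of "\<pi> ` S"] C(1) fin(1) by blast
    obtain B where B: "B \<subseteq> V" "inj_on \<pi> B" "C = \<pi> ` B"
      using C(1) by (auto simp: subset_image_inj)
    have finB: "finite B" using finC B by (simp add: finite_image_iff)
    have "quot_basis V U B"
      unfolding quot_basis_def
    proof (intro conjI allI impI)
      show "V \<subseteq> pvs.span (B \<union> U)"
      proof
        fix x assume "x \<in> V"
        then have "\<pi> x \<in> \<pi> ` pvs.span B" using C(3) B(3) \<pi>.span_image by auto
        then obtain y where y: "y \<in> pvs.span B" "\<pi> x = \<pi> y" by auto
        then have "x - y \<in> U" by (simp add: ker[symmetric] \<pi>.diff)
        then have "x - y \<in> pvs.span (B \<union> U)" by (intro pvs.span_base) simp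
        moreover have "y \<in> pvs.span (B \<union> U)" using y(1) pvs.span_mono[of B "B \<union> U"] by auto
        ultimately show "x \<in> pvs.span (B \<union> U)" using pvs.span_add by fastforce
      qed
      fix c assume "(\<Sum>b\<in>B. smul (c b) b) \<in> U"
      then have "(\<Sum>b\<in>B. smul (c b) (\<pi> b)) = 0" by (simp add: ker[symmetric] \<pi>sum)
      then have s: "(\<Sum>x\<in>\<pi> ` B. smul (c (inv_into B \<pi> x)) x) = 0"
        using B(2) by (simp add: sum.reindex)
      have "c (inv_into B \<pi> (\<pi> b)) = 0" if "b \<in> B" for b
      proof -
        have "(\<Sum>x\<in>C. smul (u x) x) = 0 \<longrightarrow> (\<forall>x\<in>C. u x = 0)" for u
          using C(2)[unfolded pvs.independent_explicit_finite_subsets, rule_format, OF order_refl finC, of u]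
          by auto
        from this[of "\<lambda>x. c (inv_into B \<pi> x)"] s have "\<forall>x\<in>\<pi> ` B. c (inv_into B \<pi> x) = 0"
          unfolding B(3)[symmetric] by auto
        then show ?thesis using that by auto
      qed
      then show "\<forall>b\<in>B. c b = 0" using B(2) by simp
    qed (use finB B in auto)
    then show ?thesis ..
  qed
  show "quot_dim V U = pvs.dim (\<pi> ` V)"
    unfolding quot_dim_def using someI_ex[OF ex] by (rule card)
qed

text \<open>The image of \<open>W\<close> is a subspace of full dimension in the finite-dimensional
  span of the image of \<open>V\<close>, hence contains that image.\<close>

lemma quot_dim_eq_imp_subset:
  fixes U :: "('v, 'k::field) mpol set"
  assumes U: "pvs.subspace U" and W: "pvs.subspace W" "W \<subseteq> V" and fin: "finite S" "V \<subseteq> pvs.span S"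
    and eq: "quot_dim W U = quot_dim V U" and x: "x \<in> V"
  shows "\<exists>w\<in>W. w - x \<in> U"
proof -
  obtain \<pi> :: "('v, 'k) mpol \<Rightarrow> ('v, 'k) mpol"
    where lin: "Vector_Spaces.linear smul smul \<pi>" and ker: "\<And>x. \<pi> x = 0 \<longleftrightarrow> x \<in> U"
    using ex_linear_with_kernel[OF U] by blast
  interpret \<pi>: Vector_Spaces.linear smul smul \<pi> by (rule lin)
  have "pvs.dim (\<pi> ` W) = pvs.dim (\<pi> ` V)"
    using eq quot_dim_eq_dim_image(1)[OF lin ker fin]
      quot_dim_eq_dim_image(1)[OF lin ker fin(1), of W] W(2) fin(2) by (metis order_trans)
  have fV: "\<pi> ` V \<subseteq> pvs.span (\<pi> ` S)" using fin(2) by (rule \<pi>.spans_image)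
  obtain B where B: "B \<subseteq> \<pi> ` W" "pvs.independent B" "\<pi> ` W \<subseteq> pvs.span B" "card B = pvs.dim (\<pi> ` W)"
    by (rule pvs.basis_exists)
  obtain C where C: "C \<subseteq> \<pi> ` V" "pvs.independent C" "\<pi> ` V \<subseteq> pvs.span C" "card C = pvs.dim (\<pi> ` V)"
    by (rule pvs.basis_exists)
  have BV: "B \<subseteq> \<pi> ` V" using B(1) W(2) by auto
  have finB: "finite B" and finC: "finite C"
    using pvs.independent_span_bound[OF _ B(2), of "\<pi> ` S"] pvs.independent_span_bound[OF _ C(2), of "\<pi> ` S"]
      BV C(1) fV fin(1) by blast+
  have "\<pi> x \<in> pvs.span B"
  proof (rule ccontr)
    assume n: "\<pi> x \<notin> pvs.span B"
    then have "\<pi> x \<notin> B" using pvs.span_base by blast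
    have "pvs.independent (insert (\<pi> x) B)" using n B(2) by (rule pvs.independent_insertI)
    from pvs.independent_span_bound[OF finC this] have "card (insert (\<pi> x) B) \<le> card C"
      using BV C(3) x by auto
    with B(4) C(4) \<open>pvs.dim (\<pi> ` W) = _\<close> finB \<open>\<pi> x \<notin> B\<close> show False by simp
  qed
  also have "pvs.span B \<subseteq> \<pi> ` W"
    using B(1) W(1) by (intro pvs.span_minimal \<pi>.subspace_image)
  finally obtain w where "w \<in> W" "\<pi> x = \<pi> w" by auto
  then show ?thesis by (intro bexI[of _ w]) (auto simp: ker[symmetric] \<pi>.diff)
qed

section \<open>Graded pieces and monomial bases\<close>

lemma lookup_smul: "Poly_Mapping.lookup (smul c p) k = c * Poly_Mapping.lookup p k"
proof -
  have "smul c p = (\<Sum>k\<in>Poly_Mapping.keys p. Poly_Mapping.single k (c * Poly_Mapping.lookup p k))"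
    unfolding smul_def
    by (subst (2) sum_single_lookup[symmetric]) (simp add: sum_distrib_left mult_single)
  then show ?thesis by (auto simp: lookup_sum lookup_single when_def in_keys_iff)
qed

lemma smul_single: "smul c (Poly_Mapping.single k d) = Poly_Mapping.single k (c * d)"
  by (simp add: smul_def mult_single)

lemma pideal_subspace: "pvs.subspace (pideal.span G)"
  unfolding pvs.subspace_def smul_def
  by (auto intro: pideal.span_zero pideal.span_add pideal.span_scale)

lemma finite_mdeg: "finite {k::'v::finite \<Rightarrow>\<^sub>0 nat. mdeg k = i}"
proof (rule finite_imageD)
  have "Poly_Mapping.lookup k v \<le> mdeg k" for k :: "'v \<Rightarrow>\<^sub>0 nat" and v
    unfolding mdeg_def by (rule member_le_sum) auto
  then have "Poly_Mapping.lookup ` {k::'v \<Rightarrow>\<^sub>0 nat. mdeg k = i} \<subseteq> (UNIV \<rightarrow>\<^sub>E {..i})" by auto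
  then show "finite (Poly_Mapping.lookup ` {k::'v \<Rightarrow>\<^sub>0 nat. mdeg k = i})"
    by (rule finite_subset) (auto intro: finite_PiE)
  show "inj_on Poly_Mapping.lookup {k::'v \<Rightarrow>\<^sub>0 nat. mdeg k = i}"
    by (rule inj_onI, rule poly_mapping_eqI) simp
qed

lemma poly_in_span_monomials:
  assumes "Poly_Mapping.keys p \<subseteq> M"
  shows "p \<in> pvs.span ((\<lambda>k. Poly_Mapping.single k 1) ` M)"
proof -
  have "p = (\<Sum>k\<in>Poly_Mapping.keys p. smul (Poly_Mapping.lookup p k) (Poly_Mapping.single k 1))"
    by (simp add: smul_single sum_single_lookup)
  also have "\<dots> \<in> pvs.span ((\<lambda>k. Poly_Mapping.single k 1) ` M)"
    using assms by (intro pvs.span_sum pvs.span_scale pvs.span_base) auto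
  finally show ?thesis .
qed

lemma hcomp_subset_span:
  "hcomp i \<subseteq> pvs.span ((\<lambda>k. Poly_Mapping.single k (1::'k::field)) ` {k::'v::finite \<Rightarrow>\<^sub>0 nat. mdeg k = nat i})"
  by (auto simp: hcomp_def intro!: poly_in_span_monomials)

lemma keys_plus_nat: "Poly_Mapping.keys (k + l) = Poly_Mapping.keys k \<union> Poly_Mapping.keys (l :: 'v \<Rightarrow>\<^sub>0 nat)"
  by (auto simp: in_keys_iff lookup_add)

lemma SR_ideal_iff:
  fixes \<Delta> :: "'v::{finite,linorder} set set" and p :: "('v, 'k::field) mpol"
  assumes sc: "simplicial_complex \<Delta>"
  shows "p \<in> SR_ideal \<Delta> \<longleftrightarrow> (\<forall>k\<in>Poly_Mapping.keys p. Poly_Mapping.keys k \<notin> \<Delta>)"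
proof
  assume "p \<in> SR_ideal \<Delta>"
  then show "\<forall>k\<in>Poly_Mapping.keys p. Poly_Mapping.keys k \<notin> \<Delta>"
    unfolding SR_ideal_def
  proof (induction rule: pideal.span_induct_alt)
    case (step c x y)
    then obtain \<tau> where \<tau>: "x = (\<Prod>i\<in>\<tau>. var i)" "\<tau> \<notin> \<Delta>" by auto
    show ?case
    proof
      fix k assume "k \<in> Poly_Mapping.keys (c * x + y)"
      then consider "k \<in> Poly_Mapping.keys (c * x)" | "k \<in> Poly_Mapping.keys y"
        using Poly_Mapping.keys_add[of "c * x" y] by blast
      then show "Poly_Mapping.keys k \<notin> \<Delta>"
      proof cases
        case 1
        then obtain l where "k = l + (\<Sum>i\<in>\<tau>. Poly_Mapping.single i 1)"
          using keys_mult[of c x] by (auto simp: \<tau>(1) prod_var)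
        moreover have "Poly_Mapping.keys (\<Sum>i\<in>\<tau>. Poly_Mapping.single i (1::nat)) = \<tau>"
          using lookup_sum_single_1[of \<tau>] by (auto simp: in_keys_iff split: if_splits)
        ultimately have "\<tau> \<subseteq> Poly_Mapping.keys k" by (simp add: keys_plus_nat)
        with \<tau>(2) show ?thesis using face_subset[OF sc] by blast
      qed (use step.IH in auto)
    qed
  qed simp
next
  assume *: "\<forall>k\<in>Poly_Mapping.keys p. Poly_Mapping.keys k \<notin> \<Delta>"
  have "Poly_Mapping.single k c \<in> SR_ideal \<Delta>" if "Poly_Mapping.keys k \<notin> \<Delta>" for k and c :: 'k
  proof -
    let ?s = "\<Sum>i\<in>Poly_Mapping.keys k. Poly_Mapping.single i (1::nat)"
    \<comment> \<open>Every monomial is a multiple of the squarefree monomial of its own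
      support.\<close>
    have "k = (k - ?s) + ?s"
      by (rule poly_mapping_eqI)
        (simp add: lookup_add lookup_minus lookup_sum_single_1 in_keys_iff del: One_nat_def)
    then have "Poly_Mapping.single k c = Poly_Mapping.single (k - ?s) c * (\<Prod>i\<in>Poly_Mapping.keys k. var i)"
      by (simp add: prod_var mult_single)
    also have "\<dots> \<in> SR_ideal \<Delta>"
      unfolding SR_ideal_def using that by (intro pideal.span_scale pideal.span_base) auto
    finally show ?thesis .
  qed
  with * have "(\<Sum>k\<in>Poly_Mapping.keys p. Poly_Mapping.single k (Poly_Mapping.lookup p k)) \<in> SR_ideal \<Delta>"
    unfolding SR_ideal_def by (intro pideal.span_sum) auto
  then show "p \<in> SR_ideal \<Delta>" by (simp add: sum_single_lookup)
qed

lemma HF_SR_ideal: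
  fixes \<Delta> :: "'v::{finite,linorder} set set"
  assumes sc: "simplicial_complex \<Delta>"
  shows "HF (int i) (SR_ideal \<Delta> :: ('v, 'k::field) mpol set)
    = card {k. mdeg k = i \<and> Poly_Mapping.keys k \<in> \<Delta>}"
proof -
  let ?U = "SR_ideal \<Delta> :: ('v, 'k) mpol set"
  define M where "M = {k::'v \<Rightarrow>\<^sub>0 nat. mdeg k = i \<and> Poly_Mapping.keys k \<in> \<Delta>}"
  define m where "m k = (Poly_Mapping.single k 1 :: ('v, 'k) mpol)" for k
  have inj: "inj_on m M" by (auto simp: inj_on_def m_def) (metis lookup_single_eq lookup_single_not_eq zero_neq_one)
  have finM: "finite M" unfolding M_def by (rule finite_subset[OF _ finite_mdeg[of i]]) auto
  have "pvs.subspace ?U" unfolding SR_ideal_def by (rule pideal_subspace)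
  then obtain \<pi> :: "('v, 'k) mpol \<Rightarrow> ('v, 'k) mpol"
    where lin: "Vector_Spaces.linear smul smul \<pi>" and ker: "\<And>x. \<pi> x = 0 \<longleftrightarrow> x \<in> ?U"
    using ex_linear_with_kernel by blast
  have "quot_basis (hcomp (int i)) ?U (m ` M)"
    unfolding quot_basis_def
  proof (intro conjI allI impI)
    show "m ` M \<subseteq> hcomp (int i)" by (auto simp: m_def M_def hcomp_def)
    show "hcomp (int i) \<subseteq> pvs.span (m ` M \<union> ?U)"
    proof
      fix p :: "('v, 'k) mpol" assume p: "p \<in> hcomp (int i)"
      have "(\<Sum>k\<in>Poly_Mapping.keys p. smul (Poly_Mapping.lookup p k) (m k)) \<in> pvs.span (m ` M \<union> ?U)"
      proof (intro pvs.span_sum pvs.span_scale pvs.span_base)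
        fix k assume "k \<in> Poly_Mapping.keys p"
        then have "mdeg k = i" using p by (auto simp: hcomp_def)
        moreover have "m k \<in> ?U" if "Poly_Mapping.keys k \<notin> \<Delta>"
          using that by (auto simp: SR_ideal_iff[OF sc] m_def)
        ultimately show "m k \<in> m ` M \<union> ?U" by (auto simp: M_def)
      qed
      then show "p \<in> pvs.span (m ` M \<union> ?U)"
        by (simp add: m_def smul_single sum_single_lookup)
    qed
    fix c assume "(\<Sum>b\<in>m ` M. smul (c b) b) \<in> ?U"
    then have U: "(\<Sum>k\<in>M. Poly_Mapping.single k (c (m k))) \<in> ?U"
      by (subst (asm) sum.reindex[OF inj]) (simp add: m_def smul_single)
    have "c (m k) = 0" if k: "k \<in> M" for k
    proof (rule ccontr)
      assume "c (m k) \<noteq> 0"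
      then have "k \<in> Poly_Mapping.keys (\<Sum>k\<in>M. Poly_Mapping.single k (c (m k)))"
        using k finM by (simp add: in_keys_iff lookup_sum lookup_single when_def)
      with U have "Poly_Mapping.keys k \<notin> \<Delta>" unfolding SR_ideal_iff[OF sc] by blast
      with k show False by (simp add: M_def)
    qed
    then show "\<forall>b\<in>m ` M. c b = 0" by auto
  qed (use finM in auto)
  moreover have "finite ((\<lambda>k. Poly_Mapping.single k (1::'k)) ` {k::'v \<Rightarrow>\<^sub>0 nat. mdeg k = nat (int i)})"
    using finite_mdeg by (intro finite_imageI)
  ultimately have "quot_dim (hcomp (int i)) ?U = card (m ` M)"
    using quot_dim_eq_dim_image(1,3)[OF lin ker _ hcomp_subset_span[of "int i"]] by metis
  then show ?thesis
    by (simp add: HF_def card_image[OF inj] M_def[symmetric])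
qed

section \<open>The h-polynomial\<close>

lemma mdeg_add: "mdeg (k + l) = mdeg k + mdeg l"
  by (simp add: mdeg_def lookup_add sum.distrib)

lemma mdeg_single [simp]: "mdeg (Poly_Mapping.single v n) = n"
  by (simp add: mdeg_def lookup_single when_def)

lemma mdeg_zero [simp]: "mdeg 0 = 0"
  by (simp add: mdeg_def)

lemma mdeg_eq_0_iff [simp]: "mdeg k = 0 \<longleftrightarrow> k = 0"
  by (auto simp: mdeg_def intro: poly_mapping_eqI)

lemma nonzero_has_key:
  assumes "p \<noteq> 0"
  obtains k where "k \<in> Poly_Mapping.keys p"
proof -
  have "p = 0" if "Poly_Mapping.keys p = {}"
    using that by (intro poly_mapping_eqI) (auto simp: in_keys_iff)
  with assms that show ?thesis by blast
qed

lemma single_1_eq_iff: "Poly_Mapping.single u (1::nat) = Poly_Mapping.single v 1 \<longleftrightarrow> u = v"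
proof
  assume "Poly_Mapping.single u (1::nat) = Poly_Mapping.single v 1"
  then have "Poly_Mapping.lookup (Poly_Mapping.single u (1::nat)) v = 1" by simp
  then show "u = v" by (simp add: lookup_single when_def split: if_splits)
qed simp

lemma decompose_var:
  fixes k :: "'v \<Rightarrow>\<^sub>0 nat"
  assumes "v \<in> Poly_Mapping.keys k"
  shows "k = (k - Poly_Mapping.single v 1) + Poly_Mapping.single v 1"
  using assms by (intro poly_mapping_eqI) (auto simp: lookup_add lookup_minus lookup_single when_def in_keys_iff)

section \<open>Monomials grouped by their support\<close>

definition monomials :: "'v::finite set \<Rightarrow> nat \<Rightarrow> ('v \<Rightarrow>\<^sub>0 nat) set" where
  "monomials \<sigma> i = {k. mdeg k = i \<and> Poly_Mapping.keys k = \<sigma>}"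

lemma finite_monomials [simp]: "finite (monomials \<sigma> i)"
  by (rule finite_subset[OF _ finite_mdeg[of i]]) (auto simp: monomials_def)

text \<open>Dividing by the variable \<open>v\<close> either leaves \<open>v\<close> in the support
  or removes it.\<close>

lemma card_monomials_insert:
  assumes "v \<notin> \<sigma>"
  shows "card (monomials (insert v \<sigma>) (Suc i)) = card (monomials (insert v \<sigma>) i) + card (monomials \<sigma> i)"
proof -
  let ?s = "\<lambda>k. k + Poly_Mapping.single v (1::nat)"
  have "monomials (insert v \<sigma>) (Suc i) = ?s ` (monomials (insert v \<sigma>) i \<union> monomials \<sigma> i)"
  proof (intro equalityI subsetI)
    fix k assume k: "k \<in> monomials (insert v \<sigma>) (Suc i)"
    define k' where "k' = k - Poly_Mapping.single v 1"
    have e: "k = ?s k'" unfolding k'_def using k by (intro decompose_var) (auto simp: monomials_def)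
    have "mdeg k' = i" using k by (simp add: monomials_def e mdeg_add)
    moreover have "insert v (Poly_Mapping.keys k') = insert v \<sigma>"
      using k by (simp add: monomials_def e keys_plus_nat)
    then have "Poly_Mapping.keys k' = insert v \<sigma> \<or> Poly_Mapping.keys k' = \<sigma>"
      using assms by (cases "v \<in> Poly_Mapping.keys k'") (auto simp: insert_absorb insert_ident)
    ultimately have "k' \<in> monomials (insert v \<sigma>) i \<union> monomials \<sigma> i"
      by (auto simp: monomials_def)
    then show "k \<in> ?s ` (monomials (insert v \<sigma>) i \<union> monomials \<sigma> i)"
      by (rule image_eqI[of k ?s k', OF e])
  next
    fix k assume "k \<in> ?s ` (monomials (insert v \<sigma>) i \<union> monomials \<sigma> i)"
    then obtain k' where k': "k = ?s k'" "k' \<in> monomials (insert v \<sigma>) i \<union> monomials \<sigma> i" by blast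
    then show "k \<in> monomials (insert v \<sigma>) (Suc i)"
      unfolding monomials_def k'(1) mem_Collect_eq mdeg_add keys_plus_nat mdeg_single by auto
  qed
  moreover have "inj ?s" by (auto simp: inj_def)
  moreover have "monomials (insert v \<sigma>) i \<inter> monomials \<sigma> i = {}" using assms by (auto simp: monomials_def)
  ultimately show ?thesis
    by (simp add: card_image[OF inj_on_subset[OF _ subset_UNIV]] card_Un_disjoint)
qed

lemma fps_monomials:
  fixes \<sigma> :: "'v::finite set"
  shows "Abs_fps (\<lambda>i. int (card (monomials \<sigma> i))) * (1 - fps_X) ^ card \<sigma> = fps_X ^ card \<sigma>"
  using finite[of \<sigma>]
proof (induction rule: finite_induct)
  case empty
  have "monomials ({} :: 'v set) i = (if i = 0 then {0} else {})" for i
    by (auto simp: monomials_def)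
  then have "Abs_fps (\<lambda>i. int (card (monomials ({} :: 'v set) i))) = 1"
    by (intro fps_ext) simp
  then show ?case by simp
next
  case (insert v \<sigma>)
  have "monomials (insert v \<sigma>) 0 = {}" by (auto simp: monomials_def)
  then have "Abs_fps (\<lambda>i. int (card (monomials (insert v \<sigma>) i))) * (1 - fps_X)
      = fps_X * Abs_fps (\<lambda>i. int (card (monomials \<sigma> i)))"
    by (intro fps_ext)
      (auto simp: right_diff_distrib fps_X_mult_nth fps_X_mult_right_nth card_monomials_insert[OF insert.hyps(2)]
        gr0_conv_Suc)
  then have "Abs_fps (\<lambda>i. int (card (monomials (insert v \<sigma>) i))) * (1 - fps_X) * (1 - fps_X) ^ card \<sigma>
      = fps_X * (Abs_fps (\<lambda>i. int (card (monomials \<sigma> i))) * (1 - fps_X) ^ card \<sigma>)"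
    by (simp only: mult.assoc)
  then show ?case
    unfolding insert.IH card_insert_disjoint[OF insert.hyps] power_Suc by (simp only: mult.assoc)
qed

text \<open>The usual expression of the h-polynomial through the f-vector, written as a sum over
  faces.\<close>

definition h_explicit :: "'v::finite set set \<Rightarrow> int poly" where
  "h_explicit \<Delta> = (\<Sum>\<sigma>\<in>\<Delta>. monom 1 (card \<sigma>) * [:1, -1:] ^ (Max (card ` \<Delta>) - card \<sigma>))"

lemma h_poly_eq:
  fixes \<Delta> :: "'v::{finite,linorder} set set"
  assumes sc: "simplicial_complex \<Delta>"
  shows "h_poly TYPE('k::field) \<Delta> = h_explicit \<Delta>"
proof -
  let ?D = "Max (card ` \<Delta>)"
  have "HF (int i) (SR_ideal \<Delta> :: ('v, 'k) mpol set) = (\<Sum>\<sigma>\<in>\<Delta>. card (monomials \<sigma> i))" for i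
  proof -
    have "{k. mdeg k = i \<and> Poly_Mapping.keys k \<in> \<Delta>} = (\<Union>\<sigma>\<in>\<Delta>. monomials \<sigma> i)" by (auto simp: monomials_def)
    moreover have "card (\<Union>\<sigma>\<in>\<Delta>. monomials \<sigma> i) = (\<Sum>\<sigma>\<in>\<Delta>. card (monomials \<sigma> i))"
      by (rule card_UN_disjoint) (simp, simp, auto simp: monomials_def)
    ultimately show ?thesis by (simp only: HF_SR_ideal[OF sc])
  qed
  then have "Abs_fps (\<lambda>i. int (HF (int i) (SR_ideal \<Delta> :: ('v, 'k) mpol set)))
      = (\<Sum>\<sigma>\<in>\<Delta>. Abs_fps (\<lambda>i. int (card (monomials \<sigma> i))))"
    by (simp add: fps_eq_iff fps_sum_nth)
  also have "\<dots> * (1 - fps_X) ^ ?D = fps_of_poly (h_explicit \<Delta>)"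
    unfolding h_explicit_def fps_of_poly_sum sum_distrib_right
  proof (rule sum.cong[OF refl])
    fix \<sigma> assume "\<sigma> \<in> \<Delta>"
    then have "?D = card \<sigma> + (?D - card \<sigma>)" using card_le_Max_card[of \<sigma> \<Delta>] by simp
    then have "(1 - fps_X :: int fps) ^ ?D = (1 - fps_X) ^ card \<sigma> * (1 - fps_X) ^ (?D - card \<sigma>)"
      by (metis power_add)
    then have "Abs_fps (\<lambda>i. int (card (monomials \<sigma> i))) * (1 - fps_X) ^ ?D
        = Abs_fps (\<lambda>i. int (card (monomials \<sigma> i))) * (1 - fps_X) ^ card \<sigma> * (1 - fps_X) ^ (?D - card \<sigma>)"
      by (simp only: mult.assoc)
    also have "\<dots> = fps_X ^ card \<sigma> * (1 - fps_X) ^ (?D - card \<sigma>)"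
      by (simp only: fps_monomials)
    also have "\<dots> = fps_X ^ card \<sigma> * fps_of_poly [:1, -1:] ^ (?D - card \<sigma>)"
    proof -
      have "(1 - fps_X :: int fps) = fps_of_poly [:1, -1:]"
        by (rule fps_ext) (auto simp: coeff_pCons split: nat.split)
      then show ?thesis by (simp only:)
    qed
    finally show "Abs_fps (\<lambda>i. int (card (monomials \<sigma> i))) * (1 - fps_X) ^ ?D
        = fps_of_poly (monom 1 (card \<sigma>) * [:1, -1:] ^ (?D - card \<sigma>))"
      by (simp only: fps_of_poly_mult fps_of_poly_monom' fps_of_poly_power)
  qed
  finally have h: "fps_of_poly (h_explicit \<Delta>) =
      Abs_fps (\<lambda>i. int (HF (int i) (SR_ideal \<Delta> :: ('v, 'k) mpol set))) * (1 - fps_X) ^ nat (cx_dim \<Delta> + 1)"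
    by (simp add: cx_dim_def)
  show ?thesis
    unfolding h_poly_def h[symmetric] by (rule the_equality) (simp_all add: fps_of_poly_eq_iff)
qed

text \<open>Expand \<open>x = 1 - (1 - x)\<close> in the power belonging to \<sigma> over the
  subsets of \<sigma>, then exchange the sums. The coefficients are, up to sign, the reduced Euler
  characteristics of the links.\<close>

lemma h_explicit_star:
  fixes \<Delta> :: "'v::{finite,linorder} set set"
  assumes sc: "simplicial_complex \<Delta>"
  shows "h_explicit \<Delta> = (\<Sum>\<tau>\<in>\<Delta>. smult ((-1) ^ card \<tau> * (\<Sum>\<sigma>\<in>{\<sigma> \<in> \<Delta>. \<tau> \<subseteq> \<sigma>}. (-1) ^ card \<sigma>))
    ([:1, -1:] ^ (Max (card ` \<Delta>) - card \<tau>)))"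
proof -
  let ?D = "Max (card ` \<Delta>)"
  let ?y = "[:1, -1:] :: int poly"
  have "h_explicit \<Delta> = (\<Sum>\<sigma>\<in>\<Delta>. \<Sum>\<tau>\<in>{\<tau> \<in> \<Delta>. \<tau> \<subseteq> \<sigma>}. smult ((-1) ^ card \<tau> * (-1) ^ card \<sigma>) (?y ^ (?D - card \<tau>)))"
    unfolding h_explicit_def
  proof (rule sum.cong[OF refl])
    fix \<sigma> assume \<sigma>: "\<sigma> \<in> \<Delta>"
    have "monom 1 (card \<sigma>) = (1 + - ?y) ^ card \<sigma>"
      by (simp add: monom_altdef one_pCons)
    also have "\<dots> = (\<Sum>\<tau>\<in>Pow \<sigma>. (- ?y) ^ card (\<sigma> - \<tau>))"
      using prod_add[of \<sigma> "\<lambda>_. 1" "\<lambda>_. - ?y"] by simp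
    finally have "monom 1 (card \<sigma>) * ?y ^ (?D - card \<sigma>)
      = (\<Sum>\<tau>\<in>Pow \<sigma>. (- ?y) ^ card (\<sigma> - \<tau>) * ?y ^ (?D - card \<sigma>))" by (simp add: sum_distrib_right)
    also have "\<dots> = (\<Sum>\<tau>\<in>{\<tau> \<in> \<Delta>. \<tau> \<subseteq> \<sigma>}. smult ((-1) ^ card \<tau> * (-1) ^ card \<sigma>) (?y ^ (?D - card \<tau>)))"
    proof (rule sum.cong)
      show "Pow \<sigma> = {\<tau> \<in> \<Delta>. \<tau> \<subseteq> \<sigma>}" using face_subset[OF sc \<sigma>] by auto
      fix \<tau> assume "\<tau> \<in> {\<tau> \<in> \<Delta>. \<tau> \<subseteq> \<sigma>}"
      then have \<tau>: "\<tau> \<subseteq> \<sigma>" by simp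
      have c: "card \<sigma> = card \<tau> + card (\<sigma> - \<tau>)" "card \<sigma> \<le> ?D"
        using card_mono[OF _ \<tau>] card_le_Max_card[OF \<sigma>] \<tau> by (simp_all add: card_Diff_subset)
      then have "?D - card \<tau> = card (\<sigma> - \<tau>) + (?D - card \<sigma>)" by linarith
      then have y: "?y ^ (?D - card \<tau>) = ?y ^ card (\<sigma> - \<tau>) * ?y ^ (?D - card \<sigma>)" by (metis power_add)
      have s: "(-1::int) ^ card \<tau> * (-1) ^ card \<sigma> = (-1) ^ card (\<sigma> - \<tau>)"
        unfolding c(1) power_add by (simp add: mult.assoc[symmetric] power_mult_distrib[symmetric])
      have "(- y) ^ n = smult ((-1) ^ n) (y ^ n)" for y :: "int poly" and n
      proof -
        have "- y = smult (- 1) y" by simp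
        then show ?thesis by (simp only: smult_power)
      qed
      then show "(- ?y) ^ card (\<sigma> - \<tau>) * ?y ^ (?D - card \<sigma>)
        = smult ((-1) ^ card \<tau> * (-1) ^ card \<sigma>) (?y ^ (?D - card \<tau>))"
        unfolding s y by (simp only: mult_smult_left)
    qed
    finally show "monom 1 (card \<sigma>) * ?y ^ (?D - card \<sigma>)
      = (\<Sum>\<tau>\<in>{\<tau> \<in> \<Delta>. \<tau> \<subseteq> \<sigma>}. smult ((-1) ^ card \<tau> * (-1) ^ card \<sigma>) (?y ^ (?D - card \<tau>)))" .
  qed
  also have "\<dots> = (\<Sum>\<tau>\<in>\<Delta>. \<Sum>\<sigma>\<in>{\<sigma> \<in> \<Delta>. \<tau> \<subseteq> \<sigma>}. smult ((-1) ^ card \<tau> * (-1) ^ card \<sigma>) (?y ^ (?D - card \<tau>)))"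
    by (rule sum.swap_restrict) auto
  finally show ?thesis by (simp add: smult_sum[symmetric] sum_distrib_left)
qed

text \<open>If all faces with at most D - deg h elements had links without top homology, their
  coefficients would vanish. Only powers of \<open>1 - x\<close> below deg h would remain, too few
  to reach the degree of h.\<close>

lemma ex_nonacyclic_link:
  fixes \<Delta> :: "'v::{finite,linorder} set set"
  assumes sc: "simplicial_complex \<Delta>" and cm: "cohen_macaulay TYPE('k::field) \<Delta>"
  shows "\<exists>\<tau>\<in>\<Delta>. card \<tau> + degree (h_explicit \<Delta>) \<le> Max (card ` \<Delta>) \<and>
    \<not> red_homology_zero TYPE('k) (link \<Delta> \<tau>) (int (Max (card ` \<Delta>)) - int (card \<tau>) - 1)"
proof (rule ccontr)
  assume *: "\<not> ?thesis"
  let ?D = "Max (card ` \<Delta>)"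
  define h where "h = h_explicit \<Delta>"
  define X where "X \<tau> = (-1) ^ card \<tau> * (\<Sum>\<sigma>\<in>{\<sigma> \<in> \<Delta>. \<tau> \<subseteq> \<sigma>}. (-1) ^ card \<sigma> :: int)" for \<tau>
  have hX: "h = (\<Sum>\<tau>\<in>\<Delta>. smult (X \<tau>) ([:1, -1:] ^ (?D - card \<tau>)))"
    unfolding h_def X_def by (rule h_explicit_star[OF sc])
  have X0: "X \<tau> = 0" if "\<tau> \<in> \<Delta>" "card \<tau> + degree h \<le> ?D" for \<tau>
    using * that sum_star_eq_0[OF sc cm that(1)] unfolding X_def h_def by auto
  have deg1: "degree ([:1, -1:] ^ n :: int poly) \<le> n" for n
    using degree_power_le[of "[:1, -1:] :: int poly" n] by simp
  have bound: "degree h \<le> ?D"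
    unfolding hX by (intro degree_sum_le order.trans[OF degree_smult_le] order.trans[OF deg1]) auto
  \<comment> \<open>This settles degree 0, where the degree cannot drop further: the value at 1
    counts the faces with D elements, of which there is at least one.\<close>
  have h1: "poly h 1 \<noteq> 0"
  proof -
    have "poly h 1 = (\<Sum>\<sigma>\<in>\<Delta>. if card \<sigma> = ?D then 1 else 0)"
      unfolding h_def h_explicit_def poly_sum
    proof (rule sum.cong[OF refl])
      fix \<sigma> assume "\<sigma> \<in> \<Delta>"
      from card_le_Max_card[OF this] show "poly (monom 1 (card \<sigma>) * [:1, - 1:] ^ (?D - card \<sigma>)) 1 = (if card \<sigma> = ?D then 1 else 0 :: int)"
        by (auto simp: poly_monom poly_power)
    qed
    also have "\<dots> = int (card {\<sigma> \<in> \<Delta>. card \<sigma> = ?D})"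
      by (subst sum.inter_filter[symmetric]) simp_all
    also have "\<dots> \<noteq> 0"
    proof -
      have "?D \<in> card ` \<Delta>" using sc by (intro Max_in) (auto simp: simplicial_complex_def)
      then show ?thesis by auto
    qed
    finally show ?thesis .
  qed
  show False
  proof (cases "degree h")
    case 0
    then have "h = 0" using X0 card_le_Max_card[of _ \<Delta>] by (subst hX) (auto intro!: sum.neutral)
    with h1 show False by simp
  next
    case (Suc n)
    have "degree h \<le> n"
      unfolding hX
    proof (rule degree_sum_le)
      fix \<tau> assume \<tau>: "\<tau> \<in> \<Delta>"
      show "degree (smult (X \<tau>) ([:1, - 1:] ^ (?D - card \<tau>))) \<le> n"
      proof (cases "card \<tau> + degree h \<le> ?D")
        case True
        then show ?thesis using X0[OF \<tau>] by simp
      next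
        case False
        then have "?D - card \<tau> \<le> n" using Suc by simp
        then show ?thesis by (intro order.trans[OF degree_smult_le] order.trans[OF deg1])
      qed
    qed simp
    with Suc show False by simp
  qed
qed

section \<open>Reduction to the sum of the variables\<close>

lemma ex_divisor_of_mdeg:
  "n \<le> mdeg k \<Longrightarrow> \<exists>k1 l. k = k1 + l \<and> mdeg k1 = n"
proof (induction n)
  case 0
  show ?case by (intro exI[of _ 0] exI[of _ k]) simp
next
  case (Suc n)
  then obtain k1 l where k: "k = k1 + l" "mdeg k1 = n" by auto
  then have "l \<noteq> 0" using Suc.prems by (auto simp: mdeg_add)
  then obtain v where "v \<in> Poly_Mapping.keys l" by (rule nonzero_has_key)
  from decompose_var[OF this] k have "k = (k1 + Poly_Mapping.single v 1) + (l - Poly_Mapping.single v 1)"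
    by (simp add: ac_simps)
  with k(2) show ?case by (metis mdeg_add mdeg_single Suc_eq_plus1)
qed

lemma linear_form_keys:
  assumes "ell \<in> hcomp 1" shows "Poly_Mapping.keys ell \<subseteq> range (\<lambda>v. Poly_Mapping.single v 1)"
proof
  fix k assume "k \<in> Poly_Mapping.keys ell"
  then have 1: "mdeg k = 1" using assms by (auto simp: hcomp_def)
  then have "k \<noteq> 0" by auto
  then obtain v where v: "v \<in> Poly_Mapping.keys k" by (rule nonzero_has_key)
  from decompose_var[OF this] 1 have "k - Poly_Mapping.single v 1 = 0"
    by (metis add_cancel_left_left mdeg_add mdeg_eq_0_iff mdeg_single)
  with decompose_var[OF v] show "k \<in> range (\<lambda>v. Poly_Mapping.single v 1)" by (metis add_0 rangeI)
qed

lemma pairing_linear_form: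
  assumes "ell \<in> hcomp 1"
  shows "pairing ell \<phi> = (\<Sum>v\<in>UNIV. Poly_Mapping.lookup ell (Poly_Mapping.single v 1) * \<phi> (Poly_Mapping.single v 1))"
proof -
  have inj: "inj (\<lambda>v::'a. Poly_Mapping.single v (1::nat))"
    by (rule injI) (simp only: single_1_eq_iff)
  show ?thesis
    using pairing_superset[OF _ linear_form_keys[OF assms], of \<phi>]
    by (simp add: sum.reindex[OF inj] del: One_nat_def)
qed

text \<open>The ideal is spanned by monomials, so a functional that kills it vanishes at each of
  them. Rescaling values or shrinking the support preserves this.\<close>

lemma pairing_power_ideal_mono:
  fixes \<Delta> :: "'v::{finite,linorder} set set" and \<phi> \<psi> :: "('v \<Rightarrow>\<^sub>0 nat) \<Rightarrow> 'k::field"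
  assumes sc: "simplicial_complex \<Delta>"
    and \<phi>: "\<And>p. p \<in> power_ideal \<Delta> a \<Longrightarrow> pairing p \<phi> = 0" and \<psi>: "\<And>k. \<phi> k = 0 \<Longrightarrow> \<psi> k = 0"
    and p: "p \<in> power_ideal \<Delta> a"
  shows "pairing p \<psi> = 0"
  using p unfolding power_ideal_def
proof (induction rule: pideal.span_induct_alt)
  case (step c x y)
  have mon: "\<psi> (l + k) = 0" if "Poly_Mapping.single k 1 \<in> SR_ideal \<Delta> \<union> range (\<lambda>i. (var i :: ('v, 'k) mpol) ^ a i)" for k l
  proof -
    have "Poly_Mapping.single l 1 * Poly_Mapping.single k (1::'k) \<in> power_ideal \<Delta> a"
      unfolding power_ideal_def using that by (intro pideal.span_scale pideal.span_base)
    from \<phi>[OF this] show ?thesis by (intro \<psi>) (simp add: mult_single)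
  qed
  have "pairing x (\<lambda>k. \<psi> (l + k)) = 0" for l
  proof -
    have "Poly_Mapping.single k 1 \<in> SR_ideal \<Delta> \<union> range (\<lambda>i. (var i :: ('v, 'k) mpol) ^ a i)"
      if "k \<in> Poly_Mapping.keys x" for k
      using step.hyps that by (auto simp: SR_ideal_iff[OF sc] var_power)
    then show ?thesis by (simp add: pairing_def mon)
  qed
  then have "pairing (c * x) \<psi> = 0" by (simp add: pairing_mult)
  with step.IH show ?case by (simp add: pairing_add)
qed simp

text \<open>If every linear form had all coefficients nonzero, rescaling the variables would carry
  \<open>L\<close> to it. In general only the part of \<open>\<phi>\<close> of highest degree in the variables missing from
  \<open>ell\<close> is rescaled: this is the limit of the rescaled functionals when the missing
  coefficients tend to zero, and it makes sense over every field.\<close>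

lemma not_surj_linear_form:
  fixes \<Delta> :: "'v::{finite,linorder} set set" and \<phi> :: "('v \<Rightarrow>\<^sub>0 nat) \<Rightarrow> 'k::field"
    and ell :: "('v, 'k) mpol"
  assumes sc: "simplicial_complex \<Delta>"
    and J: "\<And>p. p \<in> power_ideal \<Delta> a \<Longrightarrow> pairing p \<phi> = 0"
    and L: "\<And>p. pairing (sum_vars * p) \<phi> = 0"
    and k1: "\<phi> k1 \<noteq> 0" "int (mdeg k1) = t"
    and ell: "ell \<in> hcomp 1"
  shows "\<not> mult_surj (power_ideal \<Delta> a) ell (t - 1)"
proof
  assume surj: "mult_surj (power_ideal \<Delta> a) ell (t - 1)"
  define c where "c v = Poly_Mapping.lookup ell (Poly_Mapping.single v 1)" for v
  define deg_missing where "deg_missing k = (\<Sum>v | c v = 0. Poly_Mapping.lookup k v)" for k :: "'v \<Rightarrow>\<^sub>0 nat"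
  \<comment> \<open>Replacing each variable by its multiple with the coefficient from
    \<open>ell\<close> multiplies a monomial by this factor; missing variables are left
    alone.\<close>
  define cm where "cm k = (\<Prod>v | c v \<noteq> 0. c v ^ Poly_Mapping.lookup k v)" for k :: "'v \<Rightarrow>\<^sub>0 nat"
  define S where "S = {k. mdeg k = mdeg k1 \<and> \<phi> k \<noteq> 0}"
  define N where "N = Max (deg_missing ` S)"
  have finS: "finite S" unfolding S_def by (rule finite_subset[OF _ finite_mdeg]) auto
  have "N \<in> deg_missing ` S" unfolding N_def using finS k1 by (intro Max_in) (auto simp: S_def)
  then obtain k2 where k2: "k2 \<in> S" "deg_missing k2 = N" by auto
  have Nmax: "\<phi> k = 0" if "mdeg k = mdeg k1" "deg_missing k > N" for k
  proof (rule ccontr)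
    assume "\<phi> k \<noteq> 0"
    then have "deg_missing k \<le> N" unfolding N_def using that finS by (intro Max_ge) (auto simp: S_def)
    with that show False by simp
  qed
  have cm_nz: "cm k \<noteq> 0" for k by (auto simp: cm_def)
  define \<psi> where "\<psi> k = (if mdeg k = mdeg k1 \<and> deg_missing k = N then \<phi> k / cm k else 0)" for k
  have deg_missing_add: "deg_missing (k + Poly_Mapping.single v 1) = deg_missing k + (if c v = 0 then 1 else 0)" for k v
    by (simp add: deg_missing_def lookup_add sum.distrib lookup_single when_def)
  have cm_add: "cm (k + Poly_Mapping.single v 1) = cm k * c v" if "c v \<noteq> 0" for k v
  proof -
    have "(\<Prod>u | c u \<noteq> 0. c u ^ Poly_Mapping.lookup (Poly_Mapping.single v (1::nat)) u) = (\<Prod>u | c u \<noteq> 0. if u = v then c u else 1)"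
      by (intro prod.cong) (auto simp: lookup_single when_def)
    also have "\<dots> = c v" using that by simp
    finally show ?thesis by (simp add: cm_def lookup_add power_add prod.distrib)
  qed
  \<comment> \<open>If \<open>deg_missing k = N\<close>, a missing variable leads above
    \<open>N\<close>, where \<phi> vanishes; for the others \<open>c v\<close> cancels, and what
    remains is the value of \<phi> on a multiple of L. Otherwise only a missing variable could reach
    \<open>N\<close>, and its coefficient is 0.\<close>
  have main: "(\<Sum>v\<in>UNIV. c v * \<psi> (k + Poly_Mapping.single v 1)) = 0" if k: "Suc (mdeg k) = mdeg k1" for k
  proof (cases "deg_missing k = N")
    case False
    have "c v * \<psi> (k + Poly_Mapping.single v 1) = 0" for v
      using False by (auto simp: \<psi>_def deg_missing_add simp del: One_nat_def)
    then show ?thesis by (intro sum.neutral) blast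
  next
    case True
    have "c v * \<psi> (k + Poly_Mapping.single v 1) = \<phi> (k + Poly_Mapping.single v 1) / cm k" for v
    proof (cases "c v = 0")
      case True
      then show ?thesis using Nmax[of "k + Poly_Mapping.single v 1"] k \<open>deg_missing k = N\<close>
        by (simp add: deg_missing_add mdeg_add del: One_nat_def)
    next
      case False
      then show ?thesis using k \<open>deg_missing k = N\<close> cm_nz[of k] by (simp add: \<psi>_def deg_missing_add mdeg_add cm_add del: One_nat_def)
    qed
    then have "(\<Sum>v\<in>UNIV. c v * \<psi> (k + Poly_Mapping.single v 1))
        = (\<Sum>v\<in>UNIV. \<phi> (k + Poly_Mapping.single v 1)) / cm k" by (simp add: sum_divide_distrib)
    also have "(\<Sum>v\<in>UNIV. \<phi> (k + Poly_Mapping.single v 1)) = pairing (sum_vars * Poly_Mapping.single k 1) \<phi>"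
      by (simp add: pairing_mult sum_vars_def pairing_sum var_def add.commute)
    finally show ?thesis by (simp add: L)
  qed
  have "Poly_Mapping.single k2 1 \<in> hcomp (t - 1 + 1)" using k1 k2 by (simp add: hcomp_def S_def)
  then obtain q where q: "q \<in> hcomp (t - 1)" "ell * q - Poly_Mapping.single k2 1 \<in> power_ideal \<Delta> a"
    using surj unfolding mult_surj_def by blast
  have "pairing (ell * q - Poly_Mapping.single k2 1) \<psi> = 0"
    by (rule pairing_power_ideal_mono[OF sc J _ q(2)]) (auto simp: \<psi>_def)
  moreover have "pairing (ell * q) \<psi> = 0"
  proof -
    have "pairing (ell * q) \<psi> = pairing q (\<lambda>k. pairing ell (\<lambda>l. \<psi> (k + l)))"
      by (subst mult.commute) (rule pairing_mult)
    also have "\<dots> = pairing q (\<lambda>_. 0)"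
    proof (rule pairing_cong)
      fix k assume "k \<in> Poly_Mapping.keys q"
      then have "int (mdeg k) = t - 1" using q(1) by (auto simp: hcomp_def)
      then have "Suc (mdeg k) = mdeg k1" using k1(2) by linarith
      from main[OF this] show "pairing ell (\<lambda>l. \<psi> (k + l)) = 0"
        by (simp add: pairing_linear_form[OF ell] c_def)
    qed
    finally show ?thesis by simp
  qed
  ultimately have "\<psi> k2 = 0" by (simp add: pairing_diff)
  with k2 cm_nz show False by (auto simp: \<psi>_def S_def)
qed

section \<open>From full rank to surjectivity, and degrees of forms\<close>

lemma hcomp_mult: "p \<in> hcomp i \<Longrightarrow> q \<in> hcomp j \<Longrightarrow> p * q \<in> hcomp (i + j)"
  using keys_mult[of p q] by (fastforce simp: hcomp_def mdeg_add)

lemma subspace_hcomp: "pvs.subspace (hcomp i :: ('a::finite, 'b::field) mpol set)"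
proof -
  have "p + q \<in> hcomp i" if "p \<in> hcomp i" "q \<in> hcomp i" for p q :: "('a, 'b) mpol"
    using that Poly_Mapping.keys_add[of p q] by (auto simp: hcomp_def)
  moreover have "smul c p \<in> hcomp i" if "p \<in> hcomp i" for c and p :: "('a, 'b) mpol"
  proof -
    have "Poly_Mapping.keys (smul c p) \<subseteq> Poly_Mapping.keys p"
      by (auto simp: in_keys_iff lookup_smul)
    then show ?thesis using that by (auto simp: hcomp_def)
  qed
  moreover have "(0 :: ('a, 'b) mpol) \<in> hcomp i" by (simp add: hcomp_def)
  ultimately show ?thesis unfolding pvs.subspace_def by blast
qed

lemma full_rank_imp_surj:
  fixes ell :: "('v::finite, 'k::field) mpol"
  assumes U: "pvs.subspace J" and ell: "ell \<in> hcomp 1"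
    and le: "HF (i + 1) J \<le> HF i J" and fr: "mult_full_rank J ell i"
  shows "mult_surj J ell i"
  unfolding mult_surj_def
proof
  fix p :: "('v, 'k) mpol" assume p: "p \<in> hcomp (i + 1)"
  have "\<exists>w\<in>(*) ell ` hcomp i. w - p \<in> J"
  proof (rule quot_dim_eq_imp_subset[OF U _ _ _ hcomp_subset_span _ p])
    show "pvs.subspace ((*) ell ` hcomp i)"
    proof -
      have "Vector_Spaces.linear smul smul ((*) ell)"
        by unfold_locales (simp_all add: smul_def algebra_simps)
      then interpret M: Vector_Spaces.linear smul smul "(*) ell" .
      show ?thesis by (rule M.subspace_image[OF subspace_hcomp])
    qed
    show "(*) ell ` hcomp i \<subseteq> hcomp (i + 1)"
      using hcomp_mult[OF ell, of _ i] by (auto simp: add.commute)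
    show "finite ((\<lambda>k. Poly_Mapping.single k 1) ` {k. mdeg k = nat (i + 1)})"
      using finite_mdeg by (intro finite_imageI)
    show "quot_dim ((*) ell ` hcomp i) J = quot_dim (hcomp (i + 1)) J"
      using fr le by (simp add: mult_full_rank_def HF_def)
  qed
  then show "\<exists>q\<in>hcomp i. ell * q - p \<in> J" by auto
qed

lemma sum_vars_hcomp: "sum_vars \<in> hcomp 1"
proof -
  have "Poly_Mapping.keys (sum_vars :: ('a, 'b) mpol) \<subseteq> (\<Union>i\<in>UNIV. Poly_Mapping.keys (var i :: ('a, 'b) mpol))"
    unfolding sum_vars_def by (rule keys_sum)
  then have "Poly_Mapping.keys (sum_vars :: ('a, 'b) mpol) \<subseteq> range (\<lambda>i. Poly_Mapping.single i 1)"
    by (simp add: var_def) blast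
  then show ?thesis by (auto simp: hcomp_def)
qed

text \<open>Distinct variables do not cancel in any characteristic, so L is nonzero. Hence its
  degree is 1 rather than the default 0, and (U5) compares the degrees t and t - 1.\<close>

lemma tdeg_sum_vars: "tdeg (sum_vars :: ('v::finite, 'k::field) mpol) = 1"
proof -
  let ?L = "sum_vars :: ('v, 'k) mpol"
  have "pairing ?L (\<lambda>k. if k = Poly_Mapping.single v 1 then 1 else 0) = 1" for v
  proof -
    have "pairing ?L (\<lambda>k. if k = Poly_Mapping.single v 1 then 1 else 0) = (\<Sum>u\<in>UNIV. if u = v then 1 else 0)"
      unfolding sum_vars_def pairing_sum var_def pairing_single single_1_eq_iff by simp
    then show ?thesis by simp
  qed
  then have "?L \<noteq> 0" by (metis pairing_zero zero_neq_one)
  then obtain k where k: "k \<in> Poly_Mapping.keys ?L" by (rule nonzero_has_key)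
  have "mdeg ` Poly_Mapping.keys ?L \<subseteq> {1}" using sum_vars_hcomp by (auto simp: hcomp_def)
  then have "mdeg ` Poly_Mapping.keys ?L = {} \<or> mdeg ` Poly_Mapping.keys ?L = {1}"
    by (rule subset_singletonD)
  then have "mdeg ` Poly_Mapping.keys ?L = {1}"
    using k unfolding image_is_empty by (elim disjE) (simp_all only: empty_iff)
  then show ?thesis by (simp add: tdeg_def)
qed

lemma mdeg_homogeneous:
  assumes "homogeneous p" "tdeg p > 0" "k \<in> Poly_Mapping.keys p"
  shows "mdeg k = tdeg p"
proof -
  obtain i where i: "p \<in> hcomp i" using assms(1) by (auto simp: homogeneous_def)
  then have "int (mdeg l) = int (mdeg k)" if "l \<in> Poly_Mapping.keys p" for l
    using assms(3) that by (simp add: hcomp_def)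
  then have "mdeg ` Poly_Mapping.keys p \<subseteq> {mdeg k}" by auto
  then have "mdeg ` Poly_Mapping.keys p = {mdeg k}" using assms(3) by auto
  then show ?thesis by (simp add: tdeg_def)
qed

theorem proposition3p3:
  fixes \<Delta> :: "'v::{finite,linorder} set set"
    and a :: "'v \<Rightarrow> nat"
    and t :: int
    and \<theta> :: "('v, 'k::field) mpol list"
  assumes "simplicial_complex \<Delta>"
    and "cohen_macaulay TYPE('k) \<Delta>"
    and "unexpected_sop \<Delta> sum_vars a t \<theta>"
  shows "fails_WLP_surjectivity (power_ideal \<Delta> a :: ('v, 'k) mpol set) (t - 1)"
proof -
  note sc = assms(1) and cm = assms(2)
  let ?D = "Max (card ` \<Delta>)"
  let ?J = "power_ideal \<Delta> a :: ('v, 'k) mpol set"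
  let ?Q = "sop_ideal \<Delta> \<theta>"
  define deg where "deg i = tdeg (\<theta> ! i)" for i
  have len: "length \<theta> = ?D" and hom: "\<And>p. p \<in> set \<theta> \<Longrightarrow> homogeneous p \<and> tdeg p > 0"
    using assms(3) by (auto simp: unexpected_sop_def hsop_def cx_dim_def)
  have t: "t = (\<Sum>i<?D. int (deg i)) + int (degree (h_explicit \<Delta>)) - int ?D"
    using assms(3) by (simp add: unexpected_sop_def h_poly_eq[OF sc] cx_dim_def deg_def
        sum_list_sum_nth len atLeast0LessThan)
  \<comment> \<open>Degrees are integers here; this guarantees that \<open>nat t\<close> below loses
    nothing.\<close>
  have t0: "t \<ge> 0" using assms(3) by (simp add: unexpected_sop_def)
  have LQ: "sum_vars \<in> ?Q" and xQ: "\<And>v. var v ^ a v \<in> ?Q" and HF: "HF t ?J \<le> HF (t - 1) ?J"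
    using assms(3) by (auto simp: unexpected_sop_def tdeg_sum_vars)
  interpret parameter_system \<Delta> \<theta> a deg
    by unfold_locales (use sc hom xQ in \<open>auto simp: deg_def intro: mdeg_homogeneous\<close>)
  have D: "D = ?D" by (simp add: D_def len)
  define bad where "bad \<tau> \<longleftrightarrow> \<tau> \<in> \<Delta> \<and> \<not> red_homology_zero TYPE('k) (link \<Delta> \<tau>) (int D - int (card \<tau>) - 1)" for \<tau>
  obtain \<tau>0 where \<tau>0: "bad \<tau>0" "card \<tau>0 + degree (h_explicit \<Delta>) \<le> ?D"
    using ex_nonacyclic_link[OF sc cm] unfolding bad_def D by blast
  \<comment> \<open>The face \<open>\<tau>0\<close> supplies the size bound, but
    \<open>survives_top\<close> demands least cardinality; a minimal choice inherits the
    bound.\<close>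
  obtain \<tau> where \<tau>: "bad \<tau>" "\<And>\<sigma>. bad \<sigma> \<Longrightarrow> card \<tau> \<le> card \<sigma>"
    using ex_has_least_nat[of bad, OF \<tau>0(1), of card] by blast
  have "\<exists>w. survives (- int (card \<tau>)) D w"
  proof (rule survives_top)
    show "\<tau> \<in> \<Delta>" "\<not> red_homology_zero TYPE('k) (link \<Delta> \<tau>) (int D - int (card \<tau>) - 1)"
      using \<tau>(1) by (auto simp: bad_def)
    show "red_homology_zero TYPE('k) (link \<Delta> \<sigma>) (int D - int (card \<sigma>) - 1)"
      if "\<sigma> \<in> \<Delta>" "card \<sigma> < card \<tau>" for \<sigma>
      using \<tau>(2)[of \<sigma>] that by (auto simp: bad_def)
    show "card \<sigma> \<le> D" if "\<sigma> \<in> \<Delta>" for \<sigma> using card_le_Max_card[OF that] by (simp add: D)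
  qed
  then obtain w where "survives (- int (card \<tau>)) D w" ..
  from survives_0[OF cohen_macaulay_link_homology[OF sc cm, folded D] this]
  obtain w0 where "survives (- int (card \<tau>)) 0 w0" by blast
  from functional_of_survives_0[OF this] obtain \<phi> k0 where \<phi>: "\<phi> k0 \<noteq> 0"
    "int (mdeg k0) = - int (card \<tau>) + (\<Sum>i<D. int (deg i))" "\<And>p. p \<in> ?Q \<Longrightarrow> pairing p \<phi> = 0" by blast
  have "t \<le> int (mdeg k0)"
    using \<tau>(2)[OF \<tau>0(1)] \<tau>0(2) unfolding \<phi>(2) t D by linarith
  then have "nat t \<le> mdeg k0" by linarith
  then obtain k1 l where k1: "k0 = k1 + l" "mdeg k1 = nat t" using ex_divisor_of_mdeg by blast
  \<comment> \<open>The monomial \<open>k0\<close> may lie above degree t. Precomposing with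
    multiplication by the monomial of \<open>l\<close> moves the functional down to degree t, and it
    still kills the ideal, which is closed under multiplication.\<close>
  define \<psi> where "\<psi> k = \<phi> (k + l)" for k
  have \<psi>Q: "pairing p \<psi> = 0" if "p \<in> ?Q" for p
  proof -
    have "Poly_Mapping.single l 1 * p \<in> ?Q"
      using that unfolding sop_ideal_def by (rule pideal.span_scale)
    from \<phi>(3)[OF this] show ?thesis by (simp add: pairing_mult \<psi>_def[abs_def] add.commute)
  qed
  have JQ: "?J \<subseteq> ?Q"
    unfolding power_ideal_def
  proof (rule pideal.span_minimal)
    show "SR_ideal \<Delta> \<union> range (\<lambda>i. var i ^ a i) \<subseteq> ?Q"
      using xQ by (auto simp: sop_ideal_def intro: pideal.span_base)
    show "pideal.subspace ?Q" unfolding sop_ideal_def by (rule pideal.subspace_span)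
  qed
  have ns: "\<not> mult_surj ?J ell (t - 1)" if "ell \<in> hcomp 1" for ell
  proof (rule not_surj_linear_form[OF sc _ _ _ _ that, where \<phi> = \<psi>])
    show "pairing p \<psi> = 0" if "p \<in> ?J" for p using \<psi>Q that JQ by blast
    show "pairing (sum_vars * p) \<psi> = 0" for p
    proof (rule \<psi>Q)
      show "sum_vars * p \<in> ?Q"
        using LQ pideal.span_scale[of sum_vars _ p] by (simp add: sop_ideal_def mult.commute)
    qed
    show "\<psi> k1 \<noteq> 0" using \<phi>(1) k1(1) by (simp add: \<psi>_def)
    show "int (mdeg k1) = t" using k1(2) t0 by simp
  qed
  have "pvs.subspace ?J" unfolding power_ideal_def by (rule pideal_subspace)
  have "\<not> WLP ?J"
  proof
    assume "WLP ?J"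
    then obtain ell where ell: "ell \<in> hcomp 1" "mult_full_rank ?J ell (t - 1)" by (auto simp: WLP_def)
    have "mult_surj ?J ell (t - 1)"
      using HF by (intro full_rank_imp_surj[OF \<open>pvs.subspace ?J\<close> ell(1) _ ell(2)]) simp
    with ns[OF ell(1)] show False ..
  qed
  with HF ns[OF sum_vars_hcomp] show ?thesis by (simp add: fails_WLP_surjectivity_def)
qed

end
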